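(* Let $n\ge2$, let $a_1,\dots,a_n>0$ and let $b_{ij}\ge0$ for $1\le i<j\le n$ be such that the graph on $\{1,\dots,n\}$ with edge set $\{\{i,j\}: b_{ij}>0\}$ is connected. Put $$w_N=\sum_{i=1}^n a_i\,s_{\{i\}},\qquad w_T=\sum_{1\le i<j\le n}b_{ij}\,(ij)$$ in $\mathbb CW_n$. Then there is $\varepsilon_0>0$ such that for all $0<\varepsilon<\varepsilon_0$: (1) $\psi_{W_n}(w_N+\varepsilon w_T)=\psi_{W_n}(w_N+\varepsilon w_T,\widetilde{\mathrm D}_n^0)<\psi_{W_n}(w_N+\varepsilon w_T,\mathrm D_n)$; (2) $\psi_{W_n}(\varepsilon w_N+w_T)=\psi_{W_n}(\varepsilon w_N+w_T,\mathrm D_n)<\psi_{W_n}(\varepsilon w_N+w_T,\widetilde{\mathrm D}_n^0)$. In particular, neither of the identities $\psi_{W_n}(w)=\psi_{W_n}(w,\mathrm D_n)$ and $\psi_{W_n}(w)=\psi_{W_n}(w,\widetilde{\mathrm D}_n^0)$ holds for all $w$ of the form $\sum_i a_i s_{\{i\}}+\sum_{i<j}b_{ij}(ij)$ with $a_i,b_{ij}\ge0$.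
   Context: $\mathfrak S_n$ is the symmetric group on $\{1,\dots,n\}$. $W_n=W(B_n)$ is the hyperoctahedral group, realized as the set of pairs $(\eta,\pi)$ with $\eta\in\{0,1\}^n$ and $\pi\in\mathfrak S_n$, with product $(\eta,\pi)\cdot(\zeta,\sigma)=(\eta+\zeta\circ\pi^{-1},\pi\sigma)$ (addition componentwise mod 2; elements of $\{0,1\}^n$ are regarded as functions $\{1,\dots,n\}\to\{0,1\}$). A permutation $\pi\in\mathfrak S_n$ is identified with $(0,\pi)\in W_n$; in particular the transposition $(ij)$ is an element of $W_n$. Put $s_{\{i\}}=(\eta_{\{i\}},1)$ with $(\eta_{\{i\}})_j=\delta_{ij}$. $\mathrm D_n$ is the $n$-dimensional complex representation of $W_n$ with matrix entries $[\mathrm D_n(\eta,\pi)]_{ij}=(-1)^{\eta_i}\delta_{i,\pi(j)}$ (the defining representation), and $\widetilde{\mathrm D}_n^0$ is the $n$-dimensional representation with $[\widetilde{\mathrm D}_n^0(\eta,\pi)]_{ij}=\delta_{i,\pi(j)}$. For a finite group $G$, $w=\sum_{g}w_g g\in\mathbb CG$ with $w_g\ge0$ and $w_{g^{-1}}=w_g$, and a finite-dimensional complex representation $R$ of $G$ on $V$, the representation Laplacian is $\Delta_G(w,R)=\sum_{h\in G}w_h\,[\mathrm{id}_V-R(h)]$. Its eigenvalues are real and nonnegative. An eigenvalue is called trivial if its eigenspace consists entirely of $G$-invariant vectors, and $\psi_G(w,R)$ is the smallest nontrivial eigenvalue of $\Delta_G(w,R)$ (with $\min\emptyset=+\infty$).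 The spectral gap of $w$ is $\psi_G(w)=\inf_R\psi_G(w,R)$ over all finite-dimensional complex representations $R$ of $G$; equivalently, it is the second smallest eigenvalue (counted with multiplicity) of $\Delta_G(w,L)$ with $L$ the left regular representation. *)

theory Defs
  imports
    "HOL-Library.Extended_Real"
    "HOL-Combinatorics.Permutations"
    "HOL-Algebra.Group"
    "Jordan_Normal_Form.Char_Poly"
begin

section \<open>Representation Laplacians and spectral gaps\<close>

text \<open>A finite-dimensional complex representation is given in coordinates: a dimension \<open>d\<close> and a
  unital multiplicative map from the group to the complex \<open>d\<close> by \<open>d\<close> matrices (invertibility of the
  matrices follows). An element of the group algebra with real coefficients is its coefficient
  function.\<close>

definition representation ::
    "('g, 'm) monoid_scheme \<Rightarrow> nat \<Rightarrow> ('g \<Rightarrow> complex mat) \<Rightarrow> bool" where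
  "representation G d R \<longleftrightarrow>
     (\<forall>g\<in>carrier G. R g \<in> carrier_mat d d) \<and>
     R \<one>\<^bsub>G\<^esub> = 1\<^sub>m d \<and>
     (\<forall>g\<in>carrier G. \<forall>h\<in>carrier G. R (g \<otimes>\<^bsub>G\<^esub> h) = R g * R h)"

definition laplacian ::
    "('g, 'm) monoid_scheme \<Rightarrow> ('g \<Rightarrow> real) \<Rightarrow> nat \<Rightarrow> ('g \<Rightarrow> complex mat) \<Rightarrow> complex mat" where
  "laplacian G w d R =
     mat d d (\<lambda>(i, j). \<Sum>h\<in>carrier G. complex_of_real (w h) * (1\<^sub>m d - R h) $$ (i, j))"

definition invariant_vec ::
    "('g, 'm) monoid_scheme \<Rightarrow> ('g \<Rightarrow> complex mat) \<Rightarrow> complex vec \<Rightarrow> bool" where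
  "invariant_vec G R v \<longleftrightarrow> (\<forall>g\<in>carrier G. R g *\<^sub>v v = v)"

definition trivial_eigenvalue ::
    "('g, 'm) monoid_scheme \<Rightarrow> ('g \<Rightarrow> real) \<Rightarrow> nat \<Rightarrow> ('g \<Rightarrow> complex mat) \<Rightarrow> complex \<Rightarrow> bool" where
  "trivial_eigenvalue G w d R k \<longleftrightarrow>
     eigenvalue (laplacian G w d R) k \<and>
     (\<forall>v. eigenvector (laplacian G w d R) v k \<longrightarrow> invariant_vec G R v)"

text \<open>The smallest nontrivial eigenvalue. For a finite group and nonnegative symmetric \<open>w\<close> all
  eigenvalues are real, so \<open>Re\<close> is only a conversion of type, and the infimum is over a finite set;
  the infimum of the empty set is \<open>\<infinity>\<close>.\<close>

definition rep_gap ::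
    "('g, 'm) monoid_scheme \<Rightarrow> ('g \<Rightarrow> real) \<Rightarrow> nat \<Rightarrow> ('g \<Rightarrow> complex mat) \<Rightarrow> ereal" where
  "rep_gap G w d R =
     (INF k \<in> {k. eigenvalue (laplacian G w d R) k \<and> \<not> trivial_eigenvalue G w d R k}. ereal (Re k))"

definition spectral_gap :: "('g, 'm) monoid_scheme \<Rightarrow> ('g \<Rightarrow> real) \<Rightarrow> ereal" where
  "spectral_gap G w = Inf {rep_gap G w d R | d R. representation G d R}"

section \<open>The hyperoctahedral group\<close>

text \<open>Elements of \<open>{0,1}\<^sup>n\<close> are functions on \<open>nat\<close> extended by \<open>0\<close> outside \<open>{1..n}\<close>; permutations of
  \<open>{1..n}\<close> are extended by the identity.\<close>

type_synonym signed_perm = "(nat \<Rightarrow> nat) \<times> (nat \<Rightarrow> nat)"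

definition hyperoctahedral :: "nat \<Rightarrow> signed_perm monoid" where
  "hyperoctahedral n =
     \<lparr> carrier = {\<eta>. (\<forall>i. \<eta> i \<in> {0, 1}) \<and> (\<forall>i. i \<notin> {1..n} \<longrightarrow> \<eta> i = 0)} \<times> {\<pi>. \<pi> permutes {1..n}},
       mult = (\<lambda>(\<eta>, \<pi>) (\<zeta>, \<sigma>). (\<lambda>i. (\<eta> i + \<zeta> (Hilbert_Choice.inv \<pi> i)) mod 2, \<pi> \<circ> \<sigma>)),
       one = (\<lambda>_. 0, id) \<rparr>"

definition sign_change :: "nat \<Rightarrow> signed_perm" where
  "sign_change i = (\<lambda>j. if j = i then 1 else 0, id)"

definition swap :: "nat \<Rightarrow> nat \<Rightarrow> signed_perm" where
  "swap i j = (\<lambda>_. 0, Transposition.transpose i j)"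

text \<open>Matrices have indices \<open>0,\<dots>,n - 1\<close>, hence the shift by one.\<close>

definition defining_rep :: "nat \<Rightarrow> signed_perm \<Rightarrow> complex mat" where
  "defining_rep n = (\<lambda>(\<eta>, \<pi>).
     mat n n (\<lambda>(i, j). (-1) ^ \<eta> (Suc i) * (if Suc i = \<pi> (Suc j) then 1 else 0)))"

definition perm_rep :: "nat \<Rightarrow> signed_perm \<Rightarrow> complex mat" where
  "perm_rep n = (\<lambda>(\<eta>, \<pi>). mat n n (\<lambda>(i, j). if Suc i = \<pi> (Suc j) then 1 else 0))"

definition sign_weight :: "nat \<Rightarrow> (nat \<Rightarrow> real) \<Rightarrow> signed_perm \<Rightarrow> real" where
  "sign_weight n a = (\<lambda>g. \<Sum>i\<in>{1..n}. a i * (if g = sign_change i then 1 else 0))"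

definition swap_weight :: "nat \<Rightarrow> (nat \<Rightarrow> nat \<Rightarrow> real) \<Rightarrow> signed_perm \<Rightarrow> real" where
  "swap_weight n b =
     (\<lambda>g. \<Sum>(i, j)\<in>{(i, j). 1 \<le> i \<and> i < j \<and> j \<le> n}. b i j * (if g = swap i j then 1 else 0))"

definition edges :: "nat \<Rightarrow> (nat \<Rightarrow> nat \<Rightarrow> real) \<Rightarrow> (nat \<times> nat) set" where
  "edges n b = {(i, j). 1 \<le> i \<and> i < j \<and> j \<le> n \<and> b i j > 0}"

definition connected_graph :: "nat \<Rightarrow> (nat \<Rightarrow> nat \<Rightarrow> real) \<Rightarrow> bool" where
  "connected_graph n b \<longleftrightarrow>
     (\<forall>i\<in>{1..n}. \<forall>j\<in>{1..n}. (i, j) \<in> (edges n b \<union> (edges n b)\<inverse>)\<^sup>*)"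

end

theory Submission
  imports Defs "HOL-Analysis.Function_Topology" "HOL-Analysis.L2_Norm"
begin

text \<open>For all nonnegative weights the spectral gap of \<open>w\<^sub>N + w\<^sub>T\<close> is the minimum of the gaps of
  the two \<open>n\<close>-dimensional representations, and the two regimes of the theorem only differ in which of
  them is smaller, which is seen from crude Rayleigh quotients.

  The coefficients of a representation turn a non-invariant eigenvector into a nonconstant function
  on the group that is an eigenfunction, with the same eigenvalue, of the walk by right
  multiplication. Left multiplication by a sign change \<open>s\<close> commutes with this walk. If the function
  is not invariant under some \<open>s\<close>, its odd part is a nonzero eigenfunction, and its \<open>L\<^sup>2\<close> norms over
  the fibres \<open>{(\<eta>, \<pi>). \<pi> x = s}\<close> form a test function for the defining representation of no larger
  energy. Otherwise it is a function on the symmetric group, and Aldous' spectral gap conjecture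
  (the theorem of Caputo, Liggett and Richthammer) bounds the eigenvalue by the gap of the
  permutation representation.

  Aldous' theorem is by induction on the number of vertices via the octopus inequality. For weights
  \<open>c\<close> with sum \<open>0\<close> that are nonnegative except at one vertex, this says that
  \<open>T = \<Sum> c\<^sub>x c\<^sub>y (x y)\<close> (sum over all ordered pairs) is positive semidefinite. With
  \<open>s = \<Sum> c\<^sub>x\<^sup>2\<close> one has \<open>6 T\<^sup>2 - 12 s T = \<Sum> c\<^sub>x c\<^sub>y c\<^sub>z c\<^sub>w B\<^sub>x\<^sub>y\<^sub>z\<^sub>w\<close> over distinct \<open>x, y, z, w\<close>, where
  \<open>B / 12\<close> is the projection onto the two nontrivial linear characters of the alternating group of
  \<open>{x, y, z, w}\<close>. The sum is nonpositive since, for five points, any one of the five operators \<open>B\<close> is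
  at most the sum of the other four.\<close>

section \<open>The octopus inequality\<close>

text \<open>With \<open>E\<^sub>H\<close> the average over a group \<open>H\<close> acting from the right, \<open>tet\<close> is
  \<open>12 (E\<^sub>V - E\<^sub>A)\<close> for the Klein four-group \<open>V\<close> and the alternating group \<open>A\<close> on \<open>{x, y, z, w}\<close>.\<close>

definition tet :: "'v \<Rightarrow> 'v \<Rightarrow> 'v \<Rightarrow> 'v \<Rightarrow> (('v \<Rightarrow> 'a) \<Rightarrow> real) \<Rightarrow> ('v \<Rightarrow> 'a) \<Rightarrow> real" where
  "tet x y z w f p = 2 * f p
     + 2 * (f (p \<circ> (transpose x y \<circ> transpose z w)) + f (p \<circ> (transpose x z \<circ> transpose y w))
          + f (p \<circ> (transpose x w \<circ> transpose y z)))
     - (f (p \<circ> (transpose x y \<circ> transpose y z)) + f (p \<circ> (transpose y z \<circ> transpose x y))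
      + f (p \<circ> (transpose x y \<circ> transpose y w)) + f (p \<circ> (transpose y w \<circ> transpose x y))
      + f (p \<circ> (transpose x z \<circ> transpose z w)) + f (p \<circ> (transpose z w \<circ> transpose x z))
      + f (p \<circ> (transpose y z \<circ> transpose z w)) + f (p \<circ> (transpose z w \<circ> transpose y z)))"

text \<open>The Klein four-group lies in the alternating group, so
  \<open>E\<^sub>V - E\<^sub>A\<close> is a projection; both groups are unchanged when the four
  points are permuted.\<close>

lemma
  assumes "distinct [x0, x1, x2, x3]"
  shows tet_idem: "tet x0 x1 x2 x3 (tet x0 x1 x2 x3 f) p = 12 * tet x0 x1 x2 x3 f p"
    and tet_swap12: "tet x1 x0 x2 x3 f p = tet x0 x1 x2 x3 f p"
    and tet_swap23: "tet x0 x2 x1 x3 f p = tet x0 x1 x2 x3 f p"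
    and tet_swap34: "tet x0 x1 x3 x2 f p = tet x0 x1 x2 x3 f p"
proof -
  \<comment> \<open>Only the values of \<open>p\<close> at the four points vary. A transposition
    exchanges two arguments of \<open>r\<close>, so each identity becomes a finite
    computation.\<close>
  define r where "r = (\<lambda>a b c d. p(x0 := a, x1 := b, x2 := c, x3 := d))"
  have ne: "x0 \<noteq> x1" "x0 \<noteq> x2" "x0 \<noteq> x3" "x1 \<noteq> x2" "x1 \<noteq> x3" "x2 \<noteq> x3"
    using assms by auto
  have r:
    "r a b c d \<circ> transpose x0 x1 = r b a c d"
    "r a b c d \<circ> transpose x0 x2 = r c b a d"
    "r a b c d \<circ> transpose x0 x3 = r d b c a"
    "r a b c d \<circ> transpose x1 x2 = r a c b d"
    "r a b c d \<circ> transpose x1 x3 = r a d c b"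
    "r a b c d \<circ> transpose x2 x3 = r a b d c"
    "r a b c d \<circ> transpose x1 x0 = r b a c d"
    "r a b c d \<circ> transpose x2 x1 = r a c b d"
    "r a b c d \<circ> transpose x3 x2 = r a b d c" for a b c d
    using ne by (auto simp: r_def fun_eq_iff transpose_def)
  have p: "p = r (p x0) (p x1) (p x2) (p x3)"
    by (simp add: r_def)
  show "tet x0 x1 x2 x3 (tet x0 x1 x2 x3 f) p = 12 * tet x0 x1 x2 x3 f p"
    by (subst (1 2) p) (simp add: tet_def r o_assoc)
  show "tet x1 x0 x2 x3 f p = tet x0 x1 x2 x3 f p"
    by (subst (1 2) p) (simp add: tet_def r o_assoc)
  show "tet x0 x2 x1 x3 f p = tet x0 x1 x2 x3 f p"
    by (subst (1 2) p) (simp add: tet_def r o_assoc)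
  show "tet x0 x1 x3 x2 f p = tet x0 x1 x2 x3 f p"
    by (subst (1 2) p) (simp add: tet_def r o_assoc)
qed

text \<open>The five projections \<open>tet / 12\<close> vanish off the irreducible representation of the alternating
  group on five points of dimension \<open>5\<close>, where they have rank \<open>2\<close> and their sum is twice the identity.\<close>

lemma tet_five:
  assumes "distinct [x0, x1, x2, x3, x4]"
  shows "tet x0 x1 x2 x3 (tet x0 x1 x2 x3 f) p + tet x0 x1 x2 x4 (tet x0 x1 x2 x3 f) p
       + tet x0 x1 x3 x4 (tet x0 x1 x2 x3 f) p + tet x0 x2 x3 x4 (tet x0 x1 x2 x3 f) p
       + tet x1 x2 x3 x4 (tet x0 x1 x2 x3 f) p = 24 * tet x0 x1 x2 x3 f p"
proof -
  define r where "r = (\<lambda>a b c d e. p(x0 := a, x1 := b, x2 := c, x3 := d, x4 := e))"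
  have ne: "x0 \<noteq> x1" "x0 \<noteq> x2" "x0 \<noteq> x3" "x0 \<noteq> x4" "x1 \<noteq> x2" "x1 \<noteq> x3" "x1 \<noteq> x4" "x2 \<noteq> x3" "x2 \<noteq> x4" "x3 \<noteq> x4"
    using assms by auto
  have r: 
    "r a b c d e \<circ> transpose x0 x1 = r b a c d e"
    "r a b c d e \<circ> transpose x0 x2 = r c b a d e"
    "r a b c d e \<circ> transpose x0 x3 = r d b c a e"
    "r a b c d e \<circ> transpose x0 x4 = r e b c d a"
    "r a b c d e \<circ> transpose x1 x2 = r a c b d e"
    "r a b c d e \<circ> transpose x1 x3 = r a d c b e"
    "r a b c d e \<circ> transpose x1 x4 = r a e c d b"
    "r a b c d e \<circ> transpose x2 x3 = r a b d c e"
    "r a b c d e \<circ> transpose x2 x4 = r a b e d c"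
    "r a b c d e \<circ> transpose x3 x4 = r a b c e d" for a b c d e
    using ne by (auto simp: r_def fun_eq_iff transpose_def)
  have p: "p = r (p x0) (p x1) (p x2) (p x3) (p x4)"
    by (simp add: r_def)
  show ?thesis
    apply (subst (1 2 3 4 5 6) p)
    apply (simp only: tet_def r o_assoc)
    by simp
qed

section \<open>Autocorrelations and the quadratic form of \<open>tet\<close>\<close>

lemma sum_permutes_comp:
  assumes "s permutes V"
  shows "(\<Sum>p | p permutes V. g (p \<circ> s)) = (\<Sum>p | p permutes V. g p)"
  using sum_permutations_compose_right[OF assms, of g] by simp

lemma sum_permutes_adjoint:
  assumes "x \<in> V" "y \<in> V" "z \<in> V" "w \<in> V"
  shows "(\<Sum>p | p permutes V. g p * f (p \<circ> (transpose x y \<circ> transpose z w)))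
       = (\<Sum>p | p permutes V. g (p \<circ> (transpose z w \<circ> transpose x y)) * (f p :: real))"
proof -
  have s: "transpose z w \<circ> transpose x y permutes V"
    using assms by (intro permutes_compose permutes_swap_id)
  have "p \<circ> (transpose z w \<circ> transpose x y) \<circ> (transpose x y \<circ> transpose z w) = p" for p :: "'a \<Rightarrow> 'a"
    by (simp add: fun_eq_iff)
  then show ?thesis
    using sum_permutes_comp[OF s, of "\<lambda>p. g p * f (p \<circ> (transpose x y \<circ> transpose z w))"] by simp
qed

text \<open>A diagonal matrix coefficient of right translation by \<open>s\<close>; operator
  inequalities are expressed through such quadratic forms.\<close>

definition corr :: "'v set \<Rightarrow> (('v \<Rightarrow> 'v) \<Rightarrow> real) \<Rightarrow> ('v \<Rightarrow> 'v) \<Rightarrow> real" where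
  "corr V f s = (\<Sum>p | p permutes V. f p * f (p \<circ> s))"

text \<open>Right translations are orthogonal, so an element and its inverse have the same
  autocorrelation.\<close>

lemma corr_commute:
  assumes "x \<in> V" "y \<in> V" "z \<in> V" "w \<in> V"
  shows "corr V f (transpose x y \<circ> transpose z w) = corr V f (transpose z w \<circ> transpose x y)"
  unfolding corr_def by (subst sum_permutes_adjoint[OF assms]) (simp only: mult.commute)

lemma transpose_commute_disjoint:
  assumes "distinct [x, y, z, w]"
  shows "transpose x y \<circ> transpose z w = transpose z w \<circ> transpose x y"
  using assms by (auto simp: fun_eq_iff transpose_def)

text \<open>The coefficients of \<open>tet\<close> agree on inverse elements: products of disjoint
  transpositions are involutions, and the eight three-cycles form inverse pairs.\<close>

lemma tet_adjoint:
  assumes "x \<in> V" "y \<in> V" "z \<in> V" "w \<in> V" and d: "distinct [x, y, z, w]"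
  shows "(\<Sum>p | p permutes V. g p * tet x y z w f p) = (\<Sum>p | p permutes V. tet x y z w g p * f p)"
proof -
  have c: "transpose z w \<circ> transpose x y = transpose x y \<circ> transpose z w"
    "transpose y w \<circ> transpose x z = transpose x z \<circ> transpose y w"
    "transpose y z \<circ> transpose x w = transpose x w \<circ> transpose y z"
    using d by (auto intro!: transpose_commute_disjoint)
  define S where "S = (\<lambda>s. \<Sum>p | p permutes V. g p * f (p \<circ> s))"
  define S' where "S' = (\<lambda>s. \<Sum>p | p permutes V. g (p \<circ> s) * f p)"
  have S: "S (transpose a b \<circ> transpose u v) = S' (transpose u v \<circ> transpose a b)"
    if "a \<in> V" "b \<in> V" "u \<in> V" "v \<in> V" for a b u v
    unfolding S_def S'_def by (rule sum_permutes_adjoint[OF that])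
  have "(\<Sum>p | p permutes V. g p * tet x y z w f p) = 2 * S id
     + 2 * (S (transpose x y \<circ> transpose z w) + S (transpose x z \<circ> transpose y w)
          + S (transpose x w \<circ> transpose y z))
     - (S (transpose x y \<circ> transpose y z) + S (transpose y z \<circ> transpose x y)
      + S (transpose x y \<circ> transpose y w) + S (transpose y w \<circ> transpose x y)
      + S (transpose x z \<circ> transpose z w) + S (transpose z w \<circ> transpose x z)
      + S (transpose y z \<circ> transpose z w) + S (transpose z w \<circ> transpose y z))"
    unfolding S_def tet_def sum_distrib_left comp_id
    unfolding sum.distrib[symmetric] sum_subtractf[symmetric] sum_distrib_left
    by (intro sum.cong refl) (simp add: algebra_simps)
  also have "\<dots> = 2 * S' id
     + 2 * (S' (transpose x y \<circ> transpose z w) + S' (transpose x z \<circ> transpose y w)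
          + S' (transpose x w \<circ> transpose y z))
     - (S' (transpose x y \<circ> transpose y z) + S' (transpose y z \<circ> transpose x y)
      + S' (transpose x y \<circ> transpose y w) + S' (transpose y w \<circ> transpose x y)
      + S' (transpose x z \<circ> transpose z w) + S' (transpose z w \<circ> transpose x z)
      + S' (transpose y z \<circ> transpose z w) + S' (transpose z w \<circ> transpose y z))"
    using assms(1-4) by (simp add: S c) (simp add: S_def S'_def)
  also have "\<dots> = (\<Sum>p | p permutes V. tet x y z w g p * f p)"
    unfolding S'_def tet_def sum_distrib_left comp_id
    unfolding sum.distrib[symmetric] sum_subtractf[symmetric] sum_distrib_left
    by (intro sum.cong refl) (simp add: algebra_simps)
  finally show ?thesis .
qed

text \<open>The value \<open>0\<close> at coincidences lets sums over all quadruples stand for sums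
  over distinct ones.\<close>

definition tetq :: "'v set \<Rightarrow> (('v \<Rightarrow> 'v) \<Rightarrow> real) \<Rightarrow> 'v \<Rightarrow> 'v \<Rightarrow> 'v \<Rightarrow> 'v \<Rightarrow> real" where
  "tetq V f x y z w = (if distinct [x, y, z, w] then \<Sum>p | p permutes V. f p * tet x y z w f p else 0)"

text \<open>As \<open>tet\<close> is self-adjoint with square \<open>12 * tet\<close>, twelve times
  the form is the squared norm of \<open>tet x y z w f\<close>.\<close>

lemma tetq_nonneg:
  assumes "x \<in> V" "y \<in> V" "z \<in> V" "w \<in> V"
  shows "0 \<le> tetq V f x y z w"
proof (cases "distinct [x, y, z, w]")
  case True
  have "(\<Sum>p | p permutes V. tet x y z w f p * tet x y z w f p)
      = (\<Sum>p | p permutes V. f p * tet x y z w (tet x y z w f) p)"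
    by (rule tet_adjoint[OF assms True, symmetric])
  also have "\<dots> = 12 * tetq V f x y z w"
    unfolding tetq_def if_P[OF True] tet_idem[OF True] sum_distrib_left by (simp only: mult.left_commute)
  finally show ?thesis
    using sum_nonneg[of "{p. p permutes V}" "\<lambda>p. tet x y z w f p * tet x y z w f p"] by simp
qed (simp only: tetq_def if_False)

lemma tet_rotate:
  assumes d: "distinct [a, b, c, d]"
  shows "tet b c d a = tet a b c d" "tet a c d b = tet a b c d" "tet a b d c = tet a b c d"
proof -
  have d': "distinct [a, c, b, d]" "distinct [b, a, c, d]" "distinct [b, c, a, d]"
    using d by auto
  show m3: "tet a b d c = tet a b c d"
    by (intro ext) (rule tet_swap34[OF d])
  show m2: "tet a c d b = tet a b c d"
    by (intro ext) (rule trans[OF tet_swap34[OF d'(1)] tet_swap23[OF d]])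
  show m1: "tet b c d a = tet a b c d"
    by (intro ext) (rule trans[OF tet_swap34[OF d'(3)] trans[OF tet_swap23[OF d'(2)] tet_swap12[OF d]]])
qed

text \<open>The sum \<open>U\<close> of the five operators satisfies
  \<open>U (B i f) = 24 * B i f\<close>, so \<open>U / 24\<close> is an orthogonal projection whose
  range contains that of the projection \<open>B 0 / 12\<close>. Hence \<open>2 * B 0\<close> is at
  most \<open>U\<close>, and one copy of \<open>B 0\<close> cancels.\<close>

lemma tetq_five:
  fixes f :: "('v \<Rightarrow> 'v) \<Rightarrow> real"
  assumes V: "x0 \<in> V" "x \<in> V" "y \<in> V" "z \<in> V" "w \<in> V" and x0: "x0 \<notin> {x, y, z, w}"
  shows "tetq V f x y z w \<le> tetq V f x0 y z w + tetq V f x x0 z w + tetq V f x y x0 w + tetq V f x y z x0"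
proof (cases "distinct [x, y, z, w]")
  case True
  have m1: "tet b c d a g = tet a b c d g" and m2: "tet a c d b g = tet a b c d g"
    and m3: "tet a b d c g = tet a b c d g"
    if "distinct [a, b, c, d]" for a b c d :: 'v and g :: "('v \<Rightarrow> 'v) \<Rightarrow> real"
    by (simp_all only: tet_rotate[OF that])
  have ne: "x \<noteq> y" "x \<noteq> z" "x \<noteq> w" "y \<noteq> z" "y \<noteq> w" "z \<noteq> w" "x \<noteq> x0" "y \<noteq> x0" "z \<noteq> x0" "w \<noteq> x0"
    using True x0 by auto
  define B :: "nat \<Rightarrow> (('v \<Rightarrow> 'v) \<Rightarrow> real) \<Rightarrow> ('v \<Rightarrow> 'v) \<Rightarrow> real"
    where "B = (\<lambda>i. if i = 0 then tet x y z w else if i = 1 then tet y z w x0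
    else if i = 2 then tet x z w x0 else if i = 3 then tet x y w x0 else tet x y z x0)"
  have B_simps: "B 0 = tet x y z w" "B 1 = tet y z w x0" "B (Suc 0) = tet y z w x0" "B 2 = tet x z w x0" "B 3 = tet x y w x0" "B 4 = tet x y z x0"
    by (simp_all add: B_def)
  define ip where "ip = (\<lambda>f g. \<Sum>p | p permutes V. f p * (g p :: real))"
  define U where "U = (\<lambda>f p. \<Sum>i<5. B i f p)"
  have U_eq: "U f p = B 0 f p + B 1 f p + B 2 f p + B 3 f p + B 4 f p" for f p
    by (simp add: U_def eval_nat_numeral)
  have less5: "i = 0 \<or> i = 1 \<or> i = 2 \<or> i = 3 \<or> i = 4" if "i < 5" for i :: nat
    using that by auto
  have adj: "ip g (B i f) = ip (B i g) f" if "i < 5" for i g f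
    using less5[OF that] V ne unfolding ip_def
    by (elim disjE) (simp_all only: B_simps, auto intro!: tet_adjoint)
  have ip_commute: "ip g f = ip f g" for f g
    by (simp add: ip_def mult.commute)
  have ip_scale: "ip g (\<lambda>p. c * f p) = c * ip g f" for c f g
    by (simp add: ip_def sum_distrib_left mult.left_commute)
  have ip_U: "ip g (U f) = (\<Sum>i<5. ip g (B i f))" for f g
    unfolding ip_def U_def sum_distrib_left by (rule sum.swap)
  have adjU: "ip g (U f) = ip (U g) f" for f g
  proof -
    have "ip g (U f) = (\<Sum>i<5. ip f (B i g))"
      unfolding ip_U by (intro sum.cong refl) (metis adj ip_commute lessThan_iff)
    then show ?thesis
      by (metis ip_U ip_commute)
  qed
  have UB: "U (B i f) = (\<lambda>p. 24 * B i f p)" if i: "i < 5" for i f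
  proof
    fix p
    \<comment> \<open>Each case applies \<open>tet_five\<close> with the point omitted by
      \<open>B i\<close> in last position; \<open>m1\<close>, \<open>m2\<close> and
      \<open>m3\<close> restore the order of arguments.\<close>
    show "U (B i f) p = 24 * B i f p"
      using less5[OF i]
    proof (elim disjE)
      assume "i = 0"
      then show ?thesis
        unfolding U_eq using tet_five[of x y z w x0 f p] ne by (simp add: B_simps)
    next
      assume "i = 1"
      then show ?thesis
        unfolding U_eq using tet_five[of y z w x0 x f p] ne m1[of x y z w "B i f"] m1[of x y z x0 "B i f"]
          m1[of x y w x0 "B i f"] m1[of x z w x0 "B i f"] by (simp add: B_simps)
    next
      assume "i = 2"
      then show ?thesis
        unfolding U_eq using tet_five[of x z w x0 y f p] ne m2[of x y z w "B i f"] m2[of x y z x0 "B i f"]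
          m2[of x y w x0 "B i f"] m1[of y z w x0 "B i f"] by (simp add: B_simps)
    next
      assume "i = 3"
      then show ?thesis
        unfolding U_eq using tet_five[of x y w x0 z f p] ne m3[of x y z w "B i f"] m3[of x y z x0 "B i f"]
          m2[of x z w x0 "B i f"] m2[of y z w x0 "B i f"] by (simp add: B_simps)
    next
      assume "i = 4"
      then show ?thesis
        unfolding U_eq using tet_five[of x y z x0 w f p] ne m3[of x y w x0 "B i f"] m3[of x z w x0 "B i f"]
          m3[of y z w x0 "B i f"] by (simp add: B_simps)
    qed
  qed
  have BB: "B 0 (B 0 f) = (\<lambda>p. 12 * B 0 f p)" for f
    by (rule ext) (simp add: B_def tet_idem[OF True])
  \<comment> \<open>\<open>A\<close> is \<open>24\<close> times the difference of the two
    projections at \<open>f\<close>, so its squared norm is again a multiple of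
    \<open>ip f (U f) - 2 * ip f (B 0 f)\<close>.\<close>
  define A where "A = (\<lambda>p. U f p - 2 * B 0 f p)"
  have "ip A A = ip (U f) (U f) - 4 * ip (U f) (B 0 f) + 4 * ip (B 0 f) (B 0 f)"
    unfolding ip_def A_def sum_distrib_left sum.distrib[symmetric] sum_subtractf[symmetric]
    by (intro sum.cong refl) (simp add: algebra_simps)
  also have "ip (U f) (U f) = 24 * ip f (U f)"
  proof -
    have "ip (U f) (U f) = (\<Sum>i<5. ip f (U (B i f)))"
      by (subst ip_U) (simp only: adjU)
    also have "\<dots> = 24 * ip f (U f)"
      by (simp add: UB ip_scale ip_U sum_distrib_left)
    finally show ?thesis .
  qed
  also have "ip (U f) (B 0 f) = 24 * ip f (B 0 f)"
    by (simp add: UB ip_scale flip: adjU)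
  also have "ip (B 0 f) (B 0 f) = 12 * ip f (B 0 f)"
    by (simp add: BB ip_scale flip: adj)
  finally have "24 * (ip f (U f) - 2 * ip f (B 0 f)) = ip A A" by simp
  also have "\<dots> \<ge> 0" by (auto simp: ip_def intro!: sum_nonneg)
  finally have "2 * ip f (B 0 f) \<le> ip f (U f)" by simp
  moreover have "ip f (U f) = tetq V f x y z w + tetq V f x0 y z w + tetq V f x x0 z w + tetq V f x y x0 w + tetq V f x y z x0"
  proof -
    have "ip f (U f) = ip f (B 0 f) + ip f (B 1 f) + ip f (B 2 f) + ip f (B 3 f) + ip f (B 4 f)"
      unfolding ip_U by (simp add: eval_nat_numeral)
    then show ?thesis
      using ne m1[of x0 y z w f] m2[of x x0 z w f] m3[of x y x0 w f] by (auto simp: B_simps ip_def tetq_def)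
  qed
  moreover have "ip f (B 0 f) = tetq V f x y z w"
    using True by (simp add: B_simps ip_def tetq_def)
  ultimately show ?thesis by simp
next
  case False
  then have "tetq V f x y z w = 0" by (simp only: tetq_def if_False)
  then show ?thesis using V by (simp add: tetq_nonneg)
qed

section \<open>Quartic sums against weights\<close>

definition quad :: "'v set \<Rightarrow> ('v \<Rightarrow> real) \<Rightarrow> ('v \<Rightarrow> 'v \<Rightarrow> 'v \<Rightarrow> 'v \<Rightarrow> real) \<Rightarrow> real" where
  "quad V c F = (\<Sum>x\<in>V. c x * (\<Sum>y\<in>V. c y * (\<Sum>z\<in>V. c z * (\<Sum>w\<in>V. c w * F x y z w))))"

lemma quad_add: "quad V c (\<lambda>x y z w. F x y z w + G x y z w) = quad V c F + quad V c G"
  by (simp add: quad_def sum.distrib distrib_left)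

lemma quad_diff: "quad V c (\<lambda>x y z w. F x y z w - G x y z w) = quad V c F - quad V c G"
  by (simp add: quad_def sum_subtractf right_diff_distrib)

lemma quad_cmult: "quad V c (\<lambda>x y z w. k * F x y z w) = k * quad V c F"
  by (simp add: quad_def sum_distrib_left mult.left_commute)

lemma quad_mono:
  assumes "\<And>x. x \<in> V \<Longrightarrow> 0 \<le> c x"
    and "\<And>x y z w. x \<in> V \<Longrightarrow> y \<in> V \<Longrightarrow> z \<in> V \<Longrightarrow> w \<in> V \<Longrightarrow> F x y z w \<le> 0"
  shows "quad V c F \<le> 0"
  unfolding quad_def using assms by (intro sum_nonpos mult_nonneg_nonpos) auto

lemma quad_cong:
  assumes "\<And>x y z w. x \<in> V \<Longrightarrow> y \<in> V \<Longrightarrow> z \<in> V \<Longrightarrow> w \<in> V \<Longrightarrow> F x y z w = G x y z w"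
  shows "quad V c F = quad V c G"
  unfolding quad_def using assms by (intro sum.cong arg_cong2[where f = "(*)"] refl) auto

lemma weighted_sum_swap:
  "(\<Sum>y\<in>V. c y * (\<Sum>z\<in>V. c z * H z y)) = (\<Sum>y\<in>V. c y * (\<Sum>z\<in>V. c z * (H y z :: real)))"
  unfolding sum_distrib_left by (subst sum.swap) (simp only: mult.left_commute)

lemma quad_swap34: "quad V c (\<lambda>x y z w. F x y w z) = quad V c F"
  unfolding quad_def by (subst weighted_sum_swap) (rule refl)

lemma quad_swap23: "quad V c (\<lambda>x y z w. F x z y w) = quad V c F"
  unfolding quad_def by (subst weighted_sum_swap[where H = "\<lambda>y z. \<Sum>w\<in>V. c w * F _ y z w"]) (rule refl)

lemma quad_swap12: "quad V c (\<lambda>x y z w. F y x z w) = quad V c F"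
  unfolding quad_def
  by (rule weighted_sum_swap[where H = "\<lambda>x y. \<Sum>z\<in>V. c z * (\<Sum>w\<in>V. c w * F x y z w)"])

text \<open>The sum over the ignored argument factors out as the total weight \<open>0\<close>;
  exchanges of adjacent arguments reduce every case to the last argument.\<close>

lemma
  assumes c: "sum c V = 0"
  shows quad_indep4: "quad V c (\<lambda>x y z w. F x y z) = 0"
    and quad_indep3: "quad V c (\<lambda>x y z w. F x y w) = 0"
    and quad_indep2: "quad V c (\<lambda>x y z w. F x z w) = 0"
    and quad_indep1: "quad V c (\<lambda>x y z w. F y z w) = 0"
proof -
  show 4: "quad V c (\<lambda>x y z w. F x y z) = 0" for F
    by (simp add: quad_def c flip: sum_distrib_right)
  show 3: "quad V c (\<lambda>x y z w. F x y w) = 0" for F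
    using quad_swap34[of V c "\<lambda>x y z w. F x y z"] by (simp add: 4)
  show 2: "quad V c (\<lambda>x y z w. F x z w) = 0" for F
    using quad_swap23[of V c "\<lambda>x y z w. F x y w"] by (simp add: 3)
  show "quad V c (\<lambda>x y z w. F y z w) = 0"
    using quad_swap12[of V c "\<lambda>x y z w. F x z w"] by (simp add: 2)
qed

text \<open>The indicator contracts two arguments to the sum of squares and leaves the quadratic
  form of \<open>t\<close> in the other two.\<close>

lemma
  fixes t :: "'v \<Rightarrow> 'v \<Rightarrow> real" and c :: "'v \<Rightarrow> real"
  assumes "finite V"
  defines "T \<equiv> (\<Sum>x\<in>V. (c x)\<^sup>2) * (\<Sum>x\<in>V. c x * (\<Sum>y\<in>V. c y * t x y))"
  shows quad_diag12: "quad V c (\<lambda>x y z w. (if x = y then 1 else 0) * t z w) = T"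
    and quad_diag13: "quad V c (\<lambda>x y z w. (if x = z then 1 else 0) * t y w) = T"
    and quad_diag14: "quad V c (\<lambda>x y z w. (if x = w then 1 else 0) * t y z) = T"
    and quad_diag23: "quad V c (\<lambda>x y z w. (if y = z then 1 else 0) * t x w) = T"
    and quad_diag24: "quad V c (\<lambda>x y z w. (if y = w then 1 else 0) * t x z) = T"
    and quad_diag34: "quad V c (\<lambda>x y z w. (if z = w then 1 else 0) * t x y) = T"
proof -
  let ?d = "\<lambda>x y. if x = y then 1 else (0::real)"
  show 12: "quad V c (\<lambda>x y z w. ?d x y * t z w) = T"
  proof -
    have a: "(\<Sum>z\<in>V. c z * (\<Sum>w\<in>V. c w * (?d x y * t z w))) = ?d x y * (\<Sum>z\<in>V. c z * (\<Sum>w\<in>V. c w * t z w))" for x y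
      by simp
    have b: "(\<Sum>x\<in>V. c x * (\<Sum>y\<in>V. c y * (?d x y * K))) = (\<Sum>x\<in>V. (c x)\<^sup>2) * K" for K
    proof -
      have "(\<Sum>y\<in>V. c y * (?d x y * K)) = c x * K" if "x \<in> V" for x
      proof -
        have "(\<Sum>y\<in>V. c y * (?d x y * K)) = (\<Sum>y\<in>V. if x = y then c y * K else 0)"
          by (intro sum.cong) auto
        then show ?thesis using assms(1) that by simp
      qed
      then show ?thesis
        by (simp add: sum_distrib_right power2_eq_square mult.assoc)
    qed
    show ?thesis
      unfolding quad_def T_def a b ..
  qed
  show 13: "quad V c (\<lambda>x y z w. ?d x z * t y w) = T"
    using quad_swap23[of V c "\<lambda>x y z w. ?d x y * t z w"] by (simp only: 12)
  show 14: "quad V c (\<lambda>x y z w. ?d x w * t y z) = T"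
    using quad_swap34[of V c "\<lambda>x y z w. ?d x z * t y w"] by (simp only: 13)
  show 23: "quad V c (\<lambda>x y z w. ?d y z * t x w) = T"
    using quad_swap12[of V c "\<lambda>x y z w. ?d x z * t y w"] by (simp only: 13)
  show 24: "quad V c (\<lambda>x y z w. ?d y w * t x z) = T"
    using quad_swap34[of V c "\<lambda>x y z w. ?d y z * t x w"] by (simp only: 23)
  show 34: "quad V c (\<lambda>x y z w. ?d z w * t x y) = T"
    using quad_swap23[of V c "\<lambda>x y z w. ?d y w * t x z"] by (simp only: 24)
qed

text \<open>Expressing \<open>c x0\<close> by the other weights replaces each of the four
  evaluations by a difference with the value at \<open>x0\<close>. The summand is this fourfold
  difference, expanded by inclusion and exclusion.\<close>

lemma quad_remove:
  assumes V: "finite V" "x0 \<in> V" and c: "sum c V = 0"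
  shows "quad V c F = quad (V - {x0}) c (\<lambda>x y z w. F x y z w
      - (F x0 y z w + F x x0 z w + F x y x0 w + F x y z x0)
      + (F x0 x0 z w + F x0 y x0 w + F x0 y z x0 + F x x0 x0 w + F x x0 z x0 + F x y x0 x0)
      - (F x0 x0 x0 w + F x0 x0 z x0 + F x0 y x0 x0 + F x x0 x0 x0) + F x0 x0 x0 x0)"
proof -
  have c0: "c x0 = - sum c (V - {x0})"
    using sum.remove[OF V, of c] c by simp
  have r: "(\<Sum>x\<in>V. c x * g x) = (\<Sum>x\<in>V - {x0}. c x * (g x - g x0))" for g
    by (simp add: sum.remove[OF V] c0 right_diff_distrib sum_subtractf sum_distrib_right)
  show ?thesis
    unfolding quad_def r
    by (simp only: right_diff_distrib distrib_left sum_subtractf sum.distrib)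
qed

text \<open>The right-hand side is \<open>2 e + 2 V - S\<close> (with the three-cycles in \<open>S\<close> averaged over their
  factorizations) plus corrections supported on coincidences that make it vanish there. Except for
  the terms \<open>v\<close> in the first line and those of the form \<open>d x y * t z w\<close>, every summand ignores one of the four arguments,
  so it disappears after summation against weights of total \<open>0\<close>.\<close>

lemma coincidence_identity:
  fixes t :: "'v \<Rightarrow> 'v \<Rightarrow> real"
  assumes mem: "x \<in> V" "y \<in> V" "z \<in> V" "w \<in> V"
    and t: "\<And>a b. t a b = t b a" "\<And>a. t a a = e"
    and v: "\<And>a b c d. v b a c d = v a b c d" "\<And>a b c d. v a b d c = v a b c d"
      "\<And>a b c d. a \<in> V \<Longrightarrow> b \<in> V \<Longrightarrow> c \<in> V \<Longrightarrow> d \<in> V \<Longrightarrow> v c d a b = v a b c d"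
      "\<And>a b c. v a a b c = t b c" "\<And>a b. v a b a b = e"
      "\<And>a b c. distinct [a, b, c] \<Longrightarrow> v b c c a = v a b b c"
    and q: "distinct [x, y, z, w] \<Longrightarrow> q = 2 * e + 2 * (v x y z w + v x z y w + v x w y z)
        - 2 * (v x y y z + v x y y w + v x z z w + v y z z w)" "\<not> distinct [x, y, z, w] \<Longrightarrow> q = 0"
    and d: "\<And>a b. d a b = (if a = b then 1 else 0)"
  shows "q = 2 * e + 2 * (v x y z w + v x z y w + v x w y z)
     - 2 / 3 * (v x y y z + v y z z x + v z x x y + (v x y y w + v y w w x + v w x x y)
       + (v x z z w + v z w w x + v w x x z) + (v y z z w + v z w w y + v w y y z))
     - 2 * (d x y * t z w + d x z * t y w + d x w * t y z + d y z * t x w + d y w * t x z + d z w * t x y)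
     - 2 / 3 * (d x y * e + d x z * e + d x w * e + d y z * e + d y w * e + d z w * e)
     + 4 / 3 * (d x y * t x z + d x y * t x w + (d x z * t x y + d x z * t x w) + (d x w * t x y + d x w * t x z)
       + (d y z * t x y + d y z * t y w) + (d y w * t x y + d y w * t y z) + (d z w * t x z + d z w * t y z))"
proof -
  \<comment> \<open>In the application these are the six products of two transpositions that give a
    three-cycle on \<open>a\<close>, \<open>b\<close>, \<open>c\<close> or its inverse.\<close>
  have rot: "v b c c a = v a b b c" "v c a a b = v a b b c"
    "v a c c b = v a b b c" "v b a a c = v a b b c" "v c b b a = v a b b c"
    if "distinct [a, b, c]" "a \<in> V" "b \<in> V" "c \<in> V" for a b c
    using that v(1-3) v(6)[of a b c] v(6)[of b c a] v(6)[of c a b]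
    by (smt (verit, best) distinct_length_2_or_more distinct_singleton)+
  have swap: "a \<noteq> b \<Longrightarrow> v a b a c = v b a a c" "b \<noteq> c \<Longrightarrow> v a b c b = v a b b c"
    "a \<noteq> b \<Longrightarrow> v a b c a = v b a a c" for a b c
    using v(1,2) by metis+
  have deg: "v a b b a = e" "v a b b b = t a b" "v a b c c = t a b" "v a a a b = t a b" "v a a b a = t a b"
    if "a \<in> V" "b \<in> V" "c \<in> V" for a b c
    using that v t by metis+
  note S = v(4,5) deg swap t(2) d
  show ?thesis
  proof (cases "distinct [x, y, z, w]")
    case True
    then show ?thesis
      using mem q(1)[OF True]
      by (simp add: d rot[of x y z] rot[of x y w] rot[of x z w] rot[of y z w] add_divide_distrib)
  next
    case False
    note q0 = q(2)[OF False]
    \<comment> \<open>The cases follow the first coincident pair in lexicographic order.\<close>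
    consider "x = y" | "x \<noteq> y" "x = z" | "x \<noteq> y" "x \<noteq> z" "x = w" | "x \<noteq> y" "x \<noteq> z" "x \<noteq> w" "y = z"
      | "x \<noteq> y" "x \<noteq> z" "x \<noteq> w" "y \<noteq> z" "y = w" | "x \<noteq> y" "x \<noteq> z" "x \<noteq> w" "y \<noteq> z" "y \<noteq> w" "z = w"
      using False by auto
    then show ?thesis
    proof cases
      case 1
      then show ?thesis
        using mem by (cases "y = z"; cases "y = w"; cases "z = w")
          (simp_all add: S q0 rot[of y z w] swap[of y z w] swap[of z y w] swap[of w y z] swap[of w z y] t(1) add_divide_distrib)
    next
      case 2
      then show ?thesis
        using mem by (cases "y = w"; cases "z = w")
          (simp_all add: S q0 rot[of y z w] swap[of y z w] swap[of z y w] swap[of w y z] swap[of w z y] t(1) add_divide_distrib)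
    next
      case 3
      then show ?thesis
        using mem by (cases "y = z") (simp_all add: S q0 rot[of y z w] swap[of y z w] swap[of z y w] swap[of w y z] swap[of w z y] t(1) add_divide_distrib)
    next
      case 4
      then show ?thesis
        using mem by (cases "z = w") (simp_all add: S q0 rot[of x z w] swap[of x z w] swap[of z x w] swap[of w x z] swap[of w z x] t(1) add_divide_distrib)
    next
      case 5
      then show ?thesis
        using mem by (simp_all add: S q0 rot[of x z w] swap[of x z w] swap[of z x w] swap[of w x z] swap[of w z x] t(1) add_divide_distrib)
    next
      case 6
      then show ?thesis
        using mem by (simp_all add: S q0 rot[of x y w] swap[of x y w] swap[of y x w] swap[of w x y] swap[of w y x] t(1) add_divide_distrib)
    qed
  qed
qed

section \<open>From correlations to the octopus inequality\<close>

lemma corr_transpose_pair: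
  assumes "x \<in> V" "y \<in> V"
  shows "(\<Sum>p | p permutes V. f (p \<circ> transpose x y) * f (p \<circ> transpose z w))
    = corr V f (transpose x y \<circ> transpose z w)"
proof -
  have s: "transpose x y permutes V"
    using assms by (rule permutes_swap_id)
  have "p \<circ> transpose x y \<circ> transpose x y = p" for p :: "'a \<Rightarrow> 'a"
    by (simp add: fun_eq_iff)
  then show ?thesis
    using sum_permutes_comp[OF s, of "\<lambda>p. f (p \<circ> transpose x y) * f (p \<circ> transpose z w)"]
    by (simp add: corr_def o_assoc)
qed

lemma three_cycle_rotate:
  assumes "distinct [a, b, c]"
  shows "transpose b c \<circ> transpose c a = transpose a b \<circ> transpose b c"
  using assms by (auto simp: fun_eq_iff transpose_def)

text \<open>Inverse three-cycles have equal autocorrelation, so the eight of them collapse to four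
  terms with coefficient \<open>2\<close>.\<close>

lemma tetq_eq_corr:
  fixes f :: "('v \<Rightarrow> 'v) \<Rightarrow> real"
  assumes V: "x \<in> V" "y \<in> V" "z \<in> V" "w \<in> V" and d: "distinct [x, y, z, w]"
  defines "v \<equiv> \<lambda>a b c d. corr V f (transpose a b \<circ> transpose c d)"
  shows "tetq V f x y z w = 2 * corr V f id + 2 * (v x y z w + v x z y w + v x w y z)
    - 2 * (v x y y z + v x y y w + v x z z w + v y z z w)"
proof -
  have "tetq V f x y z w = 2 * corr V f id + 2 * (v x y z w + v x z y w + v x w y z)
    - (v x y y z + v y z x y + v x y y w + v y w x y + v x z z w + v z w x z + v y z z w + v z w y z)"
    unfolding tetq_def if_P[OF d] v_def corr_def tet_def sum_distrib_left comp_id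
    unfolding sum.distrib[symmetric] sum_subtractf[symmetric] sum_distrib_left
    by (intro sum.cong refl) (simp add: algebra_simps)
  moreover have "v y z x y = v x y y z" "v y w x y = v x y y w" "v z w x z = v x z z w" "v z w y z = v y z z w"
    unfolding v_def using V by (simp_all add: corr_commute)
  ultimately show ?thesis by simp
qed

text \<open>After elimination of \<open>x0\<close> the remaining weights are nonnegative and terms
  with \<open>x0\<close> repeated vanish. What is left for each quadruple is
  \<open>tetq_five\<close>.\<close>

lemma tetq_quad_nonpos:
  assumes V: "finite V" "x0 \<in> V" and c: "\<And>x. x \<in> V - {x0} \<Longrightarrow> 0 \<le> c x" "sum c V = 0"
  shows "quad V c (tetq V f) \<le> 0"
  unfolding quad_remove[OF V c(2)]
proof (rule quad_mono)
  have coinc: "tetq V f x0 x0 a b = 0" "tetq V f x0 a x0 b = 0" "tetq V f x0 a b x0 = 0"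
    "tetq V f a x0 x0 b = 0" "tetq V f a x0 b x0 = 0" "tetq V f a b x0 x0 = 0" for a b
    by (simp_all add: tetq_def)
  fix x y z w
  assume "x \<in> V - {x0}" "y \<in> V - {x0}" "z \<in> V - {x0}" "w \<in> V - {x0}"
  then show "tetq V f x y z w
      - (tetq V f x0 y z w + tetq V f x x0 z w + tetq V f x y x0 w + tetq V f x y z x0)
      + (tetq V f x0 x0 z w + tetq V f x0 y x0 w + tetq V f x0 y z x0 + tetq V f x x0 x0 w
         + tetq V f x x0 z x0 + tetq V f x y x0 x0)
      - (tetq V f x0 x0 x0 w + tetq V f x0 x0 z x0 + tetq V f x0 y x0 x0 + tetq V f x x0 x0 x0)
      + tetq V f x0 x0 x0 x0 \<le> 0"
    using tetq_five[of x0 V x y z w f] V(2) by (auto simp: coinc)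
qed (use c in auto)

text \<open>Summed against the weights, the coincidence identity leaves only
  \<open>6 * quad V c v - 12 * (s * T)\<close>. This total is nonpositive while
  \<open>quad V c v\<close> is nonnegative, so \<open>s * T\<close> is nonnegative.\<close>

theorem octopus:
  assumes V: "finite V" "x0 \<in> V" and c: "\<And>x. x \<in> V - {x0} \<Longrightarrow> 0 \<le> c x" "sum c V = 0"
  shows "0 \<le> (\<Sum>x\<in>V. c x * (\<Sum>y\<in>V. c y * corr V f (transpose x y)))"
proof -
  define t where "t = (\<lambda>x y. corr V f (transpose x y))"
  define v where "v = (\<lambda>x y z w. corr V f (transpose x y \<circ> transpose z w))"
  define e where "e = corr V f id"
  define d where "d = (\<lambda>x y :: 'a. if x = y then 1 else (0::real))"
  define T where "T = (\<Sum>x\<in>V. c x * (\<Sum>y\<in>V. c y * t x y))"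
  define s where "s = (\<Sum>x\<in>V. (c x)\<^sup>2)"
  have id: "tetq V f x y z w = 2 * e + 2 * (v x y z w + v x z y w + v x w y z)
     - 2 / 3 * (v x y y z + v y z z x + v z x x y + (v x y y w + v y w w x + v w x x y)
       + (v x z z w + v z w w x + v w x x z) + (v y z z w + v z w w y + v w y y z))
     - 2 * (d x y * t z w + d x z * t y w + d x w * t y z + d y z * t x w + d y w * t x z + d z w * t x y)
     - 2 / 3 * (d x y * e + d x z * e + d x w * e + d y z * e + d y w * e + d z w * e)
     + 4 / 3 * (d x y * t x z + d x y * t x w + (d x z * t x y + d x z * t x w) + (d x w * t x y + d x w * t x z)
       + (d y z * t x y + d y z * t y w) + (d y w * t x y + d y w * t y z) + (d z w * t x z + d z w * t y z))"
    if "x \<in> V" "y \<in> V" "z \<in> V" "w \<in> V" for x y z w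
  proof (rule coincidence_identity[OF that])
    show "tetq V f x y z w = 2 * e + 2 * (v x y z w + v x z y w + v x w y z)
        - 2 * (v x y y z + v x y y w + v x z z w + v y z z w)" if "distinct [x, y, z, w]"
      unfolding v_def e_def by (rule tetq_eq_corr) fact+
    show "tetq V f x y z w = 0" if "\<not> distinct [x, y, z, w]"
      using that by (simp only: tetq_def if_False)
    show "v b c c a = v a b b c" if "distinct [a, b, c]" for a b c
      unfolding v_def three_cycle_rotate[OF that] ..
  qed (simp_all add: t_def v_def e_def d_def transpose_commute corr_commute)
  \<comment> \<open>This is the squared norm of the weighted sum of right translations by
    transpositions applied to \<open>f\<close>.\<close>
  have vv: "quad V c v = (\<Sum>p | p permutes V. (\<Sum>x\<in>V. c x * (\<Sum>y\<in>V. c y * f (p \<circ> transpose x y)))\<^sup>2)"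
  proof -
    have sq: "quad V c (\<lambda>x y z w. g x y * g z w) = (\<Sum>x\<in>V. c x * (\<Sum>y\<in>V. c y * g x y))\<^sup>2" for g
    proof -
      define S where "S = (\<Sum>x\<in>V. c x * (\<Sum>y\<in>V. c y * g x y))"
      have "(\<Sum>z\<in>V. c z * (\<Sum>w\<in>V. c w * (g x y * g z w))) = g x y * S" for x y
        by (simp add: S_def sum_distrib_left mult.left_commute)
      then have "quad V c (\<lambda>x y z w. g x y * g z w) = S * S"
        by (simp add: quad_def S_def sum_distrib_right mult.assoc)
      then show ?thesis by (simp add: S_def power2_eq_square)
    qed
    have "quad V c v = quad V c (\<lambda>x y z w. \<Sum>p | p permutes V. f (p \<circ> transpose x y) * f (p \<circ> transpose z w))"
      by (rule quad_cong) (simp add: v_def corr_transpose_pair)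
    also have "\<dots> = (\<Sum>p | p permutes V. quad V c (\<lambda>x y z w. f (p \<circ> transpose x y) * f (p \<circ> transpose z w)))"
      unfolding quad_def sum_distrib_left
      by (simp only: sum.swap[of _ V "{p. p permutes V}"])
    also have "\<dots> = (\<Sum>p | p permutes V. (\<Sum>x\<in>V. c x * (\<Sum>y\<in>V. c y * f (p \<circ> transpose x y)))\<^sup>2)"
      by (simp only: sq)
    finally show ?thesis .
  qed
  have v: "quad V c (\<lambda>x y z w. v x z y w) = quad V c v"
    "quad V c (\<lambda>x y z w. v x w y z) = quad V c v"
    using quad_swap23[of V c v] quad_swap34[of V c "\<lambda>x y z w. v x z y w"] by simp_all
  note zero = quad_indep1[OF c(2)] quad_indep2[OF c(2)] quad_indep3[OF c(2)] quad_indep4[OF c(2)]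
  note diag = quad_diag12[OF V(1)] quad_diag13[OF V(1)] quad_diag14[OF V(1)] quad_diag23[OF V(1)]
    quad_diag24[OF V(1)] quad_diag34[OF V(1)]
  have "quad V c (tetq V f) = 6 * quad V c v - 12 * (s * T)"
    by (rule trans[OF quad_cong], rule id, assumption+,
        simp only: quad_add quad_diff quad_cmult zero v d_def diag, simp add: s_def T_def,
        simp add: c(2) flip: sum_distrib_right)
  moreover have "0 \<le> quad V c v"
    unfolding vv by (intro sum_nonneg) auto
  ultimately have "0 \<le> s * T"
    using tetq_quad_nonpos[OF assms, of f] by linarith
  moreover have "0 \<le> s" unfolding s_def by (intro sum_nonneg) auto
  \<comment> \<open>A vanishing sum of squares forces every weight to vanish.\<close>
  moreover have "T = 0" if "s = 0"
    using that V(1) unfolding s_def T_def by (subst (asm) sum_nonneg_eq_0_iff) auto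
  ultimately have "0 \<le> T"
    by (cases "s = 0") (auto simp: zero_le_mult_iff)
  then show ?thesis by (simp add: T_def t_def)
qed

section \<open>Walks generated by involutions\<close>

text \<open>A common setting for walks on vertices, permutations and signed permutations. Involutive
  moves make the walk symmetric; the potential will carry the sign changes of the defining
  representation.\<close>

locale walk =
  fixes X :: "'a set" and H :: "'h set" and t :: "'h \<Rightarrow> 'a \<Rightarrow> 'a"
    and w :: "'h \<Rightarrow> real" and pot :: "'a \<Rightarrow> real"
  assumes finite_X: "finite X" and finite_H: "finite H"
    and t_in: "h \<in> H \<Longrightarrow> p \<in> X \<Longrightarrow> t h p \<in> X"
    and t_t: "h \<in> H \<Longrightarrow> p \<in> X \<Longrightarrow> t h (t h p) = p"
begin

text \<open>Vector values cover both real test functions and complex eigenfunctions.\<close>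

definition lap :: "('a \<Rightarrow> 'b :: real_vector) \<Rightarrow> 'a \<Rightarrow> 'b" where
  "lap f p = (\<Sum>h\<in>H. w h *\<^sub>R (f p - f (t h p))) + pot p *\<^sub>R f p"

definition energy :: "('a \<Rightarrow> real) \<Rightarrow> real" where
  "energy f = (\<Sum>h\<in>H. w h * (\<Sum>p\<in>X. (f p - f (t h p))\<^sup>2)) / 2 + (\<Sum>p\<in>X. pot p * (f p)\<^sup>2)"

lemma sum_reindex_step:
  assumes "h \<in> H"
  shows "(\<Sum>p\<in>X. g (t h p)) = (\<Sum>p\<in>X. g p)"
  using assms t_in t_t by (intro sum.reindex_bij_witness[of _ "t h" "t h"]) auto

text \<open>Summation by parts: reindexing by the involution \<open>t h\<close> turns the one-sided
  sum into half of the symmetric one.\<close>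

lemma sum_mult_lap:
  "(\<Sum>p\<in>X. g p * lap f p)
    = (\<Sum>h\<in>H. w h * (\<Sum>p\<in>X. (g p - g (t h p)) * (f p - f (t h p)))) / 2 + (\<Sum>p\<in>X. pot p * (g p * f p :: real))"
proof -
  have step: "(\<Sum>p\<in>X. g p * (f p - f (t h p))) = (\<Sum>p\<in>X. (g p - g (t h p)) * (f p - f (t h p))) / 2"
    if h: "h \<in> H" for h
  proof -
    have "(\<Sum>p\<in>X. g (t h p) * (f (t h p) - f p)) = (\<Sum>p\<in>X. g (t h p) * (f (t h p) - f (t h (t h p))))"
      using t_t[OF h] by (intro sum.cong) auto
    also have "\<dots> = (\<Sum>p\<in>X. g p * (f p - f (t h p)))"
      using sum_reindex_step[OF h, of "\<lambda>p. g p * (f p - f (t h p))"] .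
    finally have "(\<Sum>p\<in>X. (g p - g (t h p)) * (f p - f (t h p))) = 2 * (\<Sum>p\<in>X. g p * (f p - f (t h p)))"
      by (simp add: algebra_simps sum.distrib sum_subtractf)
    then show ?thesis by simp
  qed
  have "(\<Sum>p\<in>X. g p * lap f p) = (\<Sum>p\<in>X. \<Sum>h\<in>H. w h * (g p * (f p - f (t h p)))) + (\<Sum>p\<in>X. pot p * (g p * f p))"
    by (simp add: lap_def distrib_left sum.distrib sum_distrib_left mult.left_commute)
  also have "(\<Sum>p\<in>X. \<Sum>h\<in>H. w h * (g p * (f p - f (t h p)))) = (\<Sum>h\<in>H. w h * (\<Sum>p\<in>X. g p * (f p - f (t h p))))"
    by (subst sum.swap) (simp add: sum_distrib_left)
  also have "\<dots> = (\<Sum>h\<in>H. w h * (\<Sum>p\<in>X. (g p - g (t h p)) * (f p - f (t h p)))) / 2"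
    unfolding sum_divide_distrib by (intro sum.cong refl) (simp add: step)
  finally show ?thesis .
qed

lemma sum_mult_lap_self: "(\<Sum>p\<in>X. f p * lap f p) = energy f"
  unfolding sum_mult_lap energy_def power2_eq_square ..

lemma lap_symmetric: "(\<Sum>p\<in>X. g p * lap f p) = (\<Sum>p\<in>X. f p * (lap g p :: real))"
  unfolding sum_mult_lap by (simp add: mult.commute)

lemma lap_cong: "(\<And>p. p \<in> X \<Longrightarrow> f p = g p) \<Longrightarrow> p \<in> X \<Longrightarrow> lap f p = lap g p"
  unfolding lap_def by (intro arg_cong2[where f = "(+)"] sum.cong) (auto simp: t_in)

lemma lap_add_scaled: "lap (\<lambda>p. f p + c *\<^sub>R g p) p = lap f p + c *\<^sub>R lap g p"
  by (simp add: lap_def scaleR_add_right scaleR_sum_right sum.distrib[symmetric] algebra_simps)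

lemma Re_lap: "Re (lap f p) = lap (\<lambda>p. Re (f p)) p"
  and Im_lap: "Im (lap f p) = lap (\<lambda>p. Im (f p)) p"
  by (simp_all add: lap_def)

text \<open>Real and imaginary parts are tested separately. In the sum of the two energies the
  contributions of \<open>Im k\<close> cancel, which leaves \<open>Re k\<close> times the squared
  norm of \<open>f\<close>.\<close>

lemma Re_eigenvalue_ge:
  fixes f :: "'a \<Rightarrow> complex"
  assumes eig: "\<And>p. p \<in> X \<Longrightarrow> lap f p = k * f p" and "q \<in> X" "f q \<noteq> 0"
    and Re: "c * (\<Sum>p\<in>X. (Re (f p))\<^sup>2) \<le> energy (\<lambda>p. Re (f p))"
    and Im: "c * (\<Sum>p\<in>X. (Im (f p))\<^sup>2) \<le> energy (\<lambda>p. Im (f p))"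
  shows "c \<le> Re k"
proof -
  define S where "S = (\<Sum>p\<in>X. (Re (f p))\<^sup>2 + (Im (f p))\<^sup>2)"
  have "energy (\<lambda>p. Re (f p)) + energy (\<lambda>p. Im (f p))
      = (\<Sum>p\<in>X. Re (f p) * Re (lap f p) + Im (f p) * Im (lap f p))"
    by (simp add: Re_lap Im_lap sum.distrib sum_mult_lap_self)
  also have "\<dots> = Re k * S"
    unfolding S_def sum_distrib_left
    by (intro sum.cong refl) (simp add: eig algebra_simps power2_eq_square)
  finally have "c * S \<le> Re k * S"
    using Re Im by (simp add: S_def sum.distrib distrib_left)
  moreover have "S > 0"
    unfolding S_def using finite_X assms(2,3)
    by (intro sum_pos2[of X q]) (auto simp: complex_eq_iff sum_power2_gt_zero_iff)
  ultimately show ?thesis by simp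
qed

text \<open>Subtracting the mean \<open>m\<close> leaves a nonzero function of sum zero. It is still
  an eigenfunction: \<open>lap f\<close> has sum zero when the potential vanishes, so
  \<open>k * m = 0\<close>.\<close>

lemma Re_eigenvalue_ge_of_nonconstant:
  fixes f :: "'a \<Rightarrow> complex"
  assumes eig: "\<And>p. p \<in> X \<Longrightarrow> lap f p = k * f p" and nc: "q \<in> X" "r \<in> X" "f q \<noteq> f r"
    and pot: "\<And>p. p \<in> X \<Longrightarrow> pot p = 0"
    and gap: "\<And>g. sum g X = 0 \<Longrightarrow> c * (\<Sum>p\<in>X. (g p)\<^sup>2) \<le> energy g"
  shows "c \<le> Re k"
proof -
  define m where "m = sum f X / of_nat (card X)"
  define f' where "f' = (\<lambda>p. f p - m)"
  have card: "card X \<noteq> 0" using nc finite_X by auto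
  have sum0: "sum f' X = 0" using card by (simp add: f'_def sum_subtractf m_def)
  have lap_f': "lap f' p = lap f p" if "p \<in> X" for p
    using that by (simp add: lap_def pot f'_def)
  have km: "k * m = 0"
  proof -
    have "(\<Sum>p\<in>X. lap f p) = 0"
    proof -
      have "(\<Sum>p\<in>X. lap f p) = (\<Sum>h\<in>H. w h *\<^sub>R ((\<Sum>p\<in>X. f p) - (\<Sum>p\<in>X. f (t h p))))"
        by (simp add: lap_def pot sum.swap[of _ H X] scaleR_sum_right[symmetric] sum_subtractf cong: sum.cong)
      then show ?thesis by (simp add: sum_reindex_step)
    qed
    then have "k * sum f X = 0" by (simp add: eig sum_distrib_left)
    then show ?thesis by (auto simp: m_def)
  qed
  have eig': "lap f' p = k * f' p" if "p \<in> X" for p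
    unfolding lap_f'[OF that] eig[OF that] using km by (simp add: f'_def right_diff_distrib)
  obtain s where s: "s \<in> X" "f' s \<noteq> 0"
    using nc unfolding f'_def by (cases "f q = m") auto
  have "(\<Sum>p\<in>X. Re (f' p)) = 0" "(\<Sum>p\<in>X. Im (f' p)) = 0"
    using sum0 by (simp_all flip: Re_sum Im_sum)
  then show ?thesis
    using Re_eigenvalue_ge[OF eig' s] gap by blast
qed

lemma energy_add_scaled:
  "energy (\<lambda>p. f p + c * g p) = energy f + 2 * c * (\<Sum>p\<in>X. g p * lap f p) + c\<^sup>2 * energy g"
proof -
  have "energy (\<lambda>p. f p + c * g p) = (\<Sum>p\<in>X. f p * lap f p) + c * (\<Sum>p\<in>X. f p * lap g p)
      + c * (\<Sum>p\<in>X. g p * lap f p) + c\<^sup>2 * (\<Sum>p\<in>X. g p * lap g p)"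
    unfolding sum_mult_lap_self[symmetric] sum_distrib_left sum.distrib[symmetric]
    using lap_add_scaled[of f c g]
    by (intro sum.cong refl) (simp add: algebra_simps power2_eq_square)
  then show ?thesis by (simp add: lap_symmetric[of f g] sum_mult_lap_self)
qed

lemma energy_cong: "(\<And>p. p \<in> X \<Longrightarrow> f p = g p) \<Longrightarrow> energy f = energy g"
  unfolding energy_def by (intro arg_cong2[where f = "(+)"] arg_cong2[where f = "(/)"] sum.cong arg_cong2[where f = "(*)"] refl)
    (auto simp: t_in)

text \<open>The Rayleigh quotient is minimized on the orthogonal complement of \<open>u\<close>,
  which \<open>lap\<close> preserves by the first hypothesis. Taking \<open>u\<close> constantly
  \<open>1\<close> gives functions of sum zero, and \<open>u\<close> constantly \<open>0\<close>
  gives all functions.\<close>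

lemma min_eigenfunction:
  assumes u: "\<And>f. (\<Sum>p\<in>X. u p * f p) = 0 \<Longrightarrow> (\<Sum>p\<in>X. u p * lap f p) = 0"
    and f0: "(\<Sum>p\<in>X. u p * f0 p) = 0" "q \<in> X" "f0 q \<noteq> 0"
  obtains f c where "(\<Sum>p\<in>X. u p * f p) = 0" "\<exists>p\<in>X. f p \<noteq> 0" "\<And>p. p \<in> X \<Longrightarrow> lap f p = c * f p"
    "\<And>g. (\<Sum>p\<in>X. u p * g p) = 0 \<Longrightarrow> c * (\<Sum>p\<in>X. (g p)\<^sup>2) \<le> energy g"
proof -
  \<comment> \<open>Functions are made to vanish off \<open>X\<close>, so that \<open>K\<close> is a
    product of compact sets in the product topology.\<close>
  define K where "K = PiE UNIV (\<lambda>p. if p \<in> X then {-1..1::real} else {0})"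
  define C where "C = K \<inter> {f. (\<Sum>p\<in>X. u p * f p) = 0} \<inter> {f. (\<Sum>p\<in>X. (f p)\<^sup>2) = 1}"
  have "compactin (product_topology (\<lambda>_. euclidean) UNIV) K"
    unfolding K_def compactin_PiE by auto
  then have "compact K"
    by (simp only: euclidean_product_topology compactin_euclidean_iff)
  moreover have "closed {f. (\<Sum>p\<in>X. u p * f p) = (0::real)}" "closed {f. (\<Sum>p\<in>X. (f p)\<^sup>2) = (1::real)}"
    by (intro closed_Collect_eq continuous_intros continuous_on_product_coordinates)+
  ultimately have "compact C"
    unfolding C_def by (intro compact_Int_closed)
  have normalize: "\<exists>f\<in>C. energy g = (\<Sum>p\<in>X. (g p)\<^sup>2) * energy f"
    if g: "(\<Sum>p\<in>X. u p * g p) = 0" and s: "(\<Sum>p\<in>X. (g p)\<^sup>2) \<noteq> 0" for g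
  proof -
    define s where "s = (\<Sum>p\<in>X. (g p)\<^sup>2)"
    define f where "f = (\<lambda>p. if p \<in> X then g p / sqrt s else 0)"
    have s0: "s > 0"
      using s sum_nonneg[of X "\<lambda>p. (g p)\<^sup>2"] unfolding s_def by simp
    have "(\<Sum>p\<in>X. u p * f p) = (\<Sum>p\<in>X. u p * g p) / sqrt s"
      by (simp add: f_def sum_divide_distrib)
    then have 1: "(\<Sum>p\<in>X. u p * f p) = 0" using g by simp
    have "(\<Sum>p\<in>X. (f p)\<^sup>2) = (\<Sum>p\<in>X. (g p)\<^sup>2) / s"
      using s0 by (simp add: f_def sum_divide_distrib power_divide)
    then have 2: "(\<Sum>p\<in>X. (f p)\<^sup>2) = 1" using s0 by (simp add: s_def)
    have "\<bar>f p\<bar> \<le> 1" if "p \<in> X" for p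
    proof -
      have "(f p)\<^sup>2 \<le> (\<Sum>p\<in>X. (f p)\<^sup>2)"
        using that finite_X by (intro member_le_sum) auto
      then show ?thesis using 2 by (simp add: abs_square_le_1)
    qed
    then have "- 1 \<le> f p \<and> f p \<le> 1" if "p \<in> X" for p
      using that by (auto simp: abs_le_iff minus_le_iff)
    moreover have "f p = 0" if "p \<notin> X" for p using that by (simp add: f_def)
    ultimately have "f \<in> K" unfolding K_def by (intro PiE_I) auto
    moreover have "energy g = s * energy f"
    proof -
      have "energy g = energy (\<lambda>p. 0 + sqrt s * f p)"
        using s0 by (intro energy_cong) (simp add: f_def)
      then show ?thesis using s0 by (subst (asm) energy_add_scaled) (simp add: energy_def lap_def)
    qed
    ultimately show ?thesis using 1 2 by (auto simp: C_def s_def)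
  qed
  have "(\<Sum>p\<in>X. (f0 p)\<^sup>2) \<noteq> 0"
    using f0(2,3) finite_X by (subst sum_nonneg_eq_0_iff) auto
  then have "C \<noteq> {}" using normalize[OF f0(1)] by auto
  have cont: "continuous_on UNIV energy"
    unfolding energy_def by (intro continuous_intros continuous_on_product_coordinates) simp
  obtain f where f: "f \<in> C" "\<And>g. g \<in> C \<Longrightarrow> energy f \<le> energy g"
    using continuous_attains_inf[OF \<open>compact C\<close> \<open>C \<noteq> {}\<close> continuous_on_subset[OF cont]] by blast
  define c where "c = energy f"
  have f_orth: "(\<Sum>p\<in>X. u p * f p) = 0" and f_norm: "(\<Sum>p\<in>X. (f p)\<^sup>2) = 1"
    using f(1) by (auto simp: C_def)
  have gap: "c * (\<Sum>p\<in>X. (g p)\<^sup>2) \<le> energy g" if g: "(\<Sum>p\<in>X. u p * g p) = 0" for g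
  proof (cases "(\<Sum>p\<in>X. (g p)\<^sup>2) = 0")
    case True
    then have "g p = 0" if "p \<in> X" for p
      using that finite_X by (subst (asm) sum_nonneg_eq_0_iff) auto
    then have "energy g = 0"
      using energy_cong[of g "\<lambda>_. 0"] by (simp add: energy_def)
    with True show ?thesis by simp
  next
    case False
    from normalize[OF g this] f(2) show ?thesis
      by (auto simp: c_def mult.commute[of _ "energy _"] sum_nonneg intro!: mult_right_mono)
  qed
  have stationary: "(\<Sum>p\<in>X. g p * (lap f p - c * f p)) = 0" if g: "(\<Sum>p\<in>X. u p * g p) = 0" for g
  proof -
    define D where "D = (\<Sum>p\<in>X. g p * (lap f p - c * f p))"
    define E where "E = energy g - c * (\<Sum>p\<in>X. (g p)\<^sup>2)"
    have E: "0 \<le> E" using gap[OF g] by (simp add: E_def)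
    have quad: "0 \<le> 2 * r * D + r\<^sup>2 * E" for r
    proof -
      have "(\<Sum>p\<in>X. u p * (f p + r * g p)) = (\<Sum>p\<in>X. u p * f p) + r * (\<Sum>p\<in>X. u p * g p)"
        by (simp add: distrib_left sum.distrib sum_distrib_left mult.left_commute)
      then have "c * (\<Sum>p\<in>X. (f p + r * g p)\<^sup>2) \<le> energy (\<lambda>p. f p + r * g p)"
        using g f_orth by (intro gap) simp
      moreover have "(\<Sum>p\<in>X. (f p + r * g p)\<^sup>2) = 1 + 2 * r * (\<Sum>p\<in>X. g p * f p) + r\<^sup>2 * (\<Sum>p\<in>X. (g p)\<^sup>2)"
        unfolding f_norm[symmetric] sum_distrib_left sum.distrib[symmetric]
        by (intro sum.cong refl) (simp add: power2_eq_square algebra_simps)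
      moreover have "(\<Sum>p\<in>X. g p * lap f p) = D + c * (\<Sum>p\<in>X. g p * f p)"
        by (simp add: D_def right_diff_distrib sum_subtractf sum_distrib_left mult.left_commute)
      ultimately show ?thesis
        by (simp add: energy_add_scaled E_def c_def algebra_simps)
    qed
    \<comment> \<open>At \<open>r = - z\<close> the quadratic inequality has the value
      \<open>- (z\<^sup>2 * (E + 2))\<close>; the summand \<open>1\<close> keeps the denominator
      positive when \<open>E = 0\<close>.\<close>
    define z where "z = D / (E + 1)"
    have D: "D = z * (E + 1)" using E by (simp add: z_def)
    have "0 \<le> - (z\<^sup>2 * (E + 2))"
      using quad[of "- z"] by (simp add: D power2_eq_square algebra_simps)
    then have "z\<^sup>2 \<le> 0" using E by (simp add: mult_le_0_iff)
    then have "D = 0" using E by (simp add: D)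
    then show ?thesis by (simp add: D_def)
  qed
  \<comment> \<open>The residual is itself orthogonal to \<open>u\<close>, so it can serve as its
    own test function and must vanish on \<open>X\<close>.\<close>
  have "(\<Sum>p\<in>X. u p * (lap f p - c * f p)) = 0"
    using u[OF f_orth] f_orth by (simp add: right_diff_distrib sum_subtractf mult.left_commute[of _ c] flip: sum_distrib_left)
  from stationary[OF this] have "lap f p = c * f p" if "p \<in> X" for p
    using that finite_X by (subst (asm) sum_nonneg_eq_0_iff) auto
  moreover have "\<exists>p\<in>X. f p \<noteq> 0"
    using f_norm by (metis (mono_tags, lifting) power_zero_numeral sum.neutral zero_neq_one)
  ultimately show thesis using that f_orth gap by blast
qed

end

section \<open>The spectral gap theorem for the symmetric group\<close>

definition vertex_energy :: "'v set \<Rightarrow> ('v \<Rightarrow> 'v \<Rightarrow> real) \<Rightarrow> ('v \<Rightarrow> real) \<Rightarrow> real" where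
  "vertex_energy V c h = (\<Sum>x\<in>V. \<Sum>y\<in>V. c x y * (h x - h y)\<^sup>2) / 2"

text \<open>The edges range over \<open>U\<close>, which may omit a vertex of \<open>V\<close>.\<close>

definition perm_energy :: "'v set \<Rightarrow> 'v set \<Rightarrow> ('v \<Rightarrow> 'v \<Rightarrow> real) \<Rightarrow> (('v \<Rightarrow> 'v) \<Rightarrow> real) \<Rightarrow> real" where
  "perm_energy U V c f = (\<Sum>x\<in>U. \<Sum>y\<in>U. c x y * (\<Sum>p | p permutes V. (f p - f (p \<circ> transpose x y))\<^sup>2)) / 4"

lemma vertex_walk: "finite V \<Longrightarrow> walk V (V \<times> V) (\<lambda>(x, y). transpose x y)"
  by unfold_locales (auto simp: transpose_def)

lemma perm_walk: "finite V \<Longrightarrow> walk {p. p permutes V} (V \<times> V) (\<lambda>(x, y) p. p \<circ> transpose x y)"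
  by unfold_locales (auto simp: finite_permutations fun_eq_iff intro!: permutes_compose permutes_swap_id)

text \<open>A transposition moves two points and so contributes its squared difference twice; the
  weights \<open>c x y / 2\<close> account for the sum over ordered pairs.\<close>

lemma vertex_walk_energy:
  assumes "finite V"
  shows "walk.energy V (V \<times> V) (\<lambda>(x, y). transpose x y) (\<lambda>(x, y). c x y / 2) pot h
    = vertex_energy V c h + (\<Sum>x\<in>V. pot x * (h x)\<^sup>2)"
proof -
  have "(\<Sum>z\<in>V. (h z - h (transpose x y z))\<^sup>2) = 2 * (h x - h y)\<^sup>2" if "x \<in> V" "y \<in> V" for x y
  proof (cases "x = y")
    case False
    have "(\<Sum>z\<in>V. (h z - h (transpose x y z))\<^sup>2) = (\<Sum>z\<in>{x, y}. (h z - h (transpose x y z))\<^sup>2)"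
      using that assms by (intro sum.mono_neutral_right) (auto simp: transpose_def)
    with False show ?thesis by (simp add: power2_commute)
  qed simp
  then show ?thesis
    unfolding walk.energy_def[OF vertex_walk[OF assms]] sum.cartesian_product'
    by (simp add: vertex_energy_def
        sum_divide_distrib cong: sum.cong)
qed

lemma perm_walk_energy:
  assumes "finite V"
  shows "walk.energy {p. p permutes V} (V \<times> V) (\<lambda>(x, y) p. p \<circ> transpose x y) (\<lambda>(x, y). c x y / 2) (\<lambda>_. 0) f
    = perm_energy V V c f"
  unfolding walk.energy_def[OF perm_walk[OF assms]] sum.cartesian_product'
  by (simp add: perm_energy_def
      sum_divide_distrib cong: sum.cong)

section \<open>Elimination of a vertex\<close>

text \<open>The network obtained by eliminating \<open>x0\<close>; when \<open>x0\<close> is isolated, division by \<open>0\<close> gives the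
  correct value \<open>c x y\<close>.\<close>

definition star_reduce :: "'v \<Rightarrow> 'v set \<Rightarrow> ('v \<Rightarrow> 'v \<Rightarrow> real) \<Rightarrow> 'v \<Rightarrow> 'v \<Rightarrow> real" where
  "star_reduce x0 V c x y = c x y + c x0 x * c x0 y / (\<Sum>z\<in>V. c x0 z)"

text \<open>For probability weights: the mean squared difference of two independent samples is twice
  the variance.\<close>

lemma weighted_variance:
  fixes c g :: "'v \<Rightarrow> real"
  shows "(\<Sum>x\<in>V. \<Sum>y\<in>V. c x * c y * (g x - g y)\<^sup>2) = 2 * (sum c V * (\<Sum>x\<in>V. c x * (g x)\<^sup>2) - (\<Sum>x\<in>V. c x * g x)\<^sup>2)"
proof -
  have "(\<Sum>x\<in>V. \<Sum>y\<in>V. c x * c y * (g x - g y)\<^sup>2)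
      = (\<Sum>x\<in>V. \<Sum>y\<in>V. (c x * (g x)\<^sup>2) * c y) + (\<Sum>x\<in>V. \<Sum>y\<in>V. c x * (c y * (g y)\<^sup>2))
        - 2 * (\<Sum>x\<in>V. \<Sum>y\<in>V. (c x * g x) * (c y * g y))"
    unfolding sum_distrib_left sum.distrib[symmetric] sum_subtractf[symmetric]
    by (intro sum.cong refl) (simp add: power2_eq_square algebra_simps)
  then show ?thesis
    by (simp add: sum_product[symmetric] power2_eq_square)
qed

lemma vertex_energy_insert:
  assumes "finite V" "x0 \<notin> V" and sym: "\<And>x. x \<in> V \<Longrightarrow> c x x0 = c x0 x"
  shows "vertex_energy (insert x0 V) c h = vertex_energy V c h + (\<Sum>y\<in>V. c x0 y * (h x0 - h y)\<^sup>2)"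
  using assms by (simp add: vertex_energy_def sum.distrib power2_commute[of "h x0"])

lemma perm_energy_insert:
  assumes "finite V" "x0 \<notin> V" and sym: "\<And>x. x \<in> V \<Longrightarrow> c x x0 = c x0 x"
  shows "perm_energy (insert x0 V) W c f
    = perm_energy V W c f + (\<Sum>y\<in>V. c x0 y * (\<Sum>p | p permutes W. (f p - f (p \<circ> transpose x0 y))\<^sup>2)) / 2"
  using assms by (simp add: perm_energy_def sum.distrib transpose_commute[of _ x0])

text \<open>Extending \<open>g\<close> to \<open>x0\<close> by its weighted average \<open>m\<close>
  minimizes the energy, and the minimum is the energy of \<open>g\<close> in the reduced network.
  Centering the extension leaves its sum of squares at least that of \<open>g\<close>, so the bound
  \<open>k\<close> is inherited.\<close>

lemma poincare_star_reduce:
  assumes V: "finite V" "x0 \<notin> V" and c: "\<And>x. x \<in> V \<Longrightarrow> 0 \<le> c x0 x" "\<And>x. x \<in> V \<Longrightarrow> c x x0 = c x0 x"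
    and k: "0 \<le> k"
    and gap: "\<And>h. sum h (insert x0 V) = 0 \<Longrightarrow> k * (\<Sum>x\<in>insert x0 V. (h x)\<^sup>2) \<le> vertex_energy (insert x0 V) c h"
    and g: "sum g V = 0"
  shows "k * (\<Sum>x\<in>V. (g x)\<^sup>2) \<le> vertex_energy V (star_reduce x0 V c) g"
proof -
  define s where "s = (\<Sum>z\<in>V. c x0 z)"
  define m where "m = (\<Sum>y\<in>V. c x0 y * g y) / s"
  define N where "N = real (card (insert x0 V))"
  \<comment> \<open>As \<open>g\<close> has sum zero, its extension by \<open>m\<close> has mean
    \<open>m / N\<close>.\<close>
  define h where "h = (\<lambda>x. (if x = x0 then m else g x) - m / N)"
  have N: "N \<ge> 1" using V by (simp add: N_def)
  \<comment> \<open>If \<open>s = 0\<close>, then \<open>x0\<close> is isolated and \<open>m\<close>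
    has the default value \<open>0\<close>.\<close>
  have cz: "c x0 y = 0" if "s = 0" "y \<in> V" for y
    using that V(1) c(1) unfolding s_def by (subst (asm) sum_nonneg_eq_0_iff) auto
  have hV: "h y = g y - m / N" if "y \<in> V" for y
    using that V(2) by (auto simp: h_def)
  have hx0: "h x0 = m - m / N" by (simp add: h_def)
  have "sum h V = - (N - 1) * (m / N)"
    using V g by (simp add: hV sum_subtractf N_def)
  then have sum0: "sum h (insert x0 V) = 0"
    using V N by (simp add: hx0 field_simps)
  have "(\<Sum>x\<in>V. (h x)\<^sup>2) = (\<Sum>x\<in>V. (g x)\<^sup>2) + (N - 1) * (m / N)\<^sup>2"
  proof -
    have "(\<Sum>x\<in>V. (h x)\<^sup>2) = (\<Sum>x\<in>V. (g x)\<^sup>2) - 2 * (m / N) * sum g V + (\<Sum>x\<in>V. (m / N)\<^sup>2)"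
      unfolding sum_distrib_left sum.distrib[symmetric] sum_subtractf[symmetric]
      by (intro sum.cong refl) (simp add: hV power2_eq_square algebra_simps)
    then show ?thesis using V g by (simp add: N_def)
  qed
  then have "(\<Sum>x\<in>V. (g x)\<^sup>2) \<le> (\<Sum>x\<in>insert x0 V. (h x)\<^sup>2)"
    using V N by (simp add: sum_nonneg)
  then have "k * (\<Sum>x\<in>V. (g x)\<^sup>2) \<le> vertex_energy (insert x0 V) c h"
    using gap[OF sum0] k by (meson mult_left_mono order_trans)
  also have "\<dots> = vertex_energy V c g + (\<Sum>y\<in>V. c x0 y * (m - g y)\<^sup>2)"
    by (subst vertex_energy_insert) (simp_all add: V c vertex_energy_def hV hx0 cong: sum.cong)
  also have "(\<Sum>y\<in>V. c x0 y * (m - g y)\<^sup>2) = (\<Sum>x\<in>V. \<Sum>y\<in>V. c x0 x * c x0 y * (g x - g y)\<^sup>2) / (2 * s)"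
  proof (cases "s = 0")
    case True
    then show ?thesis by (simp add: cz)
  next
    case False
    have "(\<Sum>y\<in>V. c x0 y * (m - g y)\<^sup>2) = m\<^sup>2 * s - 2 * m * (\<Sum>y\<in>V. c x0 y * g y) + (\<Sum>y\<in>V. c x0 y * (g y)\<^sup>2)"
      unfolding s_def sum_distrib_left sum.distrib[symmetric] sum_subtractf[symmetric]
      by (intro sum.cong refl) (simp add: power2_eq_square algebra_simps)
    moreover have B: "(\<Sum>y\<in>V. c x0 y * g y) = m * s" using False by (simp add: m_def)
    ultimately have "(\<Sum>y\<in>V. c x0 y * (m - g y)\<^sup>2) = (\<Sum>y\<in>V. c x0 y * (g y)\<^sup>2) - m\<^sup>2 * s"
      by (simp add: power2_eq_square)
    then show ?thesis
      using False unfolding weighted_variance B s_def[symmetric]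
      by (simp add: diff_divide_distrib power2_eq_square)
  qed
  also have "vertex_energy V c g + (\<Sum>x\<in>V. \<Sum>y\<in>V. c x0 x * c x0 y * (g x - g y)\<^sup>2) / (2 * s)
      = vertex_energy V (star_reduce x0 V c) g"
    by (simp add: vertex_energy_def star_reduce_def s_def[symmetric] distrib_right sum.distrib
        add_divide_distrib sum_divide_distrib mult.commute[of s 2])
  finally show ?thesis .
qed

text \<open>This is the octopus inequality in energy form: the star at \<open>x0\<close> dominates
  the conductances that replace it.\<close>

lemma perm_energy_star_reduce:
  assumes V: "finite V" "x0 \<notin> V" and c: "\<And>x. x \<in> V \<Longrightarrow> 0 \<le> c x0 x" "\<And>x. x \<in> V \<Longrightarrow> c x x0 = c x0 x"
  shows "perm_energy V (insert x0 V) (star_reduce x0 V c) f \<le> perm_energy (insert x0 V) (insert x0 V) c f"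
proof -
  let ?W = "insert x0 V"
  define s where "s = (\<Sum>z\<in>V. c x0 z)"
  define D where "D = (\<lambda>x y. \<Sum>p | p permutes ?W. (f p - f (p \<circ> transpose x y))\<^sup>2)"
  define r where "r = (\<lambda>x y. corr ?W f (transpose x y))"
  define e where "e = corr ?W f id"
  \<comment> \<open>Translation preserves the norm of \<open>f\<close>, which turns energies along
    transpositions into autocorrelations.\<close>
  have D: "D x y = 2 * (e - r x y)" if "x \<in> ?W" "y \<in> ?W" for x y
  proof -
    have "(\<Sum>p | p permutes ?W. (f (p \<circ> transpose x y))\<^sup>2) = (\<Sum>p | p permutes ?W. (f p)\<^sup>2)"
      using sum_permutes_comp[OF permutes_swap_id[OF that], of "\<lambda>p. (f p)\<^sup>2"] .
    moreover have "D x y = (\<Sum>p | p permutes ?W. (f p)\<^sup>2) + (\<Sum>p | p permutes ?W. (f (p \<circ> transpose x y))\<^sup>2)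
        - 2 * (\<Sum>p | p permutes ?W. f p * f (p \<circ> transpose x y))"
      unfolding D_def sum_distrib_left sum.distrib[symmetric] sum_subtractf[symmetric]
      by (intro sum.cong refl) (simp add: power2_eq_square algebra_simps)
    ultimately show ?thesis by (simp add: e_def r_def corr_def power2_eq_square)
  qed
  have s0: "0 \<le> s" unfolding s_def using c by (intro sum_nonneg) auto
  have "(\<Sum>x\<in>V. \<Sum>y\<in>V. c x0 x * c x0 y * D x y) / s \<le> 2 * (\<Sum>y\<in>V. c x0 y * D x0 y)"
  proof (cases "s = 0")
    case True
    then show ?thesis
      using c unfolding D_def by (auto intro!: sum_nonneg mult_nonneg_nonneg)
  next
    case False
    \<comment> \<open>The octopus weights are the conductances at \<open>x0\<close>, balanced by
      minus their total at \<open>x0\<close> itself.\<close>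
    define c' where "c' = (\<lambda>x. if x = x0 then - s else c x0 x)"
    have c'V: "c' x = c x0 x" if "x \<in> V" for x using that V by (auto simp: c'_def)
    have c'x0: "c' x0 = - s" by (simp add: c'_def)
    have "0 \<le> (\<Sum>x\<in>?W. c' x * (\<Sum>y\<in>?W. c' y * r x y))"
      unfolding r_def using V c by (intro octopus[of _ x0]) (auto simp: c'V c'x0 s_def)
    also have "\<dots> = s\<^sup>2 * e - 2 * s * (\<Sum>y\<in>V. c x0 y * r x0 y) + (\<Sum>x\<in>V. \<Sum>y\<in>V. c x0 x * c x0 y * r x y)"
    proof -
      define R where "R = (\<Sum>y\<in>V. c x0 y * r x0 y)"
      have r0: "r x x0 = r x0 x" if "x \<in> V" for x by (simp add: r_def transpose_commute)
      have e: "r x0 x0 = e" by (simp add: r_def e_def)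
      have "(\<Sum>x\<in>?W. c' x * (\<Sum>y\<in>?W. c' y * r x y))
          = - s * (- s * e + R) + (\<Sum>x\<in>V. c x0 x * (- s * r x0 x + (\<Sum>y\<in>V. c x0 y * r x y)))"
        using V by (simp add: c'V c'x0 e r0 R_def)
      also have "(\<Sum>x\<in>V. c x0 x * (- s * r x0 x + (\<Sum>y\<in>V. c x0 y * r x y)))
          = - s * R + (\<Sum>x\<in>V. \<Sum>y\<in>V. c x0 x * c x0 y * r x y)"
        unfolding R_def sum_distrib_left sum.distrib[symmetric]
        by (intro sum.cong refl) (simp add: right_diff_distrib sum_distrib_left mult.assoc mult.left_commute)
      finally show ?thesis by (simp add: R_def algebra_simps power2_eq_square)
    qed
    also have "\<dots> = (s * (2 * (\<Sum>y\<in>V. c x0 y * D x0 y)) - (\<Sum>x\<in>V. \<Sum>y\<in>V. c x0 x * c x0 y * D x y)) / 2"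
    proof -
      have h1: "(\<Sum>y\<in>V. c x0 y * D x0 y) = 2 * (s * e - (\<Sum>y\<in>V. c x0 y * r x0 y))"
        by (simp add: D s_def sum_distrib_left sum_distrib_right right_diff_distrib sum_subtractf mult_ac)
      have h2: "(\<Sum>x\<in>V. \<Sum>y\<in>V. c x0 x * c x0 y * D x y)
          = 2 * (s * s * e - (\<Sum>x\<in>V. \<Sum>y\<in>V. c x0 x * c x0 y * r x y))"
      proof -
        have "(\<Sum>x\<in>V. \<Sum>y\<in>V. c x0 x * c x0 y * D x y)
            = (\<Sum>x\<in>V. \<Sum>y\<in>V. c x0 x * c x0 y * (2 * e)) - 2 * (\<Sum>x\<in>V. \<Sum>y\<in>V. c x0 x * c x0 y * r x y)"
          unfolding sum_distrib_left sum_subtractf[symmetric]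
          by (intro sum.cong refl) (simp add: D algebra_simps)
        moreover have "(\<Sum>x\<in>V. \<Sum>y\<in>V. c x0 x * c x0 y * (2 * e)) = s * s * (2 * e)"
          unfolding s_def sum_product by (simp only: sum_distrib_right)
        ultimately show ?thesis by simp
      qed
      show ?thesis unfolding h1 h2 by (simp add: power2_eq_square algebra_simps)
    qed
    finally show ?thesis using False s0 by (simp add: divide_le_eq mult.commute)
  qed
  moreover have "perm_energy ?W ?W c f = perm_energy V ?W c f + (\<Sum>y\<in>V. c x0 y * D x0 y) / 2"
    unfolding D_def by (intro perm_energy_insert V c)
  moreover have "perm_energy V ?W (star_reduce x0 V c) f
      = perm_energy V ?W c f + (\<Sum>x\<in>V. \<Sum>y\<in>V. c x0 x * c x0 y * D x y) / s / 4"
    by (simp add: perm_energy_def star_reduce_def s_def[symmetric] D_def distrib_right sum.distrib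
        add_divide_distrib sum_divide_distrib)
  moreover have "u \<le> 2 * v \<Longrightarrow> x = y + v / 2 \<Longrightarrow> z = y + u / 4 \<Longrightarrow> z \<le> x" for u v x y z :: real
    by simp
  ultimately show ?thesis by blast
qed

section \<open>Fibre sums and Aldous' theorem\<close>

lemma sum_fiber_comp_transpose:
  assumes "x \<in> V" "y \<in> V"
  shows "(\<Sum>p | p permutes V \<and> p z = i. g (p \<circ> transpose x y)) = (\<Sum>p | p permutes V \<and> p (transpose x y z) = i. g p)"
  by (rule sum.reindex_bij_witness[of _ "\<lambda>p. p \<circ> transpose x y" "\<lambda>p. p \<circ> transpose x y"])
     (use permutes_swap_id[OF assms] in \<open>auto simp: fun_eq_iff intro!: permutes_compose\<close>)

text \<open>The permutations with \<open>p x0 = b\<close> form the left coset of the stabilizer of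
  \<open>x0\<close> represented by \<open>transpose x0 b\<close>.\<close>

lemma sum_fiber_insert:
  assumes V: "finite V" "x0 \<notin> V" and b: "b \<in> insert x0 V"
  shows "(\<Sum>p | p permutes insert x0 V \<and> p x0 = b. g p) = (\<Sum>q | q permutes V. g (transpose x0 b \<circ> q))"
proof -
  have "(\<Sum>p | p permutes insert x0 V \<and> p x0 = b. g p)
      = (\<Sum>p | p permutes insert x0 V. if p x0 = b then g p else 0)"
    using V sum.inter_filter[of "{p. p permutes insert x0 V}" g "\<lambda>p. p x0 = b"] by (simp add: finite_permutations)
  also have "\<dots> = (\<Sum>b'\<in>insert x0 V. \<Sum>q | q permutes V.
      if (transpose x0 b' \<circ> q) x0 = b then g (transpose x0 b' \<circ> q) else 0)"
    by (rule sum_over_permutations_insert[OF V])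
  also have "\<dots> = (\<Sum>b'\<in>insert x0 V. if b' = b then \<Sum>q | q permutes V. g (transpose x0 b' \<circ> q) else 0)"
  proof (intro sum.cong refl)
    fix b'
    have "(transpose x0 b' \<circ> q) x0 = b'" if "q permutes V" for q
      using permutes_not_in[OF that V(2)] by simp
    then show "(\<Sum>q | q permutes V. if (transpose x0 b' \<circ> q) x0 = b then g (transpose x0 b' \<circ> q) else 0)
        = (if b' = b then \<Sum>q | q permutes V. g (transpose x0 b' \<circ> q) else 0)"
      by (cases "b' = b") (auto intro!: sum.cong sum.neutral)
  qed
  also have "\<dots> = (\<Sum>q | q permutes V. g (transpose x0 b \<circ> q))"
    using V b by (subst sum.delta) auto
  finally show ?thesis .
qed

text \<open>For a minimizing eigenfunction \<open>F\<close>, either some fibre sum is nonzero and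
  projects \<open>F\<close> to an eigenfunction on vertices, or \<open>F\<close> has sum zero on
  every coset of the stabilizer of \<open>x0\<close>. In the second case the induction hypothesis
  applies to the reduced network on each coset.\<close>

theorem aldous:
  assumes "finite V" and "\<And>x y. x \<in> V \<Longrightarrow> y \<in> V \<Longrightarrow> 0 \<le> c x y"
    and "\<And>x y. x \<in> V \<Longrightarrow> y \<in> V \<Longrightarrow> c x y = c y x" and k: "0 \<le> k"
    and "\<And>h. sum h V = 0 \<Longrightarrow> k * (\<Sum>x\<in>V. (h x)\<^sup>2) \<le> vertex_energy V c h"
    and "(\<Sum>p | p permutes V. f p) = 0"
  shows "k * (\<Sum>p | p permutes V. (f p)\<^sup>2) \<le> perm_energy V V c f"
  using assms(1-3,5,6)
proof (induction V arbitrary: c f rule: finite_induct)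
  case empty
  then show ?case by (simp add: perm_energy_def)
next
  case (insert x0 V c f)
  define W where "W = insert x0 V"
  let ?S = "{p. p permutes W}"
  have W: "finite W" using insert by (simp add: W_def)
  note hyps = insert.hyps and IH = insert.IH and prems = insert.prems[folded W_def]
  interpret ip: walk ?S "W \<times> W" "\<lambda>(x, y) p. p \<circ> transpose x y" "\<lambda>(x, y). c x y / 2" "\<lambda>_. 0"
    by (rule perm_walk[OF W])
  interpret rw: walk W "W \<times> W" "\<lambda>(x, y). transpose x y" "\<lambda>(x, y). c x y / 2" "\<lambda>_. 0"
    by (rule vertex_walk[OF W])
  note ip_energy = perm_walk_energy[OF W, of c] and rw_energy = vertex_walk_energy[OF W, of c "\<lambda>_. 0"]
  have "k * (\<Sum>p\<in>?S. (f p)\<^sup>2) \<le> perm_energy W W c f"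
  proof (cases "\<exists>p\<in>?S. f p \<noteq> 0")
    case False
    have "0 \<le> perm_energy W W c f"
      unfolding perm_energy_def using prems(1)
      by (intro divide_nonneg_pos sum_nonneg mult_nonneg_nonneg) auto
    with False show ?thesis by simp
  next
    case True
    then obtain q where q: "q \<in> ?S" "f q \<noteq> 0" by blast
    obtain F m where F: "sum F ?S = 0" "\<exists>p\<in>?S. F p \<noteq> 0" "\<And>p. p \<in> ?S \<Longrightarrow> ip.lap F p = m * F p"
      and gap: "\<And>g. sum g ?S = 0 \<Longrightarrow> m * (\<Sum>p\<in>?S. (g p)\<^sup>2) \<le> ip.energy g"
    proof (rule ip.min_eigenfunction[of "\<lambda>_. 1" f q])
      fix g :: "('a \<Rightarrow> 'a) \<Rightarrow> real"
      show "(\<Sum>p\<in>?S. 1 * ip.lap g p) = 0"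
        unfolding ip.sum_mult_lap by simp
    qed (use q prems(4) in auto)
    have "k \<le> m"
    proof (cases "\<exists>x\<in>W. \<exists>i. (\<Sum>p | p permutes W \<and> p x = i. F p) \<noteq> 0")
      case True
      then obtain i x where x: "x \<in> W" "(\<Sum>p | p permutes W \<and> p x = i. F p) \<noteq> 0" by blast
      \<comment> \<open>Fibre sums intertwine the walks on permutations and on vertices, so
        \<open>h\<close> again has eigenvalue \<open>m\<close>.\<close>
      define h where "h = (\<lambda>x. \<Sum>p | p permutes W \<and> p x = i. F p)"
      have lap: "rw.lap h y = m * h y" if y: "y \<in> W" for y
      proof -
        have "m * h y = (\<Sum>p | p permutes W \<and> p y = i. ip.lap F p)"
          by (simp add: h_def sum_distrib_left F(3))
        also have "\<dots> = (\<Sum>e\<in>W \<times> W. (case e of (u, v) \<Rightarrow> c u v / 2) *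
            (\<Sum>p | p permutes W \<and> p y = i. F p - F (case e of (u, v) \<Rightarrow> p \<circ> transpose u v)))"
          unfolding ip.lap_def
          by (simp add: sum.swap[of _ "W \<times> W"] sum_distrib_left case_prod_beta)
        also have "\<dots> = rw.lap h y"
          unfolding rw.lap_def h_def
          by (auto simp: sum_subtractf sum_fiber_comp_transpose intro!: sum.cong)
        finally show ?thesis ..
      qed
      have "sum h W = sum F ?S"
      proof -
        obtain p where "p permutes W" "p x = i"
          using x(2) by (metis (mono_tags, lifting) mem_Collect_eq sum.neutral)
        then have i: "i \<in> W" using x(1) permutes_in_image by metis
        have fiber: "{p. p permutes W \<and> p y = i} = {p \<in> ?S. Hilbert_Choice.inv p i = y}" for y
          by (auto simp: permutes_inv_eq)
        show ?thesis
          unfolding h_def fiber using W i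
          by (intro sum.group) (auto simp: finite_permutations permutes_in_image[OF permutes_inv])
      qed
      then have "k * (\<Sum>y\<in>W. (h y)\<^sup>2) \<le> vertex_energy W c h"
        using F(1) prems(3) by simp
      also have "\<dots> = (\<Sum>y\<in>W. h y * rw.lap h y)"
        by (simp only: rw.sum_mult_lap_self rw_energy) simp
      also have "\<dots> = m * (\<Sum>y\<in>W. (h y)\<^sup>2)"
        by (simp add: lap sum_distrib_left power2_eq_square mult.left_commute)
      finally have "k * (\<Sum>y\<in>W. (h y)\<^sup>2) \<le> m * (\<Sum>y\<in>W. (h y)\<^sup>2)" .
      moreover have "(\<Sum>y\<in>W. (h y)\<^sup>2) > 0"
        using x W by (intro sum_pos2[of _ x]) (auto simp: h_def)
      ultimately show ?thesis by simp
    next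
      case False
      let ?c = "star_reduce x0 V c"
      have c0: "0 \<le> c x0 x" "c x x0 = c x0 x" if "x \<in> V" for x
        using that prems(1,2) by (auto simp: W_def)
      have sub: "k * (\<Sum>q | q permutes V. (F (transpose x0 b \<circ> q))\<^sup>2)
          \<le> perm_energy V V ?c (\<lambda>q. F (transpose x0 b \<circ> q))" if b: "b \<in> W" for b
      proof (rule IH)
        show "0 \<le> ?c x y" "?c x y = ?c y x" if "x \<in> V" "y \<in> V" for x y
          using that prems(1,2)
          by (auto simp: W_def star_reduce_def mult.commute intro!: add_nonneg_nonneg divide_nonneg_nonneg sum_nonneg)
        show "k * (\<Sum>x\<in>V. (h x)\<^sup>2) \<le> vertex_energy V ?c h" if "sum h V = 0" for h
          using hyps c0 k prems(3)[unfolded W_def] that by (rule poincare_star_reduce)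
        show "(\<Sum>q | q permutes V. F (transpose x0 b \<circ> q)) = 0"
          using False b hyps by (subst sum_fiber_insert[symmetric]) (auto simp: W_def)
      qed
      have "k * (\<Sum>p\<in>?S. (F p)\<^sup>2) = (\<Sum>b\<in>W. k * (\<Sum>q | q permutes V. (F (transpose x0 b \<circ> q))\<^sup>2))"
        by (simp only: sum_over_permutations_insert[OF hyps, folded W_def] sum_distrib_left)
      also have "\<dots> \<le> (\<Sum>b\<in>W. perm_energy V V ?c (\<lambda>q. F (transpose x0 b \<circ> q)))"
        by (intro sum_mono sub)
      \<comment> \<open>Moves inside \<open>V\<close> act from the right and preserve each coset, so
        the energies on the cosets add up.\<close>
      also have "\<dots> = perm_energy V W ?c F"
        unfolding perm_energy_def sum_over_permutations_insert[OF hyps, folded W_def] sum_distrib_left sum_divide_distrib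
        by (simp only: sum.swap[of _ V W] o_assoc)
      also have "\<dots> \<le> perm_energy W W c F"
        unfolding W_def using hyps c0 by (rule perm_energy_star_reduce)
      also have "\<dots> = (\<Sum>p\<in>?S. F p * ip.lap F p)"
        by (simp only: ip.sum_mult_lap_self ip_energy)
      also have "\<dots> = m * (\<Sum>p\<in>?S. (F p)\<^sup>2)"
        using F(3) by (simp add: sum_distrib_left power2_eq_square mult.left_commute)
      finally have "k * (\<Sum>p\<in>?S. (F p)\<^sup>2) \<le> m * (\<Sum>p\<in>?S. (F p)\<^sup>2)" .
      moreover obtain p where "p \<in> ?S" "F p \<noteq> 0" using F(2) by blast
      then have "(\<Sum>p\<in>?S. (F p)\<^sup>2) > 0"
        using ip.finite_X by (intro sum_pos2[of _ p]) auto
      ultimately show ?thesis by simp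
    qed
    then have "k * (\<Sum>p\<in>?S. (f p)\<^sup>2) \<le> m * (\<Sum>p\<in>?S. (f p)\<^sup>2)"
      by (intro mult_right_mono sum_nonneg) auto
    also have "\<dots> \<le> perm_energy W W c f"
      using gap[OF prems(4)] by (simp only: ip_energy)
    finally show ?thesis .
  qed
  then show ?case by (simp only: W_def)
qed

section \<open>Signed permutations\<close>

definition bits :: "'v set \<Rightarrow> ('v \<Rightarrow> nat) set" where
  "bits V = {\<eta>. (\<forall>i. \<eta> i \<in> {0, 1}) \<and> (\<forall>i. i \<notin> V \<longrightarrow> \<eta> i = 0)}"

lemma finite_bits: "finite V \<Longrightarrow> finite (bits V)"
  unfolding bits_def
  by (rule finite_subset[OF _ finite_set_of_finite_funs[of V "{0, 1}" 0]]) auto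

text \<open>On bits \<open>1 - \<eta> s\<close> adds one modulo 2, so this is left multiplication by
  the sign change at \<open>s\<close>.\<close>

definition flip :: "'v \<Rightarrow> ('v \<Rightarrow> nat) \<times> 'p \<Rightarrow> ('v \<Rightarrow> nat) \<times> 'p" where
  "flip s = (\<lambda>(\<eta>, p). (\<eta>(s := 1 - \<eta> s), p))"

text \<open>The moves are right multiplications by generators. The product composes the second sign
  vector with the inverse permutation, so a sign change at \<open>i\<close> flips the coordinate
  \<open>snd g i\<close>.\<close>

fun signed_step :: "'v + 'v \<times> 'v \<Rightarrow> ('v \<Rightarrow> nat) \<times> ('v \<Rightarrow> 'v) \<Rightarrow> ('v \<Rightarrow> nat) \<times> ('v \<Rightarrow> 'v)" where
  "signed_step (Inl i) g = flip (snd g i) g"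
| "signed_step (Inr (x, y)) g = (fst g, snd g \<circ> transpose x y)"

abbreviation signed_perms :: "'v set \<Rightarrow> (('v \<Rightarrow> nat) \<times> ('v \<Rightarrow> 'v)) set" where
  "signed_perms V \<equiv> bits V \<times> {p. p permutes V}"

lemma flip_in: "s \<in> V \<Longrightarrow> g \<in> bits V \<times> P \<Longrightarrow> flip s g \<in> bits V \<times> P"
proof (cases g)
  case (Pair \<eta> p)
  assume "s \<in> V" "g \<in> bits V \<times> P"
  then show ?thesis
    using Pair by (cases "\<eta> s") (auto simp: flip_def bits_def)
qed

lemma flip_flip: "g \<in> bits V \<times> P \<Longrightarrow> flip s (flip s g) = g"
  by (auto simp: flip_def bits_def fun_eq_iff) (metis One_nat_def diff_diff_cancel le_refl less_eq_nat.simps(1))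

lemma flip_commute: "flip s (flip r g) = flip r (flip s g)"
  by (cases g; cases "s = r") (simp_all add: flip_def fun_upd_twist)

lemma snd_flip [simp]: "snd (flip s g) = snd g"
  by (simp add: flip_def split: prod.splits)

lemma signed_walk:
  assumes "finite V"
  shows "walk (signed_perms V) (V <+> V \<times> V) signed_step"
proof
  fix h g assume h: "h \<in> V <+> V \<times> V" and g: "g \<in> signed_perms V"
  show "signed_step h g \<in> signed_perms V"
    using h g by (cases "(h, g)" rule: signed_step.cases)
      (auto simp: permutes_in_image intro!: flip_in permutes_compose permutes_swap_id simp del: mem_Sigma_iff)
  show "signed_step h (signed_step h g) = g"
    using h g by (cases "(h, g)" rule: signed_step.cases)
      (auto simp: flip_flip[of _ V] fun_eq_iff)
qed (use assms in \<open>auto simp: finite_bits finite_permutations\<close>)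

lemma sum_signed_perms_fiber:
  assumes V: "finite V" and s: "s \<in> V"
  shows "(\<Sum>g\<in>signed_perms V. q g) = (\<Sum>p\<in>V. \<Sum>g | g \<in> signed_perms V \<and> snd g p = s. (q g :: real))"
proof -
  have "{g. g \<in> signed_perms V \<and> snd g p = s} = {g \<in> signed_perms V. Hilbert_Choice.inv (snd g) s = p}" for p
    by (auto simp: permutes_inv_eq)
  moreover have "(\<Sum>p\<in>V. \<Sum>g\<in>{g \<in> signed_perms V. Hilbert_Choice.inv (snd g) s = p}. q g) = (\<Sum>g\<in>signed_perms V. q g)"
    using V s by (intro sum.group) (auto simp: finite_bits finite_permutations permutes_in_image[OF permutes_inv])
  ultimately show ?thesis by simp
qed

text \<open>The norms \<open>h\<close> over the fibres are a test function for the vertex walk with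
  potential \<open>2 * a\<close>. Oddness of \<open>f\<close> produces the potential, and the
  reverse triangle inequality bounds the energy along transpositions.\<close>

lemma signed_energy_ge_of_odd:
  fixes f :: "('v \<Rightarrow> nat) \<times> ('v \<Rightarrow> 'v) \<Rightarrow> real"
  assumes V: "finite V" and s: "s \<in> V"
    and a: "\<And>i. i \<in> V \<Longrightarrow> 0 \<le> a i" and c: "\<And>x y. x \<in> V \<Longrightarrow> y \<in> V \<Longrightarrow> 0 \<le> c x y"
    and odd: "\<And>g. g \<in> signed_perms V \<Longrightarrow> f (flip s g) = - f g"
    and gap: "\<And>h. m * (\<Sum>x\<in>V. (h x)\<^sup>2) \<le> vertex_energy V c h + (\<Sum>x\<in>V. 2 * a x * (h x)\<^sup>2)"
  shows "m * (\<Sum>g\<in>signed_perms V. (f g)\<^sup>2)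
    \<le> walk.energy (signed_perms V) (V <+> V \<times> V) signed_step (case_sum a (\<lambda>(x, y). c x y / 2)) (\<lambda>_. 0) f"
proof -
  let ?B = "signed_perms V"
  define Fib where "Fib = (\<lambda>p. {g. g \<in> ?B \<and> snd g p = s})"
  define h where "h = (\<lambda>p. L2_set f (Fib p))"
  have finB: "finite ?B" using V by (simp add: finite_bits finite_permutations)
  have h2: "(h p)\<^sup>2 = (\<Sum>g\<in>Fib p. (f g)\<^sup>2)" for p
    unfolding h_def L2_set_def by (simp add: sum_nonneg)
  have fiber: "(\<Sum>g\<in>?B. q g) = (\<Sum>p\<in>V. \<Sum>g\<in>Fib p. q g)" for q :: "_ \<Rightarrow> real"
    unfolding Fib_def by (rule sum_signed_perms_fiber[OF V s])
  \<comment> \<open>On the fibre of \<open>i\<close> the move is \<open>flip s\<close>, which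
    negates \<open>f\<close>, so the difference is \<open>2 * f\<close>.\<close>
  have sign: "4 * (h i)\<^sup>2 \<le> (\<Sum>g\<in>?B. (f g - f (flip (snd g i) g))\<^sup>2)" if "i \<in> V" for i
  proof -
    have "4 * (h i)\<^sup>2 = (\<Sum>g\<in>Fib i. (f g - f (flip (snd g i) g))\<^sup>2)"
      unfolding h2 sum_distrib_left
      by (intro sum.cong refl) (auto simp: Fib_def odd power2_eq_square)
    also have "\<dots> \<le> (\<Sum>g\<in>?B. (f g - f (flip (snd g i) g))\<^sup>2)"
      using finB by (intro sum_mono2) (auto simp: Fib_def)
    finally show ?thesis .
  qed
  have swap: "(\<Sum>p\<in>V. (h p - h (transpose x y p))\<^sup>2) \<le> (\<Sum>g\<in>?B. (f g - f (fst g, snd g \<circ> transpose x y))\<^sup>2)"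
    if xy: "x \<in> V" "y \<in> V" for x y
  proof -
    \<comment> \<open>\<open>T\<close> exchanges the fibres of \<open>p\<close> and
      \<open>transpose x y p\<close>, so both values of \<open>h\<close> become norms over one
      fibre.\<close>
    define T where "T = (\<lambda>g :: ('v \<Rightarrow> nat) \<times> ('v \<Rightarrow> 'v). (fst g, snd g \<circ> transpose x y))"
    have h_T: "h (transpose x y p) = L2_set (\<lambda>g. f (T g)) (Fib p)" for p
    proof -
      have invol: "b \<circ> transpose x y \<circ> transpose x y = b" for b :: "'v \<Rightarrow> 'v"
        by (simp add: fun_eq_iff)
      have "(\<Sum>g\<in>Fib (transpose x y p). (f g)\<^sup>2) = (\<Sum>g\<in>Fib p. (f (T g))\<^sup>2)"
        by (rule sum.reindex_bij_witness[of _ T T])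
          (use permutes_swap_id[OF xy] in \<open>auto simp: Fib_def T_def invol intro!: permutes_compose\<close>)
      then show ?thesis by (simp add: h_def L2_set_def)
    qed
    have tri: "L2_set F A \<le> L2_set G A + L2_set (\<lambda>g. F g - G g) A" for F G :: "('v \<Rightarrow> nat) \<times> ('v \<Rightarrow> 'v) \<Rightarrow> real" and A
      using L2_set_triangle_ineq[of G "\<lambda>g. F g - G g" A] by simp
    have "(h p - h (transpose x y p))\<^sup>2 \<le> (\<Sum>g\<in>Fib p. (f g - f (T g))\<^sup>2)" for p
    proof -
      have "L2_set (\<lambda>g. f (T g) - f g) (Fib p) = L2_set (\<lambda>g. f g - f (T g)) (Fib p)"
        by (simp add: L2_set_def power2_commute)
      then have "\<bar>h p - h (transpose x y p)\<bar> \<le> L2_set (\<lambda>g. f g - f (T g)) (Fib p)"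
        using tri[of f "Fib p" "\<lambda>g. f (T g)"] tri[of "\<lambda>g. f (T g)" "Fib p" f]
        unfolding h_T unfolding h_def by simp
      then have "\<bar>h p - h (transpose x y p)\<bar>\<^sup>2 \<le> (L2_set (\<lambda>g. f g - f (T g)) (Fib p))\<^sup>2"
        by (intro power_mono) auto
      then show ?thesis by (simp add: L2_set_def sum_nonneg)
    qed
    then show ?thesis unfolding fiber T_def by (intro sum_mono)
  qed
  have "m * (\<Sum>g\<in>?B. (f g)\<^sup>2) = m * (\<Sum>p\<in>V. (h p)\<^sup>2)"
    by (simp add: fiber h2)
  also have "\<dots> \<le> vertex_energy V c h + (\<Sum>x\<in>V. 2 * a x * (h x)\<^sup>2)" by (rule gap)
  also have "\<dots> = (\<Sum>x\<in>V. \<Sum>y\<in>V. c x y / 2 * (\<Sum>p\<in>V. (h p - h (transpose x y p))\<^sup>2)) / 2 + (\<Sum>i\<in>V. a i * (4 * (h i)\<^sup>2)) / 2"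
  proof -
    have "vertex_energy V c h = (\<Sum>x\<in>V. \<Sum>y\<in>V. c x y / 2 * (\<Sum>p\<in>V. (h p - h (transpose x y p))\<^sup>2)) / 2"
      using vertex_walk_energy[OF V, of c "\<lambda>_. 0" h]
      unfolding walk.energy_def[OF vertex_walk[OF V]] sum.cartesian_product' by simp
    then show ?thesis by (simp add: sum_divide_distrib mult_ac)
  qed
  also have "\<dots> \<le> (\<Sum>x\<in>V. \<Sum>y\<in>V. c x y / 2 * (\<Sum>g\<in>?B. (f g - f (fst g, snd g \<circ> transpose x y))\<^sup>2)) / 2
      + (\<Sum>i\<in>V. a i * (\<Sum>g\<in>?B. (f g - f (flip (snd g i) g))\<^sup>2)) / 2"
    using a c swap sign by (intro add_mono divide_right_mono sum_mono mult_left_mono) auto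
  also have "\<dots> = walk.energy ?B (V <+> V \<times> V) signed_step (case_sum a (\<lambda>(x, y). c x y / 2)) (\<lambda>_. 0) f"
    using V unfolding walk.energy_def[OF signed_walk[OF V]]
    by (simp add: sum.Plus sum.cartesian_product' add_divide_distrib)
  finally show ?thesis .
qed

text \<open>The coordinates of \<eta> are switched on one at a time, each by at most one
  flip.\<close>

lemma flip_invariant_eq:
  assumes "finite V" and inv: "\<And>s g. s \<in> V \<Longrightarrow> g \<in> bits V \<times> P \<Longrightarrow> f (flip s g) = f g"
    and g: "(\<eta>, p) \<in> bits V \<times> P"
  shows "f (\<eta>, p) = f (\<lambda>_. 0, p)"
proof -
  have "f (\<lambda>i. if i \<in> S then \<eta> i else 0, p) = f (\<lambda>_. 0, p)" if "S \<subseteq> V" for S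
    using finite_subset[OF that assms(1)] that
  proof (induction S rule: finite_induct)
    case (insert s S)
    let ?g = "(\<lambda>i. if i \<in> S then \<eta> i else 0, p)"
    have g': "?g \<in> bits V \<times> P" using g by (auto simp: bits_def)
    have "(\<lambda>i. if i \<in> insert s S then \<eta> i else 0, p) = (if \<eta> s = 1 then flip s ?g else ?g)"
      using g insert.hyps(2) by (auto simp: flip_def bits_def fun_eq_iff)
    then show ?case
      using insert inv[OF _ g', of s] by auto
  qed simp
  from this[of V] have "f (\<lambda>i. if i \<in> V then \<eta> i else 0, p) = f (\<lambda>_. 0, p)" by simp
  moreover have "(\<lambda>i. if i \<in> V then \<eta> i else 0) = \<eta>"
    using g by (auto simp: bits_def fun_eq_iff)
  ultimately show ?thesis by simp
qed

text \<open>If some left flip changes \<open>f\<close>, its odd part yields the bound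
  \<open>m\<close>; otherwise \<open>f\<close> depends on the permutation alone and Aldous' theorem
  yields \<open>k\<close>.\<close>

lemma signed_eigenvalue_ge:
  fixes f :: "('v \<Rightarrow> nat) \<times> ('v \<Rightarrow> 'v) \<Rightarrow> complex"
  assumes V: "finite V" and a: "\<And>i. i \<in> V \<Longrightarrow> 0 \<le> a i"
    and c: "\<And>x y. x \<in> V \<Longrightarrow> y \<in> V \<Longrightarrow> 0 \<le> c x y" "\<And>x y. x \<in> V \<Longrightarrow> y \<in> V \<Longrightarrow> c x y = c y x"
    and gap_def: "\<And>h. m * (\<Sum>x\<in>V. (h x)\<^sup>2) \<le> vertex_energy V c h + (\<Sum>x\<in>V. 2 * a x * (h x)\<^sup>2)"
    and k: "0 \<le> k"
    and gap_perm: "\<And>h. sum h V = 0 \<Longrightarrow> k * (\<Sum>x\<in>V. (h x)\<^sup>2) \<le> vertex_energy V c h"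
    and eig: "\<And>g. g \<in> signed_perms V \<Longrightarrow>
      walk.lap (V <+> V \<times> V) signed_step (case_sum a (\<lambda>(x, y). c x y / 2)) (\<lambda>_. 0) f g = z * f g"
    and nc: "g1 \<in> signed_perms V" "g2 \<in> signed_perms V" "f g1 \<noteq> f g2"
  shows "min k m \<le> Re z"
proof -
  let ?B = "signed_perms V" and ?H = "V <+> V \<times> V" and ?w = "case_sum a (\<lambda>(x, y). c x y / 2)"
  interpret sw: walk ?B ?H signed_step ?w "\<lambda>_. 0"
    by (rule signed_walk[OF V])
  interpret ip: walk "{p. p permutes V}" "V \<times> V" "\<lambda>(x, y) p. p \<circ> transpose x y" "\<lambda>(x, y). c x y / 2" "\<lambda>_. 0"
    by (rule perm_walk[OF V])
  show ?thesis
  proof (cases "\<exists>s\<in>V. \<exists>g\<in>?B. f (flip s g) \<noteq> f g")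
    case True
    then obtain s g0 where s: "s \<in> V" and g0: "g0 \<in> ?B" "f (flip s g0) \<noteq> f g0" by blast
    define F where "F = (\<lambda>g. f g - f (flip s g))"
    \<comment> \<open>Left and right multiplications commute, so \<open>F\<close> inherits the
      eigenvalue of \<open>f\<close>.\<close>
    have step_flip: "signed_step h (flip s g) = flip s (signed_step h g)" for h g
      by (cases "(h, g)" rule: signed_step.cases) (auto simp: flip_commute flip_def split: prod.splits)
    have "sw.lap F g = z * F g" if "g \<in> ?B" for g
    proof -
      have "sw.lap F g = sw.lap f g - sw.lap f (flip s g)"
        by (simp add: sw.lap_def F_def step_flip sum_subtractf[symmetric] algebra_simps)
      then show ?thesis
        using eig[OF that] eig[OF flip_in[OF s that]] by (simp add: F_def right_diff_distrib)
    qed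
    moreover have "F g0 \<noteq> 0" using g0 by (simp add: F_def)
    moreover have "F (flip s g) = - F g" if "g \<in> ?B" for g
      using that by (simp add: F_def flip_flip)
    ultimately have "m \<le> Re z"
      using g0(1)
      by (intro sw.Re_eigenvalue_ge[of F z g0] signed_energy_ge_of_odd[OF V s a c(1) _ gap_def]) auto
    then show ?thesis by simp
  next
    case False
    define F where "F = (\<lambda>p. f (\<lambda>_. 0, p))"
    have inv: "f (flip s g) = f g" if "s \<in> V" "g \<in> ?B" for s g
      using that False by blast
    have f: "f g = F (snd g)" if "g \<in> ?B" for g
      using that flip_invariant_eq[where f = f and P = "{p. p permutes V}", OF V inv]
      by (cases g) (simp add: F_def)
    have zero: "(\<lambda>_. 0, p) \<in> ?B" if "p permutes V" for p
      using that by (simp add: bits_def)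
    have "ip.lap F p = z * F p" if p: "p \<in> {p. p permutes V}" for p
    proof -
      have p': "p permutes V" using p by simp
      have "sw.lap f (\<lambda>_. 0, p) = ip.lap F p"
      proof -
        \<comment> \<open>Sign moves contribute nothing here, which reduces the signed Laplacian to
          the one on permutations.\<close>
        have "f (flip (p i) (\<lambda>_. 0, p)) = f (\<lambda>_. 0, p)" if "i \<in> V" for i
          using that False zero[OF p'] permutes_in_image[OF p'] by blast
        then show ?thesis
          using V unfolding sw.lap_def ip.lap_def
          by (simp add: sum.Plus F_def case_prod_beta) (intro sum.cong refl, auto)
      qed
      then show ?thesis using eig[OF zero[OF p']] by (simp add: F_def)
    qed
    moreover have "k * (\<Sum>p | p permutes V. (g p)\<^sup>2) \<le> ip.energy g" if "(\<Sum>p | p permutes V. g p) = 0" for g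
      unfolding perm_walk_energy[OF V] using V c k gap_perm that by (rule aldous)
    ultimately have "k \<le> Re z"
      using nc f by (intro ip.Re_eigenvalue_ge_of_nonconstant[of F z "snd g1" "snd g2"]) auto
    then show ?thesis by simp
  qed
qed

section \<open>Representations of the hyperoctahedral group\<close>

text \<open>The conductances are given for \<open>i < j\<close>; the walks run over ordered pairs,
  each orientation with half of this weight.\<close>

definition sym_weight :: "(nat \<Rightarrow> nat \<Rightarrow> real) \<Rightarrow> nat \<Rightarrow> nat \<Rightarrow> real" where
  "sym_weight b x y = (if x < y then b x y else if y < x then b y x else 0)"

lemma sym_weight_commute: "sym_weight b x y = sym_weight b y x"
  by (simp add: sym_weight_def)

lemma carrier_hyperoctahedral: "carrier (hyperoctahedral n) = signed_perms {1..n}"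
  by (simp add: hyperoctahedral_def bits_def)

lemma one_hyperoctahedral: "\<one>\<^bsub>hyperoctahedral n\<^esub> = (\<lambda>_. 0, id)"
  by (simp add: hyperoctahedral_def)

lemma mult_hyperoctahedral:
  "(\<eta>, p) \<otimes>\<^bsub>hyperoctahedral n\<^esub> (\<zeta>, q) = (\<lambda>i. (\<eta> i + \<zeta> (Hilbert_Choice.inv p i)) mod 2, p \<circ> q)"
  by (simp add: hyperoctahedral_def)

lemma sign_change_in: "i \<in> V \<Longrightarrow> sign_change i \<in> signed_perms V"
  by (auto simp: sign_change_def bits_def permutes_id)

lemma swap_in: "i \<in> V \<Longrightarrow> j \<in> V \<Longrightarrow> Defs.swap i j \<in> signed_perms V"
  by (auto simp: Defs.swap_def bits_def intro: permutes_swap_id)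

lemma mult_sign_change:
  assumes g: "g \<in> signed_perms {1..n}"
  shows "g \<otimes>\<^bsub>hyperoctahedral n\<^esub> sign_change i = signed_step (Inl i) g"
proof (cases g)
  case (Pair \<eta> p)
  then have p: "bij p" and \<eta>: "\<eta> k = 0 \<or> \<eta> k = 1" for k
    using g by (auto simp: bits_def permutes_bij)
  have inv: "Hilbert_Choice.inv p k = i \<longleftrightarrow> k = p i" for k
    using bij_inv_eq_iff[OF p] by metis
  have "(\<eta> k + (if Hilbert_Choice.inv p k = i then 1 else 0)) mod 2 = (if k = p i then 1 - \<eta> k else \<eta> k)" for k
    unfolding inv using \<eta>[of k] by (elim disjE) auto
  then show ?thesis
    by (auto simp: Pair sign_change_def mult_hyperoctahedral flip_def fun_eq_iff)
qed

lemma mult_swap: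
  assumes g: "g \<in> signed_perms {1..n}"
  shows "g \<otimes>\<^bsub>hyperoctahedral n\<^esub> Defs.swap i j = signed_step (Inr (i, j)) g"
proof (cases g)
  case (Pair \<eta> p)
  then have \<eta>: "\<eta> k = 0 \<or> \<eta> k = 1" for k
    using g by (auto simp: bits_def)
  have "\<eta> k mod 2 = \<eta> k" for k using \<eta>[of k] by auto
  then show ?thesis
    by (simp add: Pair Defs.swap_def mult_hyperoctahedral)
qed

text \<open>Sums over the group against the weights become sums over generators, with transpositions
  indexed by ordered pairs as in the walks.\<close>

lemma sum_weights:
  fixes n :: nat and \<phi> :: "signed_perm \<Rightarrow> complex"
  defines "V \<equiv> {1..n}"
  shows "(\<Sum>g\<in>signed_perms V. of_real (sign_weight n a g + swap_weight n b g) * \<phi> g)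
    = (\<Sum>i\<in>V. of_real (a i) * \<phi> (sign_change i))
      + (\<Sum>x\<in>V. \<Sum>y\<in>V. of_real (sym_weight b x y / 2) * \<phi> (Defs.swap x y))"
proof -
  let ?B = "signed_perms V"
  have fin: "finite ?B" by (simp add: V_def finite_bits finite_permutations)
  have point: "(\<Sum>g\<in>?B. of_real (if g = h then r else 0) * \<phi> g) = of_real r * \<phi> h" if "h \<in> ?B" for h r
    using that fin by (simp add: if_distrib[of of_real] if_distrib[of "\<lambda>x. x * _"] cong: if_cong)
  have "(\<Sum>g\<in>?B. of_real (sign_weight n a g) * \<phi> g)
      = (\<Sum>i\<in>V. \<Sum>g\<in>?B. of_real (if g = sign_change i then a i else 0) * \<phi> g)"
    unfolding sign_weight_def V_def of_real_sum sum_distrib_right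
    by (subst sum.swap) (intro sum.cong refl, simp)
  also have "\<dots> = (\<Sum>i\<in>V. of_real (a i) * \<phi> (sign_change i))"
    by (intro sum.cong refl point sign_change_in)
  finally have 1: "(\<Sum>g\<in>?B. of_real (sign_weight n a g) * \<phi> g) = (\<Sum>i\<in>V. of_real (a i) * \<phi> (sign_change i))" .
  have P: "{(i, j). 1 \<le> i \<and> i < j \<and> j \<le> n} = {(i, j) \<in> V \<times> V. i < j}"
    by (auto simp: V_def)
  have "(\<Sum>g\<in>?B. of_real (swap_weight n b g) * \<phi> g)
      = (\<Sum>e | e \<in> V \<times> V \<and> fst e < snd e. \<Sum>g\<in>?B. of_real (if g = Defs.swap (fst e) (snd e) then b (fst e) (snd e) else 0) * \<phi> g)"
    unfolding swap_weight_def P of_real_sum sum_distrib_right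
    by (subst sum.swap) (intro sum.cong refl, auto)
  also have "\<dots> = (\<Sum>e | e \<in> V \<times> V \<and> fst e < snd e. of_real (b (fst e) (snd e)) * \<phi> (Defs.swap (fst e) (snd e)))"
    by (intro sum.cong refl point swap_in) auto
  also have "\<dots> = (\<Sum>e\<in>V \<times> V. if fst e < snd e then of_real (b (fst e) (snd e)) * \<phi> (Defs.swap (fst e) (snd e)) else 0)"
    by (intro sum.inter_filter) (simp add: V_def)
  also have "\<dots> = (\<Sum>x\<in>V. \<Sum>y\<in>V. if x < y then of_real (b x y) * \<phi> (Defs.swap x y) else 0)"
    unfolding sum.cartesian_product' by (simp cong: if_cong)
  also have "\<dots> = (\<Sum>x\<in>V. \<Sum>y\<in>V. of_real (sym_weight b x y / 2) * \<phi> (Defs.swap x y))"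
  proof -
    let ?F = "\<lambda>x y. if x < y then of_real (b x y) * \<phi> (Defs.swap x y) else 0"
    have "of_real (sym_weight b x y / 2) * \<phi> (Defs.swap x y) = (?F x y + ?F y x) / 2" for x y
      by (auto simp: sym_weight_def Defs.swap_def transpose_commute)
    then have "(\<Sum>x\<in>V. \<Sum>y\<in>V. of_real (sym_weight b x y / 2) * \<phi> (Defs.swap x y))
        = ((\<Sum>x\<in>V. \<Sum>y\<in>V. ?F x y) + (\<Sum>x\<in>V. \<Sum>y\<in>V. ?F y x)) / 2"
      by (simp add: sum.distrib sum_divide_distrib add_divide_distrib)
    also have "(\<Sum>x\<in>V. \<Sum>y\<in>V. ?F y x) = (\<Sum>x\<in>V. \<Sum>y\<in>V. ?F x y)"
      by (rule sum.swap)
    finally show ?thesis by simp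
  qed
  finally show ?thesis
    unfolding of_real_add distrib_right sum.distrib 1 by (rule arg_cong)
qed

section \<open>Eigenvectors of representation Laplacians\<close>

lemma laplacian_mult_vec:
  assumes R: "\<And>h. h \<in> carrier G \<Longrightarrow> R h \<in> carrier_mat d d" and v: "v \<in> carrier_vec d" and i: "i < d"
  shows "(laplacian G w d R *\<^sub>v v) $ i = (\<Sum>h\<in>carrier G. of_real (w h) * (v $ i - (R h *\<^sub>v v) $ i))"
proof -
  have "(laplacian G w d R *\<^sub>v v) $ i = (\<Sum>j<d. (\<Sum>h\<in>carrier G. of_real (w h) * (1\<^sub>m d - R h) $$ (i, j)) * v $ j)"
    using v i by (simp add: laplacian_def scalar_prod_def lessThan_atLeast0)
  also have "\<dots> = (\<Sum>h\<in>carrier G. of_real (w h) * (\<Sum>j<d. (1\<^sub>m d - R h) $$ (i, j) * v $ j))"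
    unfolding sum_distrib_left sum_distrib_right by (subst sum.swap) (simp add: mult.assoc)
  also have "\<dots> = (\<Sum>h\<in>carrier G. of_real (w h) * (v $ i - (R h *\<^sub>v v) $ i))"
  proof (intro sum.cong refl arg_cong2[where f = "(*)"])
    fix h assume h: "h \<in> carrier G"
    have "(R h *\<^sub>v v) $ i = (\<Sum>j<d. R h $$ (i, j) * v $ j)"
      using R[OF h] v i by (simp add: scalar_prod_def lessThan_atLeast0)
    moreover have "(\<Sum>j<d. (1\<^sub>m d - R h) $$ (i, j) * v $ j) = (\<Sum>j<d. (if i = j then v $ j else 0) - R h $$ (i, j) * v $ j)"
      using R[OF h] i by (intro sum.cong refl) (auto simp: left_diff_distrib)
    ultimately show "(\<Sum>j<d. (1\<^sub>m d - R h) $$ (i, j) * v $ j) = v $ i - (R h *\<^sub>v v) $ i"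
      using i by (simp add: sum_subtractf)
  qed
  finally show ?thesis .
qed

lemma nontrivial_eigenvector:
  assumes "eigenvalue (laplacian G w d R) k" "\<not> trivial_eigenvalue G w d R k"
  obtains v where "v \<in> carrier_vec d" "v \<noteq> 0\<^sub>v d" "laplacian G w d R *\<^sub>v v = k \<cdot>\<^sub>v v" "\<not> invariant_vec G R v"
proof -
  have "dim_row (laplacian G w d R) = d" by (simp add: laplacian_def)
  with assms that show thesis
    unfolding trivial_eigenvalue_def eigenvector_def by auto
qed

text \<open>The vector \<open>v\<close> shows that \<open>c\<close> is a nontrivial eigenvalue.
  Every nontrivial eigenvalue has a non-invariant eigenvector, so the lower bound is tested on
  these.\<close>

lemma rep_gap_eqI:
  assumes v: "v \<in> carrier_vec d" "v \<noteq> 0\<^sub>v d" "laplacian G w d R *\<^sub>v v = of_real c \<cdot>\<^sub>v v" "\<not> invariant_vec G R v"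
    and ge: "\<And>k v. v \<in> carrier_vec d \<Longrightarrow> v \<noteq> 0\<^sub>v d \<Longrightarrow> laplacian G w d R *\<^sub>v v = k \<cdot>\<^sub>v v \<Longrightarrow>
      \<not> invariant_vec G R v \<Longrightarrow> c \<le> Re k"
  shows "rep_gap G w d R = ereal c"
proof (rule antisym)
  have e: "eigenvector (laplacian G w d R) v (of_real c)"
    using v by (simp add: eigenvector_def laplacian_def)
  then have "eigenvalue (laplacian G w d R) (of_real c)" "\<not> trivial_eigenvalue G w d R (of_real c)"
    using v(4) by (auto simp: eigenvalue_def trivial_eigenvalue_def)
  then show "rep_gap G w d R \<le> ereal c"
    unfolding rep_gap_def by (intro INF_lower2[of "of_real c"]) auto
  show "ereal c \<le> rep_gap G w d R"
    unfolding rep_gap_def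
  proof (rule INF_greatest)
    fix k assume "k \<in> {k. eigenvalue (laplacian G w d R) k \<and> \<not> trivial_eigenvalue G w d R k}"
    then show "ereal c \<le> ereal (Re k)"
      by (auto elim!: nontrivial_eigenvector intro: ge)
  qed
qed

text \<open>By multiplicativity, a right step by \<open>h\<close> inserts \<open>R h\<close> between
  \<open>R g\<close> and \<open>v\<close>. The weighted differences therefore sum to
  \<open>R g\<close> applied to the Laplacian of \<open>v\<close>.\<close>

lemma matrix_coefficient_eigenfunction:
  fixes n :: nat and R :: "signed_perm \<Rightarrow> complex mat"
  defines "V \<equiv> {1..n}"
  assumes rep: "representation (hyperoctahedral n) d R" and v: "v \<in> carrier_vec d" and i: "i < d"
    and eig: "laplacian (hyperoctahedral n) (\<lambda>g. sign_weight n a g + swap_weight n b g) d R *\<^sub>v v = k \<cdot>\<^sub>v v"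
    and g: "g \<in> signed_perms V"
  shows "walk.lap (V <+> V \<times> V) signed_step (case_sum a (\<lambda>(x, y). sym_weight b x y / 2)) (\<lambda>_. 0)
      (\<lambda>g. (R g *\<^sub>v v) $ i) g = k * (R g *\<^sub>v v) $ i"
proof -
  let ?G = "hyperoctahedral n" and ?B = "signed_perms V"
  let ?w = "\<lambda>g. sign_weight n a g + swap_weight n b g"
  have carr: "carrier ?G = ?B" by (simp add: carrier_hyperoctahedral V_def)
  have R: "h \<in> ?B \<Longrightarrow> R h \<in> carrier_mat d d" and R_mult: "g \<in> ?B \<Longrightarrow> h \<in> ?B \<Longrightarrow> R (g \<otimes>\<^bsub>?G\<^esub> h) = R g * R h" for g h
    using rep by (auto simp: representation_def carr)
  define f where "f = (\<lambda>g. (R g *\<^sub>v v) $ i)"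
  have act: "(R h *\<^sub>v u) $ i = (\<Sum>j<d. R h $$ (i, j) * u $ j)" if "h \<in> ?B" "u \<in> carrier_vec d" for h u
    using R[OF that(1)] that(2) i by (simp add: scalar_prod_def lessThan_atLeast0)
  have f_mult: "f (g \<otimes>\<^bsub>?G\<^esub> h) = (\<Sum>j<d. R g $$ (i, j) * (R h *\<^sub>v v) $ j)" if "h \<in> ?B" for h
  proof -
    have "f (g \<otimes>\<^bsub>?G\<^esub> h) = (R g *\<^sub>v (R h *\<^sub>v v)) $ i"
      unfolding f_def R_mult[OF g that] using R[OF g] R[OF that] v by (simp add: assoc_mult_mat_vec)
    then show ?thesis using R[OF that] v by (simp add: act[OF g] mult_mat_vec_carrier)
  qed
  have f_g: "f g = (\<Sum>j<d. R g $$ (i, j) * v $ j)"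
    by (simp add: f_def act[OF g v])
  have "k * f g = (\<Sum>j<d. R g $$ (i, j) * (k \<cdot>\<^sub>v v) $ j)"
    using v by (simp add: f_g sum_distrib_left mult.left_commute)
  also have "\<dots> = (\<Sum>j<d. R g $$ (i, j) * (\<Sum>h\<in>?B. of_real (?w h) * (v $ j - (R h *\<^sub>v v) $ j)))"
    unfolding eig[symmetric] using R v
    by (intro sum.cong refl arg_cong2[where f = "(*)"]) (subst laplacian_mult_vec, auto simp: carr)
  also have "\<dots> = (\<Sum>h\<in>?B. of_real (?w h) * (\<Sum>j<d. R g $$ (i, j) * (v $ j - (R h *\<^sub>v v) $ j)))"
    unfolding sum_distrib_left by (subst sum.swap) (simp only: mult.left_commute)
  also have "\<dots> = (\<Sum>h\<in>?B. of_real (?w h) * (f g - f (g \<otimes>\<^bsub>?G\<^esub> h)))"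
    by (intro sum.cong refl arg_cong2[where f = "(*)"])
      (simp add: f_mult f_g right_diff_distrib sum_subtractf)
  also have "\<dots> = (\<Sum>i\<in>V. of_real (a i) * (f g - f (g \<otimes>\<^bsub>?G\<^esub> sign_change i)))
      + (\<Sum>x\<in>V. \<Sum>y\<in>V. of_real (sym_weight b x y / 2) * (f g - f (g \<otimes>\<^bsub>?G\<^esub> Defs.swap x y)))"
    unfolding V_def by (rule sum_weights)
  also have "\<dots> = walk.lap (V <+> V \<times> V) signed_step (case_sum a (\<lambda>(x, y). sym_weight b x y / 2)) (\<lambda>_. 0) f g"
  proof -
    have "finite V" by (simp add: V_def)
    from signed_walk[OF this] show ?thesis
      using g by (simp add: walk.lap_def[OF signed_walk] V_def sum.Plus sum.cartesian_product' mult_sign_change mult_swap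
          scaleR_conv_of_real del: signed_step.simps)
  qed
  finally show ?thesis by (simp add: f_def)
qed

section \<open>The two representations of dimension \<open>n\<close>\<close>

lemma (in walk) lap_of_real: "lap (\<lambda>x. complex_of_real (f x)) p = of_real (lap f p)"
  by (simp add: lap_def scaleR_conv_of_real)

lemma inv_pred_less:
  assumes "p permutes {1..n}" "i < n"
  shows "Hilbert_Choice.inv p (Suc i) - 1 < n" "Suc (Hilbert_Choice.inv p (Suc i) - 1) = Hilbert_Choice.inv p (Suc i)"
proof -
  have "Hilbert_Choice.inv p (Suc i) \<in> {1..n}"
    using permutes_in_image[OF permutes_inv[OF assms(1)], of "Suc i"] assms(2) by simp
  then show "Hilbert_Choice.inv p (Suc i) - 1 < n" "Suc (Hilbert_Choice.inv p (Suc i) - 1) = Hilbert_Choice.inv p (Suc i)"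
    by auto
qed

text \<open>Row \<open>i\<close> has one nonzero entry, in the column of the preimage of
  \<open>Suc i\<close>; subtracting one converts points to matrix indices.\<close>

lemma defining_rep_mult_vec:
  assumes p: "p permutes {1..n}" and v: "v \<in> carrier_vec n" and i: "i < n"
  shows "(defining_rep n (\<eta>, p) *\<^sub>v v) $ i = (- 1) ^ \<eta> (Suc i) * v $ (Hilbert_Choice.inv p (Suc i) - 1)"
proof -
  let ?k = "Hilbert_Choice.inv p (Suc i) - 1"
  note k = inv_pred_less[OF p i]
  have eq: "Suc i = p (Suc j) \<longleftrightarrow> j = ?k" for j
    using permutes_inv_eq[OF p, of "Suc i" "Suc j"] k(2) by (metis Suc_inject)
  have "(defining_rep n (\<eta>, p) *\<^sub>v v) $ i = (\<Sum>j<n. (- 1) ^ \<eta> (Suc i) * (if Suc i = p (Suc j) then 1 else 0) * v $ j)"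
    using v i by (simp add: defining_rep_def scalar_prod_def lessThan_atLeast0)
  also have "\<dots> = (\<Sum>j<n. if j = ?k then (- 1) ^ \<eta> (Suc i) * v $ ?k else 0)"
    unfolding eq by (intro sum.cong) auto
  also have "\<dots> = (- 1) ^ \<eta> (Suc i) * v $ ?k"
    using k(1) by simp
  finally show ?thesis .
qed

text \<open>Forgetting signs reduces computations to the defining representation.\<close>

lemma perm_rep_eq: "perm_rep n g = defining_rep n (\<lambda>_. 0, snd g)"
  by (auto simp: perm_rep_def defining_rep_def split: prod.splits)

lemma defining_rep_carrier: "defining_rep n g \<in> carrier_mat n n"
  by (simp add: defining_rep_def split: prod.splits)

lemma dim_defining_rep [simp]: "dim_row (defining_rep n g) = n" "dim_col (defining_rep n g) = n"
  by (simp_all add: defining_rep_def split: prod.splits)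

lemma representation_defining_rep: "representation (hyperoctahedral n) n (defining_rep n)"
  unfolding representation_def carrier_hyperoctahedral
proof (intro conjI ballI)
  show "defining_rep n \<one>\<^bsub>hyperoctahedral n\<^esub> = 1\<^sub>m n"
    by (auto simp: one_hyperoctahedral defining_rep_def)
  fix g h assume "g \<in> signed_perms {1..n}" "h \<in> signed_perms {1..n}"
  then obtain \<eta> p \<zeta> q where g: "g = (\<eta>, p)" "p permutes {1..n}" "\<And>k. \<eta> k = 0 \<or> \<eta> k = 1"
    and h: "h = (\<zeta>, q)" "q permutes {1..n}" "\<And>k. \<zeta> k = 0 \<or> \<zeta> k = 1"
    by (auto simp: bits_def)
  show "defining_rep n (g \<otimes>\<^bsub>hyperoctahedral n\<^esub> h) = defining_rep n g * defining_rep n h"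
  proof (rule eq_matI)
    fix i j assume "i < dim_row (defining_rep n g * defining_rep n h)" "j < dim_col (defining_rep n g * defining_rep n h)"
    then have ij: "i < n" "j < n" by simp_all
    have col: "col (defining_rep n h) j \<in> carrier_vec n"
      by (rule carrier_vecI) (simp only: dim_col dim_defining_rep)
    let ?k = "Hilbert_Choice.inv p (Suc i)"
    note k = inv_pred_less[OF g(2) ij(1)]
    have "(defining_rep n g * defining_rep n h) $$ (i, j) = (defining_rep n g *\<^sub>v col (defining_rep n h) j) $ i"
      using ij by simp
    also have "\<dots> = (- 1) ^ \<eta> (Suc i) * defining_rep n h $$ (?k - 1, j)"
      unfolding g(1) using defining_rep_mult_vec[OF g(2) col ij(1)] k(1) ij by simp
    also have "\<dots> = (- 1) ^ \<eta> (Suc i) * ((- 1) ^ \<zeta> ?k * (if ?k = q (Suc j) then 1 else 0))"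
      using k ij by (simp add: h(1) defining_rep_def)
    also have "\<dots> = (- 1) ^ ((\<eta> (Suc i) + \<zeta> ?k) mod 2) * (if Suc i = p (q (Suc j)) then 1 else 0)"
      using g(3)[of "Suc i"] h(3)[of ?k] permutes_inv_eq[OF g(2), of "Suc i" "q (Suc j)"] by auto
    also have "\<dots> = defining_rep n (g \<otimes>\<^bsub>hyperoctahedral n\<^esub> h) $$ (i, j)"
      using ij by (simp add: g(1) h(1) mult_hyperoctahedral defining_rep_def)
    finally show "defining_rep n (g \<otimes>\<^bsub>hyperoctahedral n\<^esub> h) $$ (i, j) = (defining_rep n g * defining_rep n h) $$ (i, j)" ..
  qed simp_all
qed (rule defining_rep_carrier)

lemma representation_perm_rep: "representation (hyperoctahedral n) n (perm_rep n)"
proof -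
  have "perm_rep n (g \<otimes>\<^bsub>hyperoctahedral n\<^esub> h) = perm_rep n g * perm_rep n h"
    if "g \<in> signed_perms {1..n}" "h \<in> signed_perms {1..n}" for g h
  proof -
    have "(\<lambda>_. 0, snd g) \<in> signed_perms {1..n}" "(\<lambda>_. 0, snd h) \<in> signed_perms {1..n}"
      using that by (auto simp: bits_def)
    moreover have "(\<lambda>_. 0, snd (g \<otimes>\<^bsub>hyperoctahedral n\<^esub> h)) = (\<lambda>_. 0, snd g) \<otimes>\<^bsub>hyperoctahedral n\<^esub> (\<lambda>_. 0, snd h)"
      by (cases g; cases h) (simp add: mult_hyperoctahedral)
    ultimately show ?thesis
      using representation_defining_rep[of n]
      unfolding perm_rep_eq representation_def carrier_hyperoctahedral by metis
  qed
  moreover have "perm_rep n \<one>\<^bsub>hyperoctahedral n\<^esub> = 1\<^sub>m n"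
    using representation_defining_rep[of n]
    by (simp add: perm_rep_eq representation_def one_hyperoctahedral)
  ultimately show ?thesis
    by (simp add: representation_def carrier_hyperoctahedral perm_rep_eq defining_rep_carrier)
qed

abbreviation (input) hyp_weight :: "nat \<Rightarrow> (nat \<Rightarrow> real) \<Rightarrow> (nat \<Rightarrow> nat \<Rightarrow> real) \<Rightarrow> signed_perm \<Rightarrow> real" where
  "hyp_weight n a b \<equiv> \<lambda>g. sign_weight n a g + swap_weight n b g"

abbreviation vertex_lap ::
    "nat \<Rightarrow> (nat \<Rightarrow> nat \<Rightarrow> real) \<Rightarrow> (nat \<Rightarrow> real) \<Rightarrow> (nat \<Rightarrow> 'b :: real_vector) \<Rightarrow> nat \<Rightarrow> 'b" where
  "vertex_lap n b pot \<equiv> walk.lap ({1..n} \<times> {1..n}) (\<lambda>(x, y). transpose x y) (\<lambda>(x, y). sym_weight b x y / 2) pot"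

text \<open>A sign change negates only its own coordinate, where its difference from the identity is
  \<open>2\<close>; this is the source of the potential.\<close>

lemma defining_laplacian_mult_vec:
  assumes v: "v \<in> carrier_vec n" and i: "i < n"
  shows "(laplacian (hyperoctahedral n) (hyp_weight n a b) n (defining_rep n) *\<^sub>v v) $ i
    = vertex_lap n b (\<lambda>x. 2 * a x) (\<lambda>x. v $ (x - 1)) (Suc i)"
proof -
  let ?\<phi> = "\<lambda>h. v $ i - (defining_rep n h *\<^sub>v v) $ i"
  have id: "id permutes {1..n}" by (rule permutes_id)
  have sc: "?\<phi> (sign_change k) = (if Suc i = k then 2 * v $ i else 0)" for k
    unfolding sign_change_def defining_rep_mult_vec[OF id v i] by auto
  have sw: "?\<phi> (Defs.swap x y) = v $ i - v $ (transpose x y (Suc i) - 1)" if "x \<in> {1..n}" "y \<in> {1..n}" for x y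
    unfolding Defs.swap_def defining_rep_mult_vec[OF permutes_swap_id[OF that] v i] by simp
  have "(laplacian (hyperoctahedral n) (hyp_weight n a b) n (defining_rep n) *\<^sub>v v) $ i
      = (\<Sum>h\<in>signed_perms {1..n}. of_real (hyp_weight n a b h) * ?\<phi> h)"
    using laplacian_mult_vec[of "hyperoctahedral n" "defining_rep n", OF defining_rep_carrier v i, of "hyp_weight n a b"]
    unfolding carrier_hyperoctahedral .
  also have "\<dots> = of_real (2 * a (Suc i)) * v $ i
      + (\<Sum>x\<in>{1..n}. \<Sum>y\<in>{1..n}. of_real (sym_weight b x y / 2) * (v $ i - v $ (transpose x y (Suc i) - 1)))"
    unfolding sum_weights
  proof (intro arg_cong2[where f = "(+)"] sum.cong refl)
    have "(\<Sum>k\<in>{1..n}. of_real (a k) * ?\<phi> (sign_change k)) = (\<Sum>k\<in>{1..n}. if Suc i = k then of_real (2 * a k) * v $ i else 0)"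
      unfolding sc by (intro sum.cong) auto
    then show "(\<Sum>k\<in>{1..n}. of_real (a k) * ?\<phi> (sign_change k)) = of_real (2 * a (Suc i)) * v $ i"
      using i by (simp del: One_nat_def)
  qed (simp only: sw)
  also have "\<dots> = vertex_lap n b (\<lambda>x. 2 * a x) (\<lambda>x. v $ (x - 1)) (Suc i)"
    unfolding walk.lap_def[OF vertex_walk[OF finite_atLeastAtMost]] sum.cartesian_product'
    by (simp add: scaleR_conv_of_real)
  finally show ?thesis .
qed

lemma perm_laplacian_mult_vec:
  assumes v: "v \<in> carrier_vec n" and i: "i < n"
  shows "(laplacian (hyperoctahedral n) (hyp_weight n a b) n (perm_rep n) *\<^sub>v v) $ i
    = vertex_lap n b (\<lambda>_. 0) (\<lambda>x. v $ (x - 1)) (Suc i)"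
proof -
  let ?\<phi> = "\<lambda>h. v $ i - (perm_rep n h *\<^sub>v v) $ i"
  have id: "id permutes {1..n}" by (rule permutes_id)
  have sc: "?\<phi> (sign_change k) = 0" for k
    unfolding perm_rep_eq sign_change_def snd_conv defining_rep_mult_vec[OF id v i] by simp
  have sw: "?\<phi> (Defs.swap x y) = v $ i - v $ (transpose x y (Suc i) - 1)" if "x \<in> {1..n}" "y \<in> {1..n}" for x y
    unfolding perm_rep_eq Defs.swap_def snd_conv defining_rep_mult_vec[OF permutes_swap_id[OF that] v i] by simp
  have "(laplacian (hyperoctahedral n) (hyp_weight n a b) n (perm_rep n) *\<^sub>v v) $ i
      = (\<Sum>h\<in>signed_perms {1..n}. of_real (hyp_weight n a b h) * ?\<phi> h)"
    using laplacian_mult_vec[of "hyperoctahedral n" "perm_rep n", OF _ v i] by (simp add: carrier_hyperoctahedral perm_rep_eq defining_rep_carrier)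
  also have "\<dots> = (\<Sum>x\<in>{1..n}. \<Sum>y\<in>{1..n}. of_real (sym_weight b x y / 2) * (v $ i - v $ (transpose x y (Suc i) - 1)))"
    unfolding sum_weights sc mult_zero_right sum.neutral_const add_0_left
    by (intro sum.cong refl) (simp only: sw)
  also have "\<dots> = vertex_lap n b (\<lambda>_. 0) (\<lambda>x. v $ (x - 1)) (Suc i)"
    unfolding walk.lap_def[OF vertex_walk[OF finite_atLeastAtMost]] sum.cartesian_product'
    by (simp add: scaleR_conv_of_real)
  finally show ?thesis .
qed

lemma rep_gap_perm:
  assumes f: "sum f {1..n} = 0" "x0 \<in> {1..n}" "f x0 \<noteq> 0" "\<And>x. x \<in> {1..n} \<Longrightarrow> vertex_lap n b (\<lambda>_. 0) f x = c * f x"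
    and gap: "\<And>h. sum h {1..n} = 0 \<Longrightarrow> c * (\<Sum>x\<in>{1..n}. (h x)\<^sup>2) \<le> vertex_energy {1..n} (sym_weight b) h"
  shows "rep_gap (hyperoctahedral n) (hyp_weight n a b) n (perm_rep n) = ereal c"
proof (rule rep_gap_eqI)
  interpret rw: walk "{1..n}" "{1..n} \<times> {1..n}" "\<lambda>(x, y). transpose x y" "\<lambda>(x, y). sym_weight b x y / 2" "\<lambda>_. 0"
    by (rule vertex_walk) simp
  let ?G = "hyperoctahedral n" and ?L = "laplacian (hyperoctahedral n) (hyp_weight n a b) n (perm_rep n)"
  define v where "v = vec n (\<lambda>i. complex_of_real (f (Suc i)))"
  have L: "?L \<in> carrier_mat n n" by (simp add: laplacian_def)
  have v_eq: "v $ (x - 1) = of_real (f x)" if "x \<in> {1..n}" for x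
    using that by (auto simp: v_def)
  show v: "v \<in> carrier_vec n" by (simp add: v_def)
  show "v \<noteq> 0\<^sub>v n"
  proof
    assume "v = 0\<^sub>v n"
    then show False using v_eq[OF f(2)] f(2,3) by auto
  qed
  show "?L *\<^sub>v v = of_real c \<cdot>\<^sub>v v"
  proof (rule eq_vecI)
    fix i assume "i < dim_vec (of_real c \<cdot>\<^sub>v v)"
    then have i: "i < n" by (simp add: v_def)
    have "(?L *\<^sub>v v) $ i = rw.lap (\<lambda>x. v $ (x - 1)) (Suc i)"
      by (rule perm_laplacian_mult_vec[OF v i])
    also have "\<dots> = rw.lap (\<lambda>x. complex_of_real (f x)) (Suc i)"
      using i by (intro rw.lap_cong v_eq) auto
    also have "\<dots> = of_real (rw.lap f (Suc i))"
      by (rule rw.lap_of_real)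
    also have "\<dots> = (of_real c \<cdot>\<^sub>v v) $ i"
      using i f(4)[of "Suc i"] by (simp add: v_def)
    finally show "(?L *\<^sub>v v) $ i = (of_real c \<cdot>\<^sub>v v) $ i" .
  qed (use L v in auto)
  show "\<not> invariant_vec ?G (perm_rep n) v"
  proof
    assume inv: "invariant_vec ?G (perm_rep n) v"
    \<comment> \<open>Invariance under transpositions makes \<open>f\<close> constant, and sum zero
      then contradicts \<open>f x0 \<noteq> 0\<close>.\<close>
    have "f x = f x0" if x: "x \<in> {1..n}" for x
    proof -
      have x1: "x - 1 < n" "Suc (x - 1) = x" using x by auto
      have "perm_rep n (Defs.swap x x0) *\<^sub>v v = v"
        using bspec[OF inv[unfolded invariant_vec_def carrier_hyperoctahedral] swap_in[OF x f(2)]] .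
      moreover have "(perm_rep n (Defs.swap x x0) *\<^sub>v v) $ (x - 1) = v $ (x0 - 1)"
        unfolding perm_rep_eq Defs.swap_def snd_conv defining_rep_mult_vec[OF permutes_swap_id[OF x f(2)] v x1(1)]
        using x1 by simp
      ultimately show ?thesis using v_eq[OF x] v_eq[OF f(2)] by simp
    qed
    then have "sum f {1..n} = of_nat n * f x0" by simp
    then show False using f(1-3) by auto
  qed
  fix k u assume u: "u \<in> carrier_vec n" "u \<noteq> 0\<^sub>v n" "?L *\<^sub>v u = k \<cdot>\<^sub>v u" "\<not> invariant_vec ?G (perm_rep n) u"
  define F where "F = (\<lambda>x. u $ (x - 1))"
  have eig: "rw.lap F x = k * F x" if "x \<in> {1..n}" for x
  proof -
    have x: "x - 1 < n" "Suc (x - 1) = x" using that by auto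
    show ?thesis
      using perm_laplacian_mult_vec[OF u(1) x(1), of a b] u(1,3) x by (simp add: F_def)
  qed
  \<comment> \<open>Constant vectors are invariant, so a non-invariant eigenvector is
    nonconstant.\<close>
  obtain x y where xy: "x \<in> {1..n}" "y \<in> {1..n}" "F x \<noteq> F y"
  proof (rule ccontr)
    assume "\<not> thesis"
    with that have const: "F x = F y" if "x \<in> {1..n}" "y \<in> {1..n}" for x y
      using that by blast
    have "perm_rep n g *\<^sub>v u = u" if g: "g \<in> signed_perms {1..n}" for g
    proof (rule eq_vecI)
      fix i assume "i < dim_vec u"
      then have i: "i < n" using u(1) by simp
      have p: "snd g permutes {1..n}" using g by auto
      have "(perm_rep n g *\<^sub>v u) $ i = F (Hilbert_Choice.inv (snd g) (Suc i))"
        unfolding perm_rep_eq defining_rep_mult_vec[OF p u(1) i] by (simp add: F_def)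
      also have "\<dots> = F (Suc i)"
        using i permutes_in_image[OF permutes_inv[OF p], of "Suc i"] by (intro const) auto
      finally show "(perm_rep n g *\<^sub>v u) $ i = u $ i" by (simp add: F_def)
    qed (use u(1) defining_rep_carrier[of n "(\<lambda>_. 0, snd g)"] in \<open>auto simp: perm_rep_eq\<close>)
    then show False using u(4) by (simp add: invariant_vec_def carrier_hyperoctahedral)
  qed
  show "c \<le> Re k"
  proof (rule rw.Re_eigenvalue_ge_of_nonconstant[OF eig xy])
    show "c * (\<Sum>p\<in>{1..n}. (g p)\<^sup>2) \<le> rw.energy g" if "sum g {1..n} = 0" for g
      using gap[OF that] vertex_walk_energy[of "{1..n}" "sym_weight b" "\<lambda>_. 0" g] by simp
  qed auto
qed

lemma rep_gap_defining:
  assumes f: "x0 \<in> {1..n}" "f x0 \<noteq> 0" "\<And>x. x \<in> {1..n} \<Longrightarrow> vertex_lap n b (\<lambda>x. 2 * a x) f x = c * f x"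
    and gap: "\<And>h. c * (\<Sum>x\<in>{1..n}. (h x)\<^sup>2) \<le> vertex_energy {1..n} (sym_weight b) h + (\<Sum>x\<in>{1..n}. 2 * a x * (h x)\<^sup>2)"
  shows "rep_gap (hyperoctahedral n) (hyp_weight n a b) n (defining_rep n) = ereal c"
proof (rule rep_gap_eqI)
  interpret rw: walk "{1..n}" "{1..n} \<times> {1..n}" "\<lambda>(x, y). transpose x y" "\<lambda>(x, y). sym_weight b x y / 2" "\<lambda>x. 2 * a x"
    by (rule vertex_walk) simp
  let ?G = "hyperoctahedral n" and ?L = "laplacian (hyperoctahedral n) (hyp_weight n a b) n (defining_rep n)"
  define v where "v = vec n (\<lambda>i. complex_of_real (f (Suc i)))"
  have L: "?L \<in> carrier_mat n n" by (simp add: laplacian_def)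
  have v_eq: "v $ (x - 1) = of_real (f x)" if "x \<in> {1..n}" for x
    using that by (auto simp: v_def)
  show v: "v \<in> carrier_vec n" by (simp add: v_def)
  show "v \<noteq> 0\<^sub>v n"
  proof
    assume "v = 0\<^sub>v n"
    then show False using v_eq[OF f(1)] f(1,2) by auto
  qed
  show "?L *\<^sub>v v = of_real c \<cdot>\<^sub>v v"
  proof (rule eq_vecI)
    fix i assume "i < dim_vec (of_real c \<cdot>\<^sub>v v)"
    then have i: "i < n" by (simp add: v_def)
    have "(?L *\<^sub>v v) $ i = rw.lap (\<lambda>x. v $ (x - 1)) (Suc i)"
      by (rule defining_laplacian_mult_vec[OF v i])
    also have "\<dots> = rw.lap (\<lambda>x. complex_of_real (f x)) (Suc i)"
      using i by (intro rw.lap_cong v_eq) auto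
    also have "\<dots> = of_real (rw.lap f (Suc i))"
      by (rule rw.lap_of_real)
    also have "\<dots> = (of_real c \<cdot>\<^sub>v v) $ i"
      using i f(3)[of "Suc i"] by (simp add: v_def)
    finally show "(?L *\<^sub>v v) $ i = (of_real c \<cdot>\<^sub>v v) $ i" .
  qed (use L v in auto)
  show "\<not> invariant_vec ?G (defining_rep n) v"
  proof
    assume inv: "invariant_vec ?G (defining_rep n) v"
    have x1: "x0 - 1 < n" "Suc (x0 - 1) = x0" using f(1) by auto
    \<comment> \<open>The sign change at \<open>x0\<close> negates a nonzero coordinate of
      \<open>v\<close>.\<close>
    have "defining_rep n (sign_change x0) *\<^sub>v v = v"
      using bspec[OF inv[unfolded invariant_vec_def carrier_hyperoctahedral] sign_change_in[OF f(1)]] .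
    moreover have "(defining_rep n (sign_change x0) *\<^sub>v v) $ (x0 - 1) = - v $ (x0 - 1)"
      unfolding sign_change_def defining_rep_mult_vec[OF permutes_id v x1(1)] using x1 by simp
    ultimately show False using v_eq[OF f(1)] f(2) by simp
  qed
  fix k u assume u: "u \<in> carrier_vec n" "u \<noteq> 0\<^sub>v n" "?L *\<^sub>v u = k \<cdot>\<^sub>v u"
  define F where "F = (\<lambda>x. u $ (x - 1))"
  have eig: "rw.lap F x = k * F x" if "x \<in> {1..n}" for x
  proof -
    have x: "x - 1 < n" "Suc (x - 1) = x" using that by auto
    show ?thesis
      using defining_laplacian_mult_vec[OF u(1) x(1), of a b] u(1,3) x by (simp add: F_def)
  qed
  obtain i where "i < n" "u $ i \<noteq> 0"
    using u(1,2) by (metis carrier_vecD dim_vec eq_vecI index_zero_vec)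
  then have x: "Suc i \<in> {1..n}" "F (Suc i) \<noteq> 0" by (auto simp: F_def)
  show "c \<le> Re k"
    using gap vertex_walk_energy[of "{1..n}" "sym_weight b" "\<lambda>x. 2 * a x"]
    by (intro rw.Re_eigenvalue_ge[OF eig x]) auto
qed

section \<open>The two regimes\<close>

lemma vertex_energy_nonneg:
  assumes "\<And>x y. x \<in> V \<Longrightarrow> y \<in> V \<Longrightarrow> 0 \<le> c x y"
  shows "0 \<le> vertex_energy V c h"
  unfolding vertex_energy_def using assms by (intro divide_nonneg_pos sum_nonneg mult_nonneg_nonneg) auto

lemma sym_weight_nonneg:
  assumes "\<And>i j. 1 \<le> i \<Longrightarrow> i < j \<Longrightarrow> j \<le> n \<Longrightarrow> 0 \<le> b i j" "x \<in> {1..n}" "y \<in> {1..n}"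
  shows "0 \<le> sym_weight b x y"
  using assms by (auto simp: sym_weight_def)

text \<open>Real variational data: \<open>c\<close> is the minimum of the Rayleigh quotient on
  functions of sum zero, attained at \<open>f\<close>.\<close>

definition is_perm_gap :: "nat \<Rightarrow> (nat \<Rightarrow> nat \<Rightarrow> real) \<Rightarrow> real \<Rightarrow> (nat \<Rightarrow> real) \<Rightarrow> bool" where
  "is_perm_gap n b c f \<longleftrightarrow> sum f {1..n} = 0 \<and> (\<exists>x\<in>{1..n}. f x \<noteq> 0)
    \<and> (\<forall>x\<in>{1..n}. vertex_lap n b (\<lambda>_. 0) f x = c * f x)
    \<and> (\<forall>h. sum h {1..n} = 0 \<longrightarrow> c * (\<Sum>x\<in>{1..n}. (h x)\<^sup>2) \<le> vertex_energy {1..n} (sym_weight b) h)"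

definition is_defining_gap :: "nat \<Rightarrow> (nat \<Rightarrow> real) \<Rightarrow> (nat \<Rightarrow> nat \<Rightarrow> real) \<Rightarrow> real \<Rightarrow> (nat \<Rightarrow> real) \<Rightarrow> bool" where
  "is_defining_gap n a b c f \<longleftrightarrow> (\<exists>x\<in>{1..n}. f x \<noteq> 0)
    \<and> (\<forall>x\<in>{1..n}. vertex_lap n b (\<lambda>x. 2 * a x) f x = c * f x)
    \<and> (\<forall>h. c * (\<Sum>x\<in>{1..n}. (h x)\<^sup>2)
        \<le> vertex_energy {1..n} (sym_weight b) h + (\<Sum>x\<in>{1..n}. 2 * a x * (h x)\<^sup>2))"

lemma ex_perm_gap:
  assumes "n \<ge> 2"
  obtains c f where "is_perm_gap n b c f"
proof -
  interpret rw: walk "{1..n}" "{1..n} \<times> {1..n}" "\<lambda>(x, y). transpose x y" "\<lambda>(x, y). sym_weight b x y / 2" "\<lambda>_. 0"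
    by (rule vertex_walk) simp
  \<comment> \<open>This witness shows that the space of functions of sum zero is nonzero, which
    takes two vertices.\<close>
  define f0 where "f0 = (\<lambda>x :: nat. if x = 1 then 1 else if x = 2 then - 1 else (0::real))"
  have "sum f0 {1..n} = sum f0 {1, 2}"
    using assms by (intro sum.mono_neutral_right) (auto simp: f0_def)
  then have f0: "(\<Sum>x\<in>{1..n}. 1 * f0 x) = 0" by (simp add: f0_def)
  obtain f c where "(\<Sum>x\<in>{1..n}. 1 * f x) = 0" "\<exists>x\<in>{1..n}. f x \<noteq> 0" "\<And>x. x \<in> {1..n} \<Longrightarrow> rw.lap f x = c * f x"
    "\<And>h. (\<Sum>x\<in>{1..n}. 1 * h x) = 0 \<Longrightarrow> c * (\<Sum>x\<in>{1..n}. (h x)\<^sup>2) \<le> rw.energy h"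
  proof (rule rw.min_eigenfunction[of "\<lambda>_. 1" f0 1])
    show "(\<Sum>x\<in>{1..n}. 1 * rw.lap h x) = 0" for h :: "nat \<Rightarrow> real"
      unfolding rw.sum_mult_lap by simp
  qed (use f0 assms in \<open>auto simp: f0_def\<close>)
  then have "is_perm_gap n b c f"
    using vertex_walk_energy[of "{1..n}" "sym_weight b" "\<lambda>_. 0"] by (simp add: is_perm_gap_def)
  then show thesis by (rule that)
qed

lemma ex_defining_gap:
  assumes "n \<ge> 1"
  obtains c f where "is_defining_gap n a b c f"
proof -
  interpret rw: walk "{1..n}" "{1..n} \<times> {1..n}" "\<lambda>(x, y). transpose x y" "\<lambda>(x, y). sym_weight b x y / 2" "\<lambda>x. 2 * a x"
    by (rule vertex_walk) simp
  obtain f c where "\<exists>x\<in>{1..n}. f x \<noteq> 0" "\<And>x. x \<in> {1..n} \<Longrightarrow> rw.lap f x = c * f x"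
    "\<And>h. c * (\<Sum>x\<in>{1..n}. (h x)\<^sup>2) \<le> rw.energy h"
    using assms by (rule_tac rw.min_eigenfunction[of "\<lambda>_. 0" "\<lambda>_. 1" 1]) auto
  then have "is_defining_gap n a b c f"
    using vertex_walk_energy[of "{1..n}" "sym_weight b" "\<lambda>x. 2 * a x"] by (simp add: is_defining_gap_def)
  then show thesis by (rule that)
qed

lemma perm_gap_energy:
  assumes "is_perm_gap n b c f"
  shows "c * (\<Sum>x\<in>{1..n}. (f x)\<^sup>2) = vertex_energy {1..n} (sym_weight b) f"
proof -
  interpret rw: walk "{1..n}" "{1..n} \<times> {1..n}" "\<lambda>(x, y). transpose x y" "\<lambda>(x, y). sym_weight b x y / 2" "\<lambda>_. 0"
    by (rule vertex_walk) simp
  have "rw.energy f = (\<Sum>x\<in>{1..n}. f x * (c * f x))"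
    using assms unfolding rw.sum_mult_lap_self[symmetric] is_perm_gap_def by (intro sum.cong) auto
  then show ?thesis
    using vertex_walk_energy[of "{1..n}" "sym_weight b" "\<lambda>_. 0" f]
    by (simp add: sum_distrib_left power2_eq_square mult.left_commute)
qed

lemma defining_gap_energy:
  assumes "is_defining_gap n a b c f"
  shows "c * (\<Sum>x\<in>{1..n}. (f x)\<^sup>2) = vertex_energy {1..n} (sym_weight b) f + (\<Sum>x\<in>{1..n}. 2 * a x * (f x)\<^sup>2)"
proof -
  interpret rw: walk "{1..n}" "{1..n} \<times> {1..n}" "\<lambda>(x, y). transpose x y" "\<lambda>(x, y). sym_weight b x y / 2" "\<lambda>x. 2 * a x"
    by (rule vertex_walk) simp
  have "rw.energy f = (\<Sum>x\<in>{1..n}. f x * (c * f x))"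
    using assms unfolding rw.sum_mult_lap_self[symmetric] is_defining_gap_def by (intro sum.cong) auto
  then show ?thesis
    using vertex_walk_energy[of "{1..n}" "sym_weight b" "\<lambda>x. 2 * a x" f]
    by (simp add: sum_distrib_left power2_eq_square mult.left_commute)
qed

lemma sum_squares_pos:
  fixes f :: "'a \<Rightarrow> real"
  assumes "finite X" "\<exists>x\<in>X. f x \<noteq> 0"
  shows "0 < (\<Sum>x\<in>X. (f x)\<^sup>2)"
  using assms by (auto intro!: sum_pos2)

lemma perm_gap_nonneg:
  assumes gap: "is_perm_gap n b c f" and b: "\<And>i j. 1 \<le> i \<Longrightarrow> i < j \<Longrightarrow> j \<le> n \<Longrightarrow> 0 \<le> b i j"
  shows "0 \<le> c"
proof -
  have "0 \<le> c * (\<Sum>x\<in>{1..n}. (f x)\<^sup>2)"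
    unfolding perm_gap_energy[OF gap] using b by (intro vertex_energy_nonneg sym_weight_nonneg)
  moreover have "0 < (\<Sum>x\<in>{1..n}. (f x)\<^sup>2)"
    using gap by (intro sum_squares_pos) (auto simp: is_perm_gap_def)
  ultimately show ?thesis by (simp add: zero_le_mult_iff)
qed

text \<open>If \<open>c = 0\<close>, the eigenfunction has energy zero and is constant along edges,
  hence constant by connectivity. Sum zero then makes it vanish.\<close>

lemma perm_gap_pos:
  assumes gap: "is_perm_gap n b c f" and b: "\<And>i j. 1 \<le> i \<Longrightarrow> i < j \<Longrightarrow> j \<le> n \<Longrightarrow> 0 \<le> b i j"
    and conn: "connected_graph n b"
  shows "0 < c"
proof (rule ccontr)
  assume "\<not> 0 < c"
  then have "c = 0" using perm_gap_nonneg[OF gap b] by simp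
  then have E: "vertex_energy {1..n} (sym_weight b) f = 0"
    using perm_gap_energy[OF gap] by simp
  note nn = sym_weight_nonneg[where b = b and n = n, OF b]
  have term_zero: "sym_weight b x y * (f x - f y)\<^sup>2 = 0" if "x \<in> {1..n}" "y \<in> {1..n}" for x y
  proof -
    have "(\<Sum>x\<in>{1..n}. \<Sum>y\<in>{1..n}. sym_weight b x y * (f x - f y)\<^sup>2) = 0"
      using E by (simp add: vertex_energy_def)
    then have "(\<Sum>y\<in>{1..n}. sym_weight b x y * (f x - f y)\<^sup>2) = 0"
      using that nn by (subst (asm) sum_nonneg_eq_0_iff) (auto intro!: sum_nonneg)
    then show ?thesis
      using that nn by (subst (asm) sum_nonneg_eq_0_iff) auto
  qed
  have edge: "f x = f y" if "(x, y) \<in> edges n b" for x y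
    using that term_zero[of x y] by (auto simp: edges_def sym_weight_def)
  have const: "f x = f y" if "(x, y) \<in> (edges n b \<union> (edges n b)\<inverse>)\<^sup>*" for x y
    using that by (induction rule: rtrancl_induct) (auto dest: edge)
  obtain x0 where x0: "x0 \<in> {1..n}" "f x0 \<noteq> 0"
    using gap by (auto simp: is_perm_gap_def)
  have "sum f {1..n} = (\<Sum>x\<in>{1..n}. f x0)"
    using conn x0(1) by (intro sum.cong refl const) (auto simp: connected_graph_def)
  then show False using gap x0 by (simp add: is_perm_gap_def)
qed

lemma rep_gap_perm_eq:
  assumes "is_perm_gap n b c f"
  shows "rep_gap (hyperoctahedral n) (hyp_weight n a b) n (perm_rep n) = ereal c"
  using assms unfolding is_perm_gap_def by (auto intro: rep_gap_perm)

lemma rep_gap_defining_eq: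
  assumes "is_defining_gap n a b c f"
  shows "rep_gap (hyperoctahedral n) (hyp_weight n a b) n (defining_rep n) = ereal c"
  using assms unfolding is_defining_gap_def by (auto intro: rep_gap_defining)

text \<open>Both representations compete in the infimum, which gives the upper bound. For the lower
  bound, a matrix coefficient of a non-invariant eigenvector is a nonconstant eigenfunction on the
  group.\<close>

theorem spectral_gap_hyperoctahedral:
  assumes a: "\<And>i. i \<in> {1..n} \<Longrightarrow> 0 \<le> a i" and b: "\<And>i j. 1 \<le> i \<Longrightarrow> i < j \<Longrightarrow> j \<le> n \<Longrightarrow> 0 \<le> b i j"
    and k: "is_perm_gap n b k f" and m: "is_defining_gap n a b m f'"
  shows "spectral_gap (hyperoctahedral n) (hyp_weight n a b) = ereal (min k m)"
proof (rule antisym)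
  let ?G = "hyperoctahedral n" and ?w = "hyp_weight n a b"
  have "spectral_gap ?G ?w \<le> rep_gap ?G ?w n (perm_rep n)" "spectral_gap ?G ?w \<le> rep_gap ?G ?w n (defining_rep n)"
    unfolding spectral_gap_def using representation_perm_rep representation_defining_rep
    by (auto intro!: Inf_lower)
  then show "spectral_gap ?G ?w \<le> ereal (min k m)"
    by (simp add: rep_gap_perm_eq[OF k] rep_gap_defining_eq[OF m] min_def)
  show "ereal (min k m) \<le> spectral_gap ?G ?w"
    unfolding spectral_gap_def
  proof (rule Inf_greatest, clarify)
    fix d R assume rep: "representation ?G d R"
    have "min k m \<le> Re z"
      if z: "eigenvalue (laplacian ?G ?w d R) z" "\<not> trivial_eigenvalue ?G ?w d R z" for z
    proof -
      obtain v where v: "v \<in> carrier_vec d" "laplacian ?G ?w d R *\<^sub>v v = z \<cdot>\<^sub>v v" "\<not> invariant_vec ?G R v"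
        using nontrivial_eigenvector[OF z] by metis
      then obtain g where g: "g \<in> signed_perms {1..n}" "R g *\<^sub>v v \<noteq> v"
        unfolding invariant_vec_def carrier_hyperoctahedral by blast
      have one: "(\<lambda>_. 0, id) \<in> signed_perms {1..n}"
        by (simp add: bits_def permutes_id)
      have R1: "R (\<lambda>_. 0, id) *\<^sub>v v = v"
        using rep v(1) by (simp add: representation_def one_hyperoctahedral)
      have "R g \<in> carrier_mat d d"
        using rep g(1) unfolding representation_def carrier_hyperoctahedral by blast
      \<comment> \<open>A coordinate changed by \<open>R g\<close> makes the coefficient differ at
        \<open>g\<close> and at the identity.\<close>
      then obtain i where i: "i < d" "(R g *\<^sub>v v) $ i \<noteq> v $ i"
        using g(2) v(1) by (metis carrier_vecD eq_vecI mult_mat_vec_carrier)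
      show ?thesis
      proof (rule signed_eigenvalue_ge)
        show "(R g *\<^sub>v v) $ i \<noteq> (R (\<lambda>_. 0, id) *\<^sub>v v) $ i" using i(2) R1 by simp
        show "walk.lap ({1..n} <+> {1..n} \<times> {1..n}) signed_step (case_sum a (\<lambda>(x, y). sym_weight b x y / 2)) (\<lambda>_. 0)
            (\<lambda>g. (R g *\<^sub>v v) $ i) h = z * (R h *\<^sub>v v) $ i" if "h \<in> signed_perms {1..n}" for h
          using rep v(1) i(1) v(2) that by (rule matrix_coefficient_eigenfunction)
        show "0 \<le> k" by (rule perm_gap_nonneg[OF k b])
        show "0 \<le> sym_weight b x y" if "x \<in> {1..n}" "y \<in> {1..n}" for x y
          using b that by (rule sym_weight_nonneg)
      qed (use a g(1) one k m in \<open>auto simp: is_perm_gap_def is_defining_gap_def sym_weight_commute\<close>)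
    qed
    then show "ereal (min k m) \<le> rep_gap ?G ?w d R"
      unfolding rep_gap_def by (intro INF_greatest ereal_less_eq(3)[THEN iffD2]) blast
  qed
qed

section \<open>Scaling and small parameters\<close>

lemma swap_weight_scale: "swap_weight n (\<lambda>i j. r * b i j) g = r * swap_weight n b g"
  unfolding swap_weight_def sum_distrib_left by (intro sum.cong) auto

lemma sign_weight_scale: "sign_weight n (\<lambda>i. r * a i) g = r * sign_weight n a g"
  unfolding sign_weight_def sum_distrib_left by (intro sum.cong) auto

lemma vertex_energy_scale:
  "vertex_energy V (sym_weight (\<lambda>i j. r * b i j)) h = r * vertex_energy V (sym_weight b) h"
proof -
  have "sym_weight (\<lambda>i j. r * b i j) x y = r * sym_weight b x y" for x y
    by (simp add: sym_weight_def)
  then show ?thesis by (simp add: vertex_energy_def sum_distrib_left mult.assoc)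
qed

definition gap_attained_by ::
    "nat \<Rightarrow> (signed_perm \<Rightarrow> real) \<Rightarrow> (signed_perm \<Rightarrow> complex mat) \<Rightarrow> (signed_perm \<Rightarrow> complex mat) \<Rightarrow> bool" where
  "gap_attained_by n w R R' \<longleftrightarrow>
     spectral_gap (hyperoctahedral n) w = rep_gap (hyperoctahedral n) w n R
     \<and> rep_gap (hyperoctahedral n) w n R < rep_gap (hyperoctahedral n) w n R'"

text \<open>A fixed test function bounds the permutation gap \<open>c\<close> by a multiple of
  \<open>e\<close>, while dropping the transposition energy leaves \<open>2 * m \<le> c'\<close>
  with \<open>m\<close> the least sign weight.\<close>

lemma small_swaps:
  assumes n: "n \<ge> 2" and a: "\<And>i. i \<in> {1..n} \<Longrightarrow> 0 < a i"
    and b: "\<And>i j. 1 \<le> i \<Longrightarrow> i < j \<Longrightarrow> j \<le> n \<Longrightarrow> 0 \<le> b i j"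
  obtains r where "0 < r" "\<And>e. 0 < e \<Longrightarrow> e < r \<Longrightarrow>
    gap_attained_by n (\<lambda>g. sign_weight n a g + e * swap_weight n b g) (perm_rep n) (defining_rep n)"
proof -
  define h :: "nat \<Rightarrow> real" where "h = (\<lambda>x. if x = 1 then 1 else if x = 2 then - 1 else 0)"
  have "(\<Sum>x\<in>{1..n}. g (h x)) = (\<Sum>x\<in>{1, 2}. g (h x))" if "g 0 = 0" for g :: "real \<Rightarrow> real"
    using n that by (intro sum.mono_neutral_right) (auto simp: h_def)
  from this[of "\<lambda>x. x"] this[of "\<lambda>x. x\<^sup>2"]
  have h: "sum h {1..n} = 0" "(\<Sum>x\<in>{1..n}. (h x)\<^sup>2) = 2" by (simp_all add: h_def)
  have n1: "n \<ge> 1" using n by simp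
  define E where "E = vertex_energy {1..n} (sym_weight b) h"
  have E: "0 \<le> E" unfolding E_def using b by (intro vertex_energy_nonneg sym_weight_nonneg)
  define m where "m = Min (a ` {1..n})"
  have m: "m \<le> a i" if "i \<in> {1..n}" for i using that by (simp add: m_def)
  have m0: "0 < m" using a n by (simp add: m_def)
  show thesis
  proof (rule that)
    \<comment> \<open>Below this threshold \<open>c \<le> e * E / 2 < 2 * m\<close>; the added
      \<open>1\<close> covers \<open>E = 0\<close>.\<close>
    show "0 < 4 * m / (E + 1)" using m0 E by simp
    fix e :: real assume e: "0 < e" "e < 4 * m / (E + 1)"
    let ?b = "\<lambda>i j. e * b i j"
    have b': "0 \<le> ?b i j" if "1 \<le> i" "i < j" "j \<le> n" for i j using b[OF that] e by simp
    obtain c f where c: "is_perm_gap n ?b c f" using ex_perm_gap[OF n] .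
    obtain c' f' where c': "is_defining_gap n a ?b c' f'" using ex_defining_gap[OF n1] .
    have "c * 2 \<le> e * E"
      using c h(1) unfolding is_perm_gap_def E_def vertex_energy_scale[symmetric] h(2)[symmetric] by blast
    moreover have "e * E + e < 4 * m"
      using e E by (simp add: pos_less_divide_eq distrib_left)
    ultimately have "c < 2 * m" using e by linarith
    moreover have "2 * m \<le> c'"
    proof -
      have "2 * m * (\<Sum>x\<in>{1..n}. (f' x)\<^sup>2) \<le> (\<Sum>x\<in>{1..n}. 2 * a x * (f' x)\<^sup>2)"
        unfolding sum_distrib_left using m by (intro sum_mono mult_right_mono) auto
      also have "\<dots> \<le> c' * (\<Sum>x\<in>{1..n}. (f' x)\<^sup>2)"
        unfolding defining_gap_energy[OF c'] using b'
        by (intro le_add_same_cancel2[THEN iffD2] vertex_energy_nonneg sym_weight_nonneg)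
      finally have "2 * m * (\<Sum>x\<in>{1..n}. (f' x)\<^sup>2) \<le> c' * (\<Sum>x\<in>{1..n}. (f' x)\<^sup>2)" .
      moreover have "0 < (\<Sum>x\<in>{1..n}. (f' x)\<^sup>2)"
        using c' by (intro sum_squares_pos) (auto simp: is_defining_gap_def)
      ultimately show ?thesis by simp
    qed
    ultimately have lt: "c < c'" by simp
    have "spectral_gap (hyperoctahedral n) (hyp_weight n a ?b) = ereal (min c c')"
      using a b' c c' by (intro spectral_gap_hyperoctahedral) (auto simp: less_imp_le)
    then show "gap_attained_by n (\<lambda>g. sign_weight n a g + e * swap_weight n b g) (perm_rep n) (defining_rep n)"
      using lt rep_gap_perm_eq[OF c, of a] rep_gap_defining_eq[OF c']
      by (simp add: gap_attained_by_def swap_weight_scale min_def)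
  qed
qed

text \<open>The constant function has no transposition energy, so the defining gap \<open>c'\<close>
  is at most \<open>e * S / n\<close>. The permutation gap \<open>c\<close> is positive by
  connectivity and independent of \<open>e\<close>.\<close>

lemma small_sign_changes:
  assumes n: "n \<ge> 2" and a: "\<And>i. i \<in> {1..n} \<Longrightarrow> 0 < a i"
    and b: "\<And>i j. 1 \<le> i \<Longrightarrow> i < j \<Longrightarrow> j \<le> n \<Longrightarrow> 0 \<le> b i j" and conn: "connected_graph n b"
  obtains r where "0 < r" "\<And>e. 0 < e \<Longrightarrow> e < r \<Longrightarrow>
    gap_attained_by n (\<lambda>g. e * sign_weight n a g + swap_weight n b g) (defining_rep n) (perm_rep n)"
proof -
  obtain c f where c: "is_perm_gap n b c f" using ex_perm_gap[OF n] .
  have c0: "0 < c" by (rule perm_gap_pos[OF c b conn])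
  have n1: "n \<ge> 1" using n by simp
  define S where "S = (\<Sum>i\<in>{1..n}. 2 * a i)"
  have S: "0 \<le> S" unfolding S_def using a by (intro sum_nonneg) (auto simp: less_imp_le)
  show thesis
  proof (rule that)
    show "0 < c / (S + 1)" using c0 S by simp
    fix e :: real assume e: "0 < e" "e < c / (S + 1)"
    let ?a = "\<lambda>i. e * a i"
    have a': "0 \<le> ?a i" if "i \<in> {1..n}" for i using a[OF that] e by simp
    obtain c' f' where c': "is_defining_gap n ?a b c' f'" using ex_defining_gap[OF n1] .
    have "c' * (\<Sum>x\<in>{1..n}. 1\<^sup>2) \<le> vertex_energy {1..n} (sym_weight b) (\<lambda>_. 1) + (\<Sum>x\<in>{1..n}. 2 * ?a x * 1\<^sup>2)"
      using c'[unfolded is_defining_gap_def, THEN conjunct2, THEN conjunct2, THEN spec, of "\<lambda>_. 1"] .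
    then have "c' * n \<le> e * S"
      by (simp add: vertex_energy_def S_def sum_distrib_left mult.left_commute)
    \<comment> \<open>This removes the factor \<open>n\<close>; a nonpositive \<open>c'\<close> is
      below \<open>c\<close> anyway.\<close>
    moreover have "c' \<le> c' * n \<or> c' \<le> 0"
      using n by (cases "c' \<le> 0") (auto simp: mult_le_cancel_left1)
    moreover have "e * S + e < c"
      using e S by (simp add: pos_less_divide_eq distrib_left)
    ultimately have lt: "c' < c" using e c0 by linarith
    have "spectral_gap (hyperoctahedral n) (hyp_weight n ?a b) = ereal (min c c')"
      using a' b c c' by (intro spectral_gap_hyperoctahedral) auto
    then show "gap_attained_by n (\<lambda>g. e * sign_weight n a g + swap_weight n b g) (defining_rep n) (perm_rep n)"
      using lt rep_gap_perm_eq[OF c, of ?a] rep_gap_defining_eq[OF c']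
      by (simp add: gap_attained_by_def sign_weight_scale min_def)
  qed
qed

theorem mainTheorem2:
  fixes n :: nat
  assumes "n \<ge> 2"
  shows
    "(\<forall>(a :: nat \<Rightarrow> real) (b :: nat \<Rightarrow> nat \<Rightarrow> real).
        (\<forall>i\<in>{1..n}. a i > 0) \<longrightarrow>
        (\<forall>i j. 1 \<le> i \<and> i < j \<and> j \<le> n \<longrightarrow> b i j \<ge> 0) \<longrightarrow>
        connected_graph n b \<longrightarrow>
        (\<exists>\<epsilon>\<^sub>0::real. \<epsilon>\<^sub>0 > 0 \<and> (\<forall>\<epsilon>::real. 0 < \<epsilon> \<and> \<epsilon> < \<epsilon>\<^sub>0 \<longrightarrow>
          (let W = hyperoctahedral n;
               w\<^sub>1 = (\<lambda>g. sign_weight n a g + \<epsilon> * swap_weight n b g);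
               w\<^sub>2 = (\<lambda>g. \<epsilon> * sign_weight n a g + swap_weight n b g)
           in spectral_gap W w\<^sub>1 = rep_gap W w\<^sub>1 n (perm_rep n) \<and>
              rep_gap W w\<^sub>1 n (perm_rep n) < rep_gap W w\<^sub>1 n (defining_rep n) \<and>
              spectral_gap W w\<^sub>2 = rep_gap W w\<^sub>2 n (defining_rep n) \<and>
              rep_gap W w\<^sub>2 n (defining_rep n) < rep_gap W w\<^sub>2 n (perm_rep n)))))
     \<and> \<not> (\<forall>(a :: nat \<Rightarrow> real) (b :: nat \<Rightarrow> nat \<Rightarrow> real).
            (\<forall>i\<in>{1..n}. a i \<ge> 0) \<longrightarrow>
            (\<forall>i j. 1 \<le> i \<and> i < j \<and> j \<le> n \<longrightarrow> b i j \<ge> 0) \<longrightarrow>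
            (let W = hyperoctahedral n; w = (\<lambda>g. sign_weight n a g + swap_weight n b g)
             in spectral_gap W w = rep_gap W w n (defining_rep n)))
     \<and> \<not> (\<forall>(a :: nat \<Rightarrow> real) (b :: nat \<Rightarrow> nat \<Rightarrow> real).
            (\<forall>i\<in>{1..n}. a i \<ge> 0) \<longrightarrow>
            (\<forall>i j. 1 \<le> i \<and> i < j \<and> j \<le> n \<longrightarrow> b i j \<ge> 0) \<longrightarrow>
            (let W = hyperoctahedral n; w = (\<lambda>g. sign_weight n a g + swap_weight n b g)
             in spectral_gap W w = rep_gap W w n (perm_rep n)))"
proof -
  have gaps: "\<exists>\<epsilon>\<^sub>0::real. \<epsilon>\<^sub>0 > 0 \<and> (\<forall>\<epsilon>::real. 0 < \<epsilon> \<and> \<epsilon> < \<epsilon>\<^sub>0 \<longrightarrow>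
      gap_attained_by n (\<lambda>g. sign_weight n a g + \<epsilon> * swap_weight n b g) (perm_rep n) (defining_rep n)
      \<and> gap_attained_by n (\<lambda>g. \<epsilon> * sign_weight n a g + swap_weight n b g) (defining_rep n) (perm_rep n))"
    if a: "\<forall>i\<in>{1..n}. a i > 0" and b: "\<forall>i j. 1 \<le> i \<and> i < j \<and> j \<le> n \<longrightarrow> b i j \<ge> 0"
      and conn: "connected_graph n b" for a b
  proof -
    obtain r where r: "0 < r" "\<And>e. 0 < e \<Longrightarrow> e < r \<Longrightarrow>
        gap_attained_by n (\<lambda>g. sign_weight n a g + e * swap_weight n b g) (perm_rep n) (defining_rep n)"
      using small_swaps[OF assms, of a b] a b by blast
    obtain r' where r': "0 < r'" "\<And>e. 0 < e \<Longrightarrow> e < r' \<Longrightarrow>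
        gap_attained_by n (\<lambda>g. e * sign_weight n a g + swap_weight n b g) (defining_rep n) (perm_rep n)"
      using small_sign_changes[OF assms, of a b] a b conn by blast
    show ?thesis using r r' by (intro exI[of _ "min r r'"]) simp
  qed
  \<comment> \<open>Unit weights on the complete graph, with one part scaled by a small
    \<open>e\<close>, refute each of the two identities.\<close>
  define u :: "nat \<Rightarrow> real" where "u = (\<lambda>_. 1)"
  define v :: "nat \<Rightarrow> nat \<Rightarrow> real" where "v = (\<lambda>_ _. 1)"
  have "connected_graph n v"
    unfolding connected_graph_def
  proof (intro ballI)
    fix i j assume ij: "i \<in> {1..n}" "j \<in> {1..n}"
    show "(i, j) \<in> (edges n v \<union> (edges n v)\<inverse>)\<^sup>*"
    proof (cases "i = j")
      case False
      then have "(i, j) \<in> edges n v \<union> (edges n v)\<inverse>"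
        using ij by (auto simp: edges_def v_def)
      then show ?thesis by blast
    qed simp
  qed
  with gaps[of u v] obtain r where r: "0 < r" "\<And>e. 0 < e \<Longrightarrow> e < r \<Longrightarrow>
      gap_attained_by n (\<lambda>g. sign_weight n u g + e * swap_weight n v g) (perm_rep n) (defining_rep n)
      \<and> gap_attained_by n (\<lambda>g. e * sign_weight n u g + swap_weight n v g) (defining_rep n) (perm_rep n)"
    by (auto simp: u_def v_def)
  define e where "e = r / 2"
  have e: "0 < e" "e < r" using r(1) by (simp_all add: e_def)
  \<comment> \<open>The factor \<open>e\<close> moves into the coefficients, so that the strict
    inequalities concern weights of the form in the identities.\<close>
  note strict = r(2)[OF e, unfolded gap_attained_by_def, folded swap_weight_scale sign_weight_scale]
  have nonneg: "0 \<le> u i" "0 \<le> e * u i" "0 \<le> v i j" "0 \<le> e * v i j" for i j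
    using e by (simp_all add: u_def v_def)
  show ?thesis
    unfolding Let_def
  proof (intro conjI allI impI notI)
    fix a :: "nat \<Rightarrow> real" and b :: "nat \<Rightarrow> nat \<Rightarrow> real"
    assume "\<forall>i\<in>{1..n}. a i > 0" "\<forall>i j. 1 \<le> i \<and> i < j \<and> j \<le> n \<longrightarrow> b i j \<ge> 0" "connected_graph n b"
    from gaps[OF this] show "\<exists>\<epsilon>\<^sub>0::real. \<epsilon>\<^sub>0 > 0 \<and> (\<forall>\<epsilon>::real. 0 < \<epsilon> \<and> \<epsilon> < \<epsilon>\<^sub>0 \<longrightarrow>
        spectral_gap (hyperoctahedral n) (\<lambda>g. sign_weight n a g + \<epsilon> * swap_weight n b g)
          = rep_gap (hyperoctahedral n) (\<lambda>g. sign_weight n a g + \<epsilon> * swap_weight n b g) n (perm_rep n)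
        \<and> rep_gap (hyperoctahedral n) (\<lambda>g. sign_weight n a g + \<epsilon> * swap_weight n b g) n (perm_rep n)
          < rep_gap (hyperoctahedral n) (\<lambda>g. sign_weight n a g + \<epsilon> * swap_weight n b g) n (defining_rep n)
        \<and> spectral_gap (hyperoctahedral n) (\<lambda>g. \<epsilon> * sign_weight n a g + swap_weight n b g)
          = rep_gap (hyperoctahedral n) (\<lambda>g. \<epsilon> * sign_weight n a g + swap_weight n b g) n (defining_rep n)
        \<and> rep_gap (hyperoctahedral n) (\<lambda>g. \<epsilon> * sign_weight n a g + swap_weight n b g) n (defining_rep n)
          < rep_gap (hyperoctahedral n) (\<lambda>g. \<epsilon> * sign_weight n a g + swap_weight n b g) n (perm_rep n))"
      unfolding gap_attained_by_def conj_assoc .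
  next
    assume H: "\<forall>a b. (\<forall>i\<in>{1..n}. a i \<ge> 0) \<longrightarrow> (\<forall>i j. 1 \<le> i \<and> i < j \<and> j \<le> n \<longrightarrow> b i j \<ge> 0) \<longrightarrow>
      spectral_gap (hyperoctahedral n) (hyp_weight n a b)
        = rep_gap (hyperoctahedral n) (hyp_weight n a b) n (defining_rep n)"
    have "spectral_gap (hyperoctahedral n) (hyp_weight n u (\<lambda>i j. e * v i j))
        = rep_gap (hyperoctahedral n) (hyp_weight n u (\<lambda>i j. e * v i j)) n (defining_rep n)"
      by (rule H[rule_format]) (use nonneg in auto)
    then show False using strict by simp
  next
    assume H: "\<forall>a b. (\<forall>i\<in>{1..n}. a i \<ge> 0) \<longrightarrow> (\<forall>i j. 1 \<le> i \<and> i < j \<and> j \<le> n \<longrightarrow> b i j \<ge> 0) \<longrightarrow>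
      spectral_gap (hyperoctahedral n) (hyp_weight n a b)
        = rep_gap (hyperoctahedral n) (hyp_weight n a b) n (perm_rep n)"
    have "spectral_gap (hyperoctahedral n) (hyp_weight n (\<lambda>i. e * u i) v)
        = rep_gap (hyperoctahedral n) (hyp_weight n (\<lambda>i. e * u i) v) n (perm_rep n)"
      by (rule H[rule_format]) (use nonneg in auto)
    then show False using strict by simp
  qed
qed

end
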